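(* Let $\mathbb{L}$ be a complete, algebraically closed non-Archimedean field of characteristic $0$ and let $\phi$ be a rational map over $\mathbb{L}$ of degree $d\geq 2$ with potential good reduction. Let $\xi$ be the unique type $2$ point of $\mathbb{P}^1_{an}$ which is fixed by $\phi$ and totally ramified for $\phi$. Then every direction $\vec v\in T_\xi\mathbb{P}^1_{an}$ with $(T_\xi\phi)(\vec v)=\vec v$ satisfies $m_\phi(\xi,\vec v)\geq 2$ if and only if the fixed point locus $\{\zeta\in\mathbb{P}^1_{an}:\phi(\zeta)=\zeta\}$ of $\phi$ is a finite set. In this case, the fixed point locus of $\phi$ consists of the type $1$ fixed points of $\phi$ (i.e. its fixed points in $\mathbb{P}^1(\mathbb{L})$) together with $\xi$.
   Context: $\mathbb{P}^1_{an}$ is the Berkovich projective line over $\mathbb{L}$; type $1$ points are the points of $\mathbb{P}^1(\mathbb{L})$, type $2$ points correspond to closed disks $D(a,r)$ with $r\in|\mathbb{L}^\times|$. Potential good reduction: some Möbius conjugate $\sigma\circ\phi\circ\sigma^{-1}$, $\sigma\in PGL_2(\mathbb{L})$, written in normalized form (coprime numerator and denominator, coefficients in the valuation ring, not all in the maximal ideal), has reduction modulo the maximal ideal of degree $\deg\phi$. $m_\phi(\zeta)$ is the multiplicity (local degree) of $\phi$ at $\zeta$; $\zeta$ is totally ramified if $m_\phi(\zeta)=d$. $T_\zeta\mathbb{P}^1_{an}$ is the set of directions (connected components of $\mathbb{P}^1_{an}\setminus\{\zeta\}$) at $\zeta$, $T_\zeta\phi$ the induced map on directions, and $m_\phi(\zeta,\vec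 v)$ the directional multiplicity. Directions $\vec v$ at $\xi$ with $(T_\xi\phi)(\vec v)=\vec v$ are called residually fixed, and residually critical if moreover $m_\phi(\xi,\vec v)\ge 2$. Such $\xi$ exists and is unique for maps with potential good reduction. *)

theory Defs
  imports "HOL-Computational_Algebra.Polynomial" "HOL-Analysis.Analysis"
begin

definition nonarch_abs :: "('a::field \<Rightarrow> real) \<Rightarrow> bool" where
  "nonarch_abs av \<longleftrightarrow>
     (\<forall>x. av x \<ge> 0) \<and> (\<forall>x. av x = 0 \<longleftrightarrow> x = 0) \<and>
     (\<forall>x y. av (x * y) = av x * av y) \<and>
     (\<forall>x y. av (x + y) \<le> max (av x) (av y)) \<and>
     (\<exists>x. x \<noteq> 0 \<and> av x \<noteq> 1)"

definition complete_abs :: "('a::field \<Rightarrow> real) \<Rightarrow> bool" where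
  "complete_abs av \<longleftrightarrow>
     (\<forall>X :: nat \<Rightarrow> 'a. (\<forall>e>0. \<exists>N. \<forall>m\<ge>N. \<forall>n\<ge>N. av (X m - X n) < e) \<longrightarrow>
        (\<exists>l. \<forall>e>0. \<exists>N. \<forall>n\<ge>N. av (X n - l) < e))"

definition alg_closed :: "'a::field itself \<Rightarrow> bool" where
  "alg_closed _ \<longleftrightarrow> (\<forall>p :: 'a poly. degree p > 0 \<longrightarrow> (\<exists>x. poly p x = 0))"

definition char_zero_field :: "'a::field itself \<Rightarrow> bool" where
  "char_zero_field _ \<longleftrightarrow> (\<forall>n::nat. n > 0 \<longrightarrow> of_nat n \<noteq> (0::'a))"

definition ground_field :: "('a::field \<Rightarrow> real) \<Rightarrow> bool" where
  "ground_field av \<longleftrightarrow> nonarch_abs av \<and> complete_abs av \<and>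
     alg_closed TYPE('a) \<and> char_zero_field TYPE('a)"

text \<open>Points of the Berkovich affine line are multiplicative seminorms on L[T]
  extending av; the Berkovich projective line adds the point Infty.\<close>

type_synonym 'a bpt = "('a poly \<Rightarrow> real) option"

abbreviation Infty :: "'a bpt" where "Infty \<equiv> None"
abbreviation Fin :: "('a poly \<Rightarrow> real) \<Rightarrow> 'a bpt" where "Fin s \<equiv> Some s" 

definition mseminorm :: "('a::field \<Rightarrow> real) \<Rightarrow> ('a poly \<Rightarrow> real) \<Rightarrow> bool" where
  "mseminorm av s \<longleftrightarrow> (\<forall>p. s p \<ge> 0) \<and> (\<forall>c. s [:c:] = av c) \<and>
     (\<forall>p q. s (p * q) = s p * s q) \<and> (\<forall>p q. s (p + q) \<le> max (s p) (s q))"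

definition berk :: "('a::field \<Rightarrow> real) \<Rightarrow> 'a bpt set" where
  "berk av = insert Infty (Fin ` {s. mseminorm av s})"

text \<open>Weak topology on the affine part (pointwise convergence of seminorms),
  neighbourhoods of Infty of the form {|T| > R}: the one-point compactification.\<close>
definition berk_top :: "('a::field \<Rightarrow> real) \<Rightarrow> 'a bpt topology" where
  "berk_top av = subtopology
     (topology_generated_by
        ({ {z. \<exists>s. z = Fin s \<and> s f \<in> U} | f U. open U } \<union>
         { {z. z = Infty \<or> (\<exists>s. z = Fin s \<and> s [:0, 1:] > R)} | R. True }))
     (berk av)"

definition type1_pt :: "('a::field \<Rightarrow> real) \<Rightarrow> 'a \<Rightarrow> 'a bpt" where
  "type1_pt av a = Fin (\<lambda>f. av (poly f a))"

definition type1_set :: "('a::field \<Rightarrow> real) \<Rightarrow> 'a bpt set" where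
  "type1_set av = insert Infty (range (type1_pt av))"

definition disk_pt :: "('a::field \<Rightarrow> real) \<Rightarrow> 'a \<Rightarrow> real \<Rightarrow> 'a bpt" where
  "disk_pt av a r =
     Fin (\<lambda>f. Max ((\<lambda>i. av (coeff (pcompose f [:a, 1:]) i) * r ^ i) ` {..degree f}))"

definition type2 :: "('a::field \<Rightarrow> real) \<Rightarrow> 'a bpt \<Rightarrow> bool" where
  "type2 av z \<longleftrightarrow> (\<exists>a r. r \<in> av ` (UNIV - {0}) \<and> z = disk_pt av a r)"

definition gauss_pt :: "('a::field \<Rightarrow> real) \<Rightarrow> 'a bpt" where
  "gauss_pt av = disk_pt av 0 1"

definition dirs :: "('a::field \<Rightarrow> real) \<Rightarrow> 'a bpt \<Rightarrow> 'a bpt set set" where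
  "dirs av z = connected_components_of (subtopology (berk_top av) (berk av - {z}))"

text \<open>A rational map is a pair (P,Q) of polynomials, phi = P/Q.\<close>
type_synonym 'a ratmap = "'a poly \<times> 'a poly"

definition rdeg :: "'a::field ratmap \<Rightarrow> nat" where
  "rdeg phi = max (degree (fst phi)) (degree (snd phi))"

text \<open>Homogenisation: hom n F U V = V^n F(U/V).\<close>
definition hom :: "nat \<Rightarrow> 'a::field poly \<Rightarrow> 'a poly \<Rightarrow> 'a poly \<Rightarrow> 'a poly" where
  "hom n F U V = (\<Sum>i\<le>n. smult (coeff F i) (U ^ i * V ^ (n - i)))"

definition comp_rm :: "'a::field ratmap \<Rightarrow> 'a ratmap \<Rightarrow> 'a ratmap" where
  "comp_rm phi psi =
     (hom (rdeg phi) (fst phi) (fst psi) (snd psi), hom (rdeg phi) (snd phi) (fst psi) (snd psi))"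

definition scale_rm :: "'a::field \<Rightarrow> 'a ratmap \<Rightarrow> 'a ratmap" where
  "scale_rm c phi = (smult c (fst phi), smult c (snd phi))"

definition mob_ok :: "'a::field \<times> 'a \<times> 'a \<times> 'a \<Rightarrow> bool" where
  "mob_ok m = (case m of (al, be, ga, de) \<Rightarrow> al * de - be * ga \<noteq> 0)"

definition mob :: "'a::field \<times> 'a \<times> 'a \<times> 'a \<Rightarrow> 'a ratmap" where
  "mob m = (case m of (al, be, ga, de) \<Rightarrow> ([:be, al:], [:de, ga:]))"

definition mob_inv :: "'a::field \<times> 'a \<times> 'a \<times> 'a \<Rightarrow> 'a \<times> 'a \<times> 'a \<times> 'a" where
  "mob_inv m = (case m of (al, be, ga, de) \<Rightarrow> (de, - be, - ga, al))"

definition conj_rm :: "'a::field \<times> 'a \<times> 'a \<times> 'a \<Rightarrow> 'a ratmap \<Rightarrow> 'a ratmap" where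
  "conj_rm s phi = comp_rm (mob s) (comp_rm phi (mob (mob_inv s)))"

text \<open>Action of a rational map on the Berkovich projective line:
  [f]_{phi(z)} = [f o phi]_z, with f o phi = hom (deg f) f P Q / Q^(deg f).\<close>
definition bact :: "('a::field \<Rightarrow> real) \<Rightarrow> 'a ratmap \<Rightarrow> 'a bpt \<Rightarrow> 'a bpt" where
  "bact av phi z =
     (case z of
        None \<Rightarrow> (if degree (fst phi) > degree (snd phi) then Infty
                  else type1_pt av (coeff (fst phi) (rdeg phi) / coeff (snd phi) (rdeg phi)))
      | Some s \<Rightarrow> (if s (snd phi) = 0 then Infty
                  else Fin (\<lambda>f. s (hom (degree f) f (fst phi) (snd phi)) / (s (snd phi)) ^ degree f)))"

definition fix_locus :: "('a::field \<Rightarrow> real) \<Rightarrow> 'a ratmap \<Rightarrow> 'a bpt set" where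
  "fix_locus av phi = {z \<in> berk av. bact av phi z = z}"

definition tmap :: "('a::field \<Rightarrow> real) \<Rightarrow> 'a ratmap \<Rightarrow> 'a bpt \<Rightarrow> 'a bpt set \<Rightarrow> 'a bpt set" where
  "tmap av phi z v = (THE w. w \<in> dirs av (bact av phi z) \<and>
      (\<exists>U. openin (berk_top av) U \<and> z \<in> U \<and> bact av phi ` (U \<inter> v) \<subseteq> w))"

section \<open>Reduction modulo the maximal ideal (via lifts to the valuation ring)\<close>

definition intp :: "('a::field \<Rightarrow> real) \<Rightarrow> 'a poly \<Rightarrow> bool" where
  "intp av p \<longleftrightarrow> (\<forall>i. av (coeff p i) \<le> 1)"

text \<open>p and q have the same reduction.\<close>
definition congm :: "('a::field \<Rightarrow> real) \<Rightarrow> 'a poly \<Rightarrow> 'a poly \<Rightarrow> bool" where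
  "congm av p q \<longleftrightarrow> (\<forall>i. av (coeff (p - q) i) < 1)"

text \<open>Degree of the reduction of an integral polynomial (0 if the reduction is 0).\<close>
definition red_degree :: "('a::field \<Rightarrow> real) \<Rightarrow> 'a poly \<Rightarrow> nat" where
  "red_degree av p = (if \<exists>i. av (coeff p i) = 1 then (GREATEST i. av (coeff p i) = 1) else 0)"

definition red_nonconst :: "('a::field \<Rightarrow> real) \<Rightarrow> 'a poly \<Rightarrow> bool" where
  "red_nonconst av h \<longleftrightarrow> (\<exists>i\<ge>1. av (coeff h i) = 1)"

text \<open>The reductions of A and B are coprime in the residue-field polynomial ring.\<close>
definition red_coprime :: "('a::field \<Rightarrow> real) \<Rightarrow> 'a poly \<Rightarrow> 'a poly \<Rightarrow> bool" where
  "red_coprime av A B \<longleftrightarrow> \<not> (\<exists>H S T. intp av H \<and> intp av S \<and> intp av T \<and>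
       red_nonconst av H \<and> congm av A (H * S) \<and> congm av B (H * T))"

definition normalized :: "('a::field \<Rightarrow> real) \<Rightarrow> 'a ratmap \<Rightarrow> bool" where
  "normalized av phi \<longleftrightarrow> coprime (fst phi) (snd phi) \<and> intp av (fst phi) \<and> intp av (snd phi) \<and>
     (\<exists>i. av (coeff (fst phi) i) = 1 \<or> av (coeff (snd phi) i) = 1)"

text \<open>Lifts (A,B) of the reduced map: reduction of phi = G*A / G*B with A, B coprime
  mod the maximal ideal, i.e. the reduced rational map is (red A)/(red B).\<close>
definition red_fact :: "('a::field \<Rightarrow> real) \<Rightarrow> 'a ratmap \<Rightarrow> 'a ratmap" where
  "red_fact av phi = (SOME (A, B). intp av A \<and> intp av B \<and> red_coprime av A B \<and>
      (\<exists>G. intp av G \<and> congm av (fst phi) (G * A) \<and> congm av (snd phi) (G * B)))"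

definition red_map_degree :: "('a::field \<Rightarrow> real) \<Rightarrow> 'a ratmap \<Rightarrow> nat" where
  "red_map_degree av phi = (case red_fact av phi of (A, B) \<Rightarrow>
      max (red_degree av A) (red_degree av B))"

definition good_reduction :: "('a::field \<Rightarrow> real) \<Rightarrow> 'a ratmap \<Rightarrow> bool" where
  "good_reduction av phi \<longleftrightarrow> normalized av phi \<and> red_map_degree av phi = rdeg phi"

definition potential_good_reduction :: "('a::field \<Rightarrow> real) \<Rightarrow> 'a ratmap \<Rightarrow> bool" where
  "potential_good_reduction av phi \<longleftrightarrow>
     (\<exists>s c. mob_ok s \<and> c \<noteq> 0 \<and> good_reduction av (scale_rm c (conj_rm s phi)))"

section \<open>Multiplicities at a type 2 point (algebraic reduction, Baker--Rumely)\<close>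

text \<open>Order of vanishing at the residue class of a (integral) of the reduction of R.\<close>
definition ord_red :: "('a::field \<Rightarrow> real) \<Rightarrow> 'a \<Rightarrow> 'a poly \<Rightarrow> nat" where
  "ord_red av a R = (GREATEST k. \<exists>S. intp av S \<and> congm av R ([:- a, 1:] ^ k * S))"

definition loc_data :: "('a::field \<Rightarrow> real) \<Rightarrow> 'a ratmap \<Rightarrow> 'a bpt \<Rightarrow>
    ('a \<times> 'a \<times> 'a \<times> 'a) \<times> ('a \<times> 'a \<times> 'a \<times> 'a) \<times> 'a" where
  "loc_data av phi z = (SOME (s, t, c). mob_ok s \<and> mob_ok t \<and> c \<noteq> 0 \<and>
      bact av (mob s) (gauss_pt av) = z \<and> bact av (mob t) (gauss_pt av) = bact av phi z \<and>
      normalized av (scale_rm c (comp_rm (mob (mob_inv t)) (comp_rm phi (mob s)))))"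

definition loc_map :: "('a::field \<Rightarrow> real) \<Rightarrow> 'a ratmap \<Rightarrow> 'a bpt \<Rightarrow> 'a ratmap" where
  "loc_map av phi z = (case loc_data av phi z of (s, t, c) \<Rightarrow>
      scale_rm c (comp_rm (mob (mob_inv t)) (comp_rm phi (mob s))))"

definition mult_pt :: "('a::field \<Rightarrow> real) \<Rightarrow> 'a ratmap \<Rightarrow> 'a bpt \<Rightarrow> nat" where
  "mult_pt av phi z = red_map_degree av (loc_map av phi z)"

text \<open>Directional multiplicity m_phi(z,v) at a type 2 point: the multiplicity of the reduced map
  at the residue point corresponding to v (v = s_*(direction of that residue point)).\<close>
definition dir_mult :: "('a::field \<Rightarrow> real) \<Rightarrow> 'a ratmap \<Rightarrow> 'a bpt \<Rightarrow> 'a bpt set \<Rightarrow> nat" where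
  "dir_mult av phi z v = (case loc_data av phi z of (s, t, c) \<Rightarrow>
     (case red_fact av (loc_map av phi z) of (A, B) \<Rightarrow>
       (let e = max (red_degree av A) (red_degree av B);
            x = (SOME x. x \<in> type1_set av \<and> x \<in> v);
            y = bact av (mob (mob_inv s)) x
        in if \<exists>a. y = type1_pt av a \<and> av a \<le> 1 then
             (let a = (SOME a. y = type1_pt av a) in
                ord_red av a (smult (poly B a) A - smult (poly A a) B))
           else
             ord_red av 0 (smult (coeff B e) (hom e A 1 [:0, 1:])
                            - smult (coeff A e) (hom e B 1 [:0, 1:])))))"

end

theory Submission
  imports Defs
begin

text \<open>
  Move \<open>xi\<close> to the Gauss point. Total ramification means that the conjugated map \<open>F/G\<close> has good
  reduction, so it maps residue disks into residue disks, and these are the directions at the Gauss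
  point: each of them is connected, because every seminorm is joined by its thickenings to the
  disks around the centre. A fixed point other than \<open>xi\<close> lies in a residually fixed direction,
  which a further element of \<open>PGL\<^sub>2\<close> of the valuation ring moves to the open unit disk. There
  \<open>F/G\<close> has coefficients with \<open>|F\<^sub>0| < 1\<close>, \<open>|G\<^sub>0| = 1\<close>, and the multiplicity is at least 2 iff
  \<open>|F\<^sub>1| < 1\<close>. If \<open>|F\<^sub>1| = 1\<close>, every disk \<open>D(0, r)\<close> with \<open>|F\<^sub>0| \<le> r < 1\<close> is fixed. If \<open>|F\<^sub>1| < 1\<close>,
  there is an attracting fixed point \<open>\<alpha>\<close> of type 1 in the disk and the map contracts \<open>|T - \<alpha>|\<close>
  strictly, so it has no other fixed point there.
\<close>

section \<open>Multiplicative seminorms and Gauss norms\<close>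

text \<open>All data at \<open>xi\<close> come from choices: \<open>loc_data\<close> may use
  different frames at source and target, and \<open>red_fact\<close> returns lifts tied to the map
  only through a common residual factor. Statements about multiplicities therefore have to survive
  these choices. Total ramification forces the common factor to reduce to a nonzero constant. The
  multiplicity at 0 is read off the form \<open>G(0) F - F(0) G\<close>, which is alternating and
  bilinear in the pair, so rescaling both lifts by a unit or changing the target frame multiplies it
  by a unit. When |F_0| < 1 and |G_0| = 1, its linear coefficient is F_1 times a unit, up to a term
  of absolute value below 1; hence the criterion |F_1| < 1. The residue field is handled throughout
  by strict inequalities between Gauss norms. The attracting fixed point is a root of F - T G, whose
  constant term F_0 is smaller than its linear coefficient F_1 - G_0 of absolute value 1. Algebraic
  closedness makes a point of the affine line determined by its values on the polynomials T - a, so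
  images of points are found by evaluating linear combinations of numerator and denominator.\<close>

locale mult_seminorm =
  fixes s :: "'b::comm_ring_1 \<Rightarrow> real"
  assumes nonneg [simp]: "0 \<le> s x"
    and zero [simp]: "s 0 = 0"
    and one [simp]: "s 1 = 1"
    and mult: "s (x * y) = s x * s y"
    and ultra: "s (x + y) \<le> max (s x) (s y)"
begin

lemma power: "s (x ^ n) = s x ^ n"
  by (induction n) (auto simp: mult)

lemma minus [simp]: "s (- x) = s x"
proof -
  have "s (-1) * s (-1) = 1"
    by (simp flip: mult)
  then have "s (-1) = 1"
    by (metis nonneg abs_of_nonneg power2_eq_square real_sqrt_abs real_sqrt_one)
  then show ?thesis
    using mult[of "-1" x] by simp
qed

lemma ultra_diff: "s (x - y) \<le> max (s x) (s y)"
  using ultra[of x "- y"] by simp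

lemma minus_commute: "s (x - y) = s (y - x)"
  using minus[of "x - y"] by simp

lemma add_lt: "s x < c \<Longrightarrow> s y < c \<Longrightarrow> s (x + y) < c"
  using ultra[of x y] by auto

lemma add_le: "s x \<le> c \<Longrightarrow> s y \<le> c \<Longrightarrow> s (x + y) \<le> c"
  using ultra[of x y] by auto

lemma diff_lt: "s x < c \<Longrightarrow> s y < c \<Longrightarrow> s (x - y) < c"
  using ultra_diff[of x y] by auto

lemma diff_le: "s x \<le> c \<Longrightarrow> s y \<le> c \<Longrightarrow> s (x - y) \<le> c"
  using ultra_diff[of x y] by auto

text \<open>Isosceles principle: if x + y were smaller than y, then y = (x + y) - x would be a
  difference of two elements smaller than itself.\<close>

lemma add_eq_dominant: "s x < s y \<Longrightarrow> s (x + y) = s y"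
  using ultra[of x y] ultra_diff[of "x + y" x] by auto

lemma eq_if_close: "s (x - y) < s y \<Longrightarrow> s x = s y"
  using add_eq_dominant[of "x - y" y] by simp

lemma sum_le: "finite A \<Longrightarrow> 0 \<le> c \<Longrightarrow> (\<And>i. i \<in> A \<Longrightarrow> s (f i) \<le> c) \<Longrightarrow> s (sum f A) \<le> c"
  by (induction A rule: finite_induct) (auto intro!: add_le)

lemma sum_lt: "finite A \<Longrightarrow> 0 < c \<Longrightarrow> (\<And>i. i \<in> A \<Longrightarrow> s (f i) < c) \<Longrightarrow> s (sum f A) < c"
  by (induction A rule: finite_induct) (auto intro!: add_lt)

lemma abs_diff_le: "\<bar>s x - s y\<bar> \<le> s (x - y)"
proof -
  have "0 \<le> s x" "0 \<le> s y" "0 \<le> s (x - y)"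
    by (rule nonneg)+
  then show ?thesis
    using ultra[of "x - y" y] ultra[of "y - x" x] minus_commute[of x y]
    unfolding max_def by (simp split: if_splits del: nonneg)
qed

end

text \<open>The coefficient ring is arbitrary because two cases occur: with \<open>av\<close> this
  gives the disk points, with a seminorm on polynomials it gives the thickenings.\<close>

definition gnorm :: "('b::comm_ring_1 \<Rightarrow> real) \<Rightarrow> real \<Rightarrow> 'b poly \<Rightarrow> real" where
  "gnorm s r p = Max ((\<lambda>i. s (coeff p i) * r ^ i) ` {..degree p})"

lemma Max_image_Suc:
  fixes f :: "nat \<Rightarrow> real"
  shows "Max (f ` {..Suc n}) = max (f (Suc n)) (Max (f ` {..n}))"
  by (simp add: atMost_Suc)

lemma continuous_on_Max_atMost:
  fixes f :: "nat \<Rightarrow> 'c::topological_space \<Rightarrow> real"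
  shows "(\<And>i. continuous_on A (f i)) \<Longrightarrow> continuous_on A (\<lambda>x. Max ((\<lambda>i. f i x) ` {..n}))"
proof (induction n)
  case (Suc n)
  then show ?case
    by (subst Max_image_Suc) (intro continuous_intros, auto)
qed simp

lemma continuous_on_gnorm: "continuous_on A (\<lambda>r. gnorm s r p)"
  unfolding gnorm_def by (intro continuous_on_Max_atMost continuous_intros)

context mult_seminorm
begin

lemma gnorm_ge:
  assumes "0 \<le> r"
  shows "s (coeff p i) * r ^ i \<le> gnorm s r p"
proof (cases "i \<le> degree p")
  case True
  then show ?thesis
    unfolding gnorm_def by (intro Max_ge) auto
next
  case False
  \<comment> \<open>Past the degree the left side is 0; the constant term, always among the terms
    maximised, supplies nonnegativity.\<close>
  have "0 \<le> s (coeff p 0) * r ^ 0"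
    by simp
  also have "\<dots> \<le> gnorm s r p"
    unfolding gnorm_def by (intro Max_ge) (auto intro!: image_eqI[of _ _ 0])
  finally show ?thesis
    using False by (simp add: coeff_eq_0)
qed

lemma gnorm_nonneg: "0 \<le> r \<Longrightarrow> 0 \<le> gnorm s r p"
  using order_trans[OF nonneg gnorm_ge[of r p 0, simplified]] by simp

lemma gnorm_le: "(\<And>i. s (coeff p i) * r ^ i \<le> c) \<Longrightarrow> gnorm s r p \<le> c"
  unfolding gnorm_def by auto

lemma gnorm_lt: "(\<And>i. s (coeff p i) * r ^ i < c) \<Longrightarrow> gnorm s r p < c"
  unfolding gnorm_def by auto

lemma gnorm_attained: "\<exists>i. s (coeff p i) * r ^ i = gnorm s r p"
proof -
  have "gnorm s r p \<in> (\<lambda>i. s (coeff p i) * r ^ i) ` {..degree p}"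
    unfolding gnorm_def by (intro Max_in) auto
  then show ?thesis
    by auto
qed

lemma gnorm_const [simp]: "gnorm s r [:c:] = s c"
  by (simp add: gnorm_def)

lemma gnorm_linear:
  assumes "0 \<le> r"
  shows "gnorm s r [:a, b:] = max (s a) (s b * r)"
proof (rule antisym)
  show "gnorm s r [:a, b:] \<le> max (s a) (s b * r)"
  proof (rule gnorm_le)
    fix i
    show "s (coeff [:a, b:] i) * r ^ i \<le> max (s a) (s b * r)"
      using nonneg[of a] by (cases i; cases "i - 1") (auto simp: le_max_iff_disj)
  qed
  show "max (s a) (s b * r) \<le> gnorm s r [:a, b:]"
    using gnorm_ge[OF assms, of "[:a, b:]" 0] gnorm_ge[OF assms, of "[:a, b:]" 1] by simp
qed

lemma gnorm_ultra:
  assumes "0 \<le> r"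
  shows "gnorm s r (p + q) \<le> max (gnorm s r p) (gnorm s r q)"
proof (rule gnorm_le)
  fix i
  have "s (coeff (p + q) i) * r ^ i \<le> max (s (coeff p i)) (s (coeff q i)) * r ^ i"
    using ultra[of "coeff p i" "coeff q i"] assms by (intro mult_right_mono) auto
  also have "\<dots> \<le> max (gnorm s r p) (gnorm s r q)"
    using gnorm_ge[OF assms, of p i] gnorm_ge[OF assms, of q i] by (auto simp: max_def)
  finally show "s (coeff (p + q) i) * r ^ i \<le> max (gnorm s r p) (gnorm s r q)" .
qed

lemma gnorm_mult_le:
  assumes r: "0 \<le> r"
  shows "gnorm s r (p * q) \<le> gnorm s r p * gnorm s r q"
proof (rule gnorm_le)
  fix k
  define c where "c = gnorm s r p * gnorm s r q"
  have c: "0 \<le> c"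
    unfolding c_def using gnorm_nonneg[OF r] by simp
  have t: "s (coeff p i * coeff q (k - i)) * r ^ k \<le> c" if "i \<le> k" for i
  proof -
    have "s (coeff p i * coeff q (k - i)) * r ^ k
        = (s (coeff p i) * r ^ i) * (s (coeff q (k - i)) * r ^ (k - i))"
      using power_add[of r i "k - i"] that by (simp add: mult)
    also have "\<dots> \<le> c"
      unfolding c_def using r by (intro mult_mono gnorm_ge gnorm_nonneg) auto
    finally show ?thesis .
  qed
  show "s (coeff (p * q) k) * r ^ k \<le> gnorm s r p * gnorm s r q"
  \<comment> \<open>Radius 0 is allowed, since the thickening paths start there, so division by
    \<open>r ^ k\<close> needs a case split.\<close>
  proof (cases "r ^ k = 0")
    case True
    have "s (coeff (p * q) k) * r ^ k = 0"
      unfolding True by (rule mult_zero_right)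
    also have "\<dots> \<le> gnorm s r p * gnorm s r q"
      using c unfolding c_def .
    finally show ?thesis .
  next
    case False
    then have rk: "0 < r ^ k"
      using zero_le_power[OF r, of k] by linarith
    have "s (coeff (p * q) k) \<le> c / r ^ k"
      unfolding coeff_mult using c rk t by (intro sum_le) (auto simp: pos_le_divide_eq)
    then show ?thesis
      using rk by (simp add: pos_le_divide_eq c_def)
  qed
qed

text \<open>Gauss's lemma: the product of the first dominant coefficients dominates the coefficient in its degree.\<close>
lemma gnorm_mult:
  assumes r: "0 \<le> r"
  shows "gnorm s r (p * q) = gnorm s r p * gnorm s r q"
proof (rule antisym[OF gnorm_mult_le[OF r]])
  define A where "A = gnorm s r p"
  define B where "B = gnorm s r q"
  define a where "a i = s (coeff p i) * r ^ i" for i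
  define b where "b i = s (coeff q i) * r ^ i" for i
  have nn: "0 \<le> A" "0 \<le> B" "\<And>i. 0 \<le> a i" "\<And>i. 0 \<le> b i"
    unfolding A_def B_def a_def b_def using gnorm_nonneg[OF r] r by auto
  have ub: "\<And>i. a i \<le> A" "\<And>i. b i \<le> B"
    unfolding A_def B_def a_def b_def using gnorm_ge[OF r] by auto
  show "gnorm s r p * gnorm s r q \<le> gnorm s r (p * q)"
  proof (cases "A = 0 \<or> B = 0")
    case True
    then show ?thesis
      using gnorm_nonneg[OF r, of "p * q"] unfolding A_def B_def by auto
  next
    case False
    then have pos: "0 < A" "0 < B"
      using nn by auto
    define i0 where "i0 = (LEAST i. a i = A)"
    define j0 where "j0 = (LEAST i. b i = B)"
    have i0: "a i0 = A" and j0: "b j0 = B"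
      unfolding i0_def j0_def a_def b_def A_def B_def
      using LeastI_ex[OF gnorm_attained[where r = r]] by blast+
    have lti: "a i < A" if "i < i0" for i
      using not_less_Least[of i "\<lambda>i. a i = A"] that ub(1)[of i] unfolding i0_def by auto
    have ltj: "b i < B" if "i < j0" for i
      using not_less_Least[of i "\<lambda>i. b i = B"] that ub(2)[of i] unfolding j0_def by auto
    define k where "k = i0 + j0"
    have "r ^ i0 \<noteq> 0" "r ^ j0 \<noteq> 0"
      using i0 j0 pos unfolding a_def b_def by (metis mult_zero_right less_irrefl)+
    then have rk: "0 < r ^ k"
      using zero_le_power[OF r, of i0] zero_le_power[OF r, of j0] unfolding k_def power_add
      by (intro mult_pos_pos) linarith+
    have t: "s (coeff p i * coeff q (k - i)) * r ^ k = a i * b (k - i)" if "i \<le> k" for i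
      using power_add[of r i "k - i"] that by (simp add: mult a_def b_def)
    \<comment> \<open>For i < i0 the first factor is below its maximum; for i > i0 one has k - i <
      j0, and the second factor is.\<close>
    have small: "s (coeff p i * coeff q (k - i)) < A * B / r ^ k" if "i \<in> {..k} - {i0}" for i
    proof -
      have "a i * b (k - i) < A * B"
      proof (cases "i < i0")
        case True
        then show ?thesis
          using mult_left_mono[OF ub(2)[of "k - i"] nn(3)[of i]]
            mult_strict_right_mono[OF lti[OF True] pos(2)] by linarith
      next
        case False
        then have "b (k - i) < B"
          using that unfolding k_def by (intro ltj) auto
        then show ?thesis
          using mult_right_mono[OF ub(1)[of i] nn(4)[of "k - i"]]
            mult_strict_left_mono[OF _ pos(1)] by fastforce
      qed
      then show ?thesis
        using t[of i] that rk by (simp add: pos_less_divide_eq)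
    qed
    have "coeff (p * q) k = (\<Sum>i\<in>{..k} - {i0}. coeff p i * coeff q (k - i)) + coeff p i0 * coeff q j0"
      unfolding coeff_mult by (subst sum.remove[of _ i0]) (auto simp: k_def)
    moreover have "s (coeff p i0 * coeff q j0) * r ^ k = A * B"
      using t[of i0] i0 j0 by (simp add: k_def)
    then have "s (coeff p i0 * coeff q j0) = A * B / r ^ k"
      using rk by (metis less_irrefl nonzero_mult_div_cancel_right)
    moreover have "s (\<Sum>i\<in>{..k} - {i0}. coeff p i * coeff q (k - i)) < A * B / r ^ k"
      using small pos rk by (intro sum_lt) auto
    ultimately have "s (coeff (p * q) k) = A * B / r ^ k"
      using add_eq_dominant by simp
    then have "A * B = s (coeff (p * q) k) * r ^ k"
      using rk by (metis less_irrefl nonzero_divide_eq_eq)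
    also have "\<dots> \<le> gnorm s r (p * q)"
      by (rule gnorm_ge[OF r])
    finally show ?thesis
      unfolding A_def B_def .
  qed
qed

lemma mult_seminorm_gnorm:
  assumes "0 \<le> r"
  shows "mult_seminorm (gnorm s r)"
  using assms gnorm_nonneg gnorm_mult gnorm_ultra gnorm_const[of r 0] gnorm_const[of r 1]
  by unfold_locales (auto simp: one_pCons simp del: gnorm_const)

end

section \<open>Homogenisation\<close>

lemma smult_sum_right: "smult c (sum f A) = (\<Sum>i\<in>A. smult c (f i))"
  by (induction A rule: infinite_finite_induct) (auto simp: smult_add_right)

lemma hom_add: "hom n (F + G) U V = hom n F U V + hom n G U V"
  by (simp add: hom_def smult_add_left sum.distrib)

lemma hom_smult: "hom n (smult c F) U V = smult c (hom n F U V)"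
  by (simp add: hom_def smult_sum_right)

lemma hom_0 [simp]: "hom n 0 U V = 0"
  by (simp add: hom_def)

lemma hom_sum: "hom n (sum f A) U V = (\<Sum>i\<in>A. hom n (f i) U V)"
  by (induction A rule: infinite_finite_induct) (auto simp: hom_add)

lemma hom_monom: "k \<le> n \<Longrightarrow> hom n (monom c k) U V = smult c (U ^ k * V ^ (n - k))"
  unfolding hom_def by (subst sum.remove[of _ k]) (auto intro!: sum.neutral)

lemma hom_mult:
  assumes "degree F \<le> n" "degree G \<le> m"
  shows "hom (n + m) (F * G) U V = hom n F U V * hom m G U V"
proof -
  have "F * G = (\<Sum>i\<le>n. monom (coeff F i) i) * (\<Sum>j\<le>m. monom (coeff G j) j)"
    using poly_as_sum_of_monoms'[OF assms(1)] poly_as_sum_of_monoms'[OF assms(2)] by simp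
  also have "\<dots> = (\<Sum>i\<le>n. \<Sum>j\<le>m. monom (coeff F i * coeff G j) (i + j))"
    by (simp add: sum_product mult_monom)
  finally have "hom (n + m) (F * G) U V
      = (\<Sum>i\<le>n. \<Sum>j\<le>m. hom (n + m) (monom (coeff F i * coeff G j) (i + j)) U V)"
    by (simp add: hom_sum)
  also have "\<dots> = (\<Sum>i\<le>n. \<Sum>j\<le>m.
      smult (coeff F i) (U ^ i * V ^ (n - i)) * smult (coeff G j) (U ^ j * V ^ (m - j)))"
  proof (intro sum.cong refl)
    fix i j assume "i \<in> {..n}" "j \<in> {..m}"
    then have *: "n + m - (i + j) = (n - i) + (m - j)" "i + j \<le> n + m"
      by auto
    show "hom (n + m) (monom (coeff F i * coeff G j) (i + j)) U V
        = smult (coeff F i) (U ^ i * V ^ (n - i)) * smult (coeff G j) (U ^ j * V ^ (m - j))"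
      unfolding hom_monom[OF *(2)] *(1) power_add by (simp add: mult_ac)
  qed
  also have "\<dots> = hom n F U V * hom m G U V"
    unfolding hom_def by (rule sum_product[symmetric])
  finally show ?thesis .
qed

lemma hom_one: "hom n 1 U V = V ^ n"
  using hom_monom[of 0 n 1 U V] by (simp add: monom_0 one_pCons)

text \<open>Compares the exact degree used by \<open>bact\<close> with the larger formal degrees
  needed to add polynomials of different degrees.\<close>

lemma hom_raise: "degree F \<le> n \<Longrightarrow> hom (n + m) F U V = hom n F U V * V ^ m"
  using hom_mult[of F n 1 m U V] by (simp add: hom_one)

lemma hom_power: "degree F \<le> n \<Longrightarrow> hom (k * n) (F ^ k) U V = hom n F U V ^ k"
proof (induction k)
  case (Suc k)
  have "degree (F ^ k) \<le> k * n"
    using degree_power_le[of F k] Suc.prems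
    by (metis le_trans mult.commute mult_le_mono2)
  then show ?case
    using hom_mult[of F n "F ^ k" "k * n" U V] Suc by simp
qed (simp add: hom_one)

lemma degree_hom_le:
  assumes "degree U \<le> d" "degree V \<le> d"
  shows "degree (hom n F U V) \<le> n * d"
  unfolding hom_def
proof (intro degree_sum_le)
  fix i assume "i \<in> {..n}"
  have "degree (smult (coeff F i) (U ^ i * V ^ (n - i))) \<le> degree U * i + degree V * (n - i)"
    by (meson add_mono degree_mult_le degree_power_le degree_smult_le le_trans)
  also have "\<dots> \<le> d * i + d * (n - i)"
    using assms by (intro add_mono mult_right_mono) auto
  also have "\<dots> = n * d"
    using \<open>i \<in> {..n}\<close> by (metis atMost_iff add_mult_distrib2 le_add_diff_inverse mult.commute)
  finally show "degree (smult (coeff F i) (U ^ i * V ^ (n - i))) \<le> n * d" .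
qed simp

text \<open>Substitution of forms is associative. The bound d is a formal degree, so the identity is
  insensitive to cancellation of top coefficients.\<close>

lemma hom_hom:
  assumes "degree P \<le> d" "degree Q \<le> d"
  shows "hom n f (hom d P U V) (hom d Q U V) = hom (n * d) (hom n f P Q) U V"
proof -
  have "hom (n * d) (P ^ i * Q ^ (n - i)) U V = hom d P U V ^ i * hom d Q U V ^ (n - i)"
    if "i \<le> n" for i
  proof -
    have "n * d = i * d + (n - i) * d"
      using that by (metis add_mult_distrib le_add_diff_inverse)
    moreover have "degree (P ^ i) \<le> i * d" "degree (Q ^ (n - i)) \<le> (n - i) * d"
      using degree_power_le[of P i] degree_power_le[of Q "n - i"] assms
      by (metis le_trans mult.commute mult_le_mono2)+
    ultimately show ?thesis
      using assms by (simp add: hom_mult hom_power)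
  qed
  then show ?thesis
    unfolding hom_def[of n f "hom d P U V"] hom_def[of n f P]
    by (simp add: hom_sum hom_smult)
qed

lemma hom_linear: "hom 1 [:b, a:] U V = smult a U + smult b V"
  by (simp add: hom_def)

lemma hom_id: "degree F \<le> n \<Longrightarrow> hom n F [:0, 1:] 1 = F"
  unfolding hom_def
  by (simp add: poly_as_sum_of_monoms' flip: monom_altdef)

section \<open>Values of binary forms, including at infinity\<close>

definition hval :: "nat \<Rightarrow> 'a::field poly \<Rightarrow> 'a \<Rightarrow> 'a \<Rightarrow> 'a" where
  "hval n F x y = (\<Sum>i\<le>n. coeff F i * x ^ i * y ^ (n - i))"

lemma poly_hom: "poly (hom n F U V) a = hval n F (poly U a) (poly V a)"
  by (simp add: hom_def hval_def poly_sum mult.assoc)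

lemma hval_0_right: "hval n F x 0 = coeff F n * x ^ n"
proof -
  have "hval n F x 0 = (\<Sum>i\<le>n. if i = n then coeff F i * x ^ i else 0)"
    unfolding hval_def by (intro sum.cong) (auto simp: power_0_left)
  then show ?thesis
    by simp
qed

lemma hval_eq:
  assumes "degree F \<le> n" "y \<noteq> 0"
  shows "hval n F x y = y ^ n * poly F (x / y)"
proof -
  have "F = (\<Sum>i\<le>n. monom (coeff F i) i)"
    using poly_as_sum_of_monoms'[OF assms(1)] by simp
  then have "poly F (x / y) = poly (\<Sum>i\<le>n. monom (coeff F i) i) (x / y)"
    by (rule arg_cong)
  then have "y ^ n * poly F (x / y) = (\<Sum>i\<le>n. y ^ n * (coeff F i * (x / y) ^ i))"
    by (simp add: poly_sum poly_monom sum_distrib_left)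
  also have "\<dots> = hval n F x y"
    unfolding hval_def
  proof (intro sum.cong refl)
    fix i assume "i \<in> {..n}"
    then have "y ^ n = y ^ i * y ^ (n - i)"
      by (simp flip: power_add)
    then show "y ^ n * (coeff F i * (x / y) ^ i) = coeff F i * x ^ i * y ^ (n - i)"
      using assms by (simp add: power_divide)
  qed
  finally show ?thesis ..
qed

lemma hval_1_right: "degree F \<le> n \<Longrightarrow> hval n F x 1 = poly F x"
  by (simp add: hval_eq)

lemma hval_homogeneous: "hval n F (c * x) (c * y) = c ^ n * hval n F x y"
  unfolding hval_def sum_distrib_left
proof (intro sum.cong refl)
  fix i assume "i \<in> {..n}"
  then have "c ^ n = c ^ i * c ^ (n - i)"
    by (simp flip: power_add)
  then show "coeff F i * (c * x) ^ i * (c * y) ^ (n - i) = c ^ n * (coeff F i * x ^ i * y ^ (n - i))"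
    by (simp add: power_mult_distrib)
qed

lemma coeff_mult_top:
  fixes F G :: "'a::comm_ring_1 poly"
  assumes "degree F \<le> n" "degree G \<le> m"
  shows "coeff (F * G) (n + m) = coeff F n * coeff G m"
proof -
  have "coeff F i * coeff G (n + m - i) = 0" if "i \<in> {..n + m} - {n}" for i
    using that assms by (cases "i < n") (auto simp: coeff_eq_0)
  then show ?thesis
    unfolding coeff_mult by (subst sum.remove[of _ n]) auto
qed

lemma coeff_power_top:
  fixes F :: "'a::comm_ring_1 poly"
  assumes "degree F \<le> n"
  shows "coeff (F ^ k) (k * n) = coeff F n ^ k"
proof (induction k)
  case (Suc k)
  have "degree (F ^ k) \<le> k * n"
    using degree_power_le[of F k] assms by (metis le_trans mult.commute mult_le_mono2)
  then show ?case
    using coeff_mult_top[of F n "F ^ k" "k * n"] Suc assms by simp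
qed simp

text \<open>The coefficient in the formal top degree is the value at the point (1, 0), which (U, V)
  sends to the pair of their own top coefficients.\<close>

lemma coeff_hom_top:
  assumes "degree U \<le> d" "degree V \<le> d"
  shows "coeff (hom n F U V) (n * d) = hval n F (coeff U d) (coeff V d)"
  unfolding hom_def hval_def coeff_sum
proof (intro sum.cong refl)
  fix i assume "i \<in> {..n}"
  then have "n * d = i * d + (n - i) * d"
    by (metis atMost_iff add_mult_distrib le_add_diff_inverse)
  moreover have "degree (U ^ i) \<le> i * d" "degree (V ^ (n - i)) \<le> (n - i) * d"
    using degree_power_le[of U i] degree_power_le[of V "n - i"] assms
    by (metis le_trans mult.commute mult_le_mono2)+
  ultimately show "coeff (smult (coeff F i) (U ^ i * V ^ (n - i))) (n * d)
      = coeff F i * coeff U d ^ i * coeff V d ^ (n - i)"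
    using assms by (simp add: coeff_mult_top coeff_power_top)
qed

lemma hval_hom: "hval n (hom n F [:b, a:] [:d, c:]) x y = hval n F (a * x + b * y) (c * x + d * y)"
proof (cases "y = 0")
  case True
  have "hval n (hom n F [:b, a:] [:d, c:]) x 0 = hval n F a c * x ^ n"
    using coeff_hom_top[of "[:b, a:]" 1 "[:d, c:]" n F] by (simp add: hval_0_right)
  then show ?thesis
    using True hval_homogeneous[of n F x a c] by (simp add: ac_simps)
next
  case False
  then have "hval n (hom n F [:b, a:] [:d, c:]) x y
      = y ^ n * poly (hom n F [:b, a:] [:d, c:]) (x / y)"
    using degree_hom_le[of "[:b, a:]" 1 "[:d, c:]" n F] by (simp add: hval_eq)
  also have "\<dots> = hval n F (y * (b + x / y * a)) (y * (d + x / y * c))"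
    by (simp add: poly_hom hval_homogeneous)
  also have "y * (b + x / y * a) = a * x + b * y"
    using False by (simp add: field_simps)
  also have "y * (d + x / y * c) = c * x + d * y"
    using False by (simp add: field_simps)
  finally show ?thesis .
qed

section \<open>Points of the Berkovich line and the action of rational maps\<close>

locale alg_closed_nonarch =
  fixes av :: "'a::field \<Rightarrow> real"
  assumes nonarch: "nonarch_abs av"
    and closed: "alg_closed TYPE('a)"
begin

lemma av_eq_0 [simp]: "av x = 0 \<longleftrightarrow> x = 0"
  using nonarch by (auto simp: nonarch_abs_def)

sublocale av: mult_seminorm av
proof
  have "av 1 * av 1 = av 1"
    using nonarch unfolding nonarch_abs_def by (metis mult_1)
  then show "av 1 = 1"
    using av_eq_0[of 1] by simp
qed (use nonarch in \<open>auto simp: nonarch_abs_def\<close>)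

lemma av_pos [simp]: "0 < av x \<longleftrightarrow> x \<noteq> 0"
  using av.nonneg[of x] av_eq_0[of x] by linarith

lemma av_divide: "y \<noteq> 0 \<Longrightarrow> av (x / y) = av x / av y"
  using av.mult[of "x / y" y] by (simp add: field_simps)

section \<open>Seminorms and linear factors\<close>

lemma mseminorm_iff: "mseminorm av s \<longleftrightarrow> mult_seminorm s \<and> (\<forall>c. s [:c:] = av c)"
proof
  assume s: "mseminorm av s"
  have "s 0 = 0" "s 1 = 1"
    using s unfolding mseminorm_def by (metis pCons_0_0 av.zero, metis one_pCons av.one)
  then show "mult_seminorm s \<and> (\<forall>c. s [:c:] = av c)"
    using s unfolding mseminorm_def mult_seminorm_def by blast
qed (auto simp: mseminorm_def mult_seminorm_def)

lemma mseminorm_smult: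
  assumes "mseminorm av s"
  shows "s (smult c p) = av c * s p"
proof -
  have "s ([:c:] * p) = s [:c:] * s p"
    using assms unfolding mseminorm_def by blast
  then show ?thesis
    using assms by (simp add: mseminorm_def)
qed

text \<open>Algebraic closedness turned into an induction principle: peel off one root at a
  time.\<close>

lemma poly_linear_induct [case_names const linear]:
  fixes p :: "'a poly"
  assumes const: "\<And>c. Pr [:c:]" and linear: "\<And>a q. q \<noteq> 0 \<Longrightarrow> Pr q \<Longrightarrow> Pr ([:-a, 1:] * q)"
  shows "Pr p"
proof (induction "degree p" arbitrary: p)
  case 0
  then show ?case
    using const by (metis degree_0_id)
next
  case (Suc n)
  then obtain a where "poly p a = 0"
    using closed unfolding alg_closed_def by (metis zero_less_Suc)
  then obtain q where q: "p = [:-a, 1:] * q"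
    by (auto simp: poly_eq_0_iff_dvd)
  then have "q \<noteq> 0"
    using Suc.hyps(2) by auto
  then have "degree q = n"
    using Suc.hyps(2) unfolding q by (subst (asm) degree_mult_eq) auto
  then show ?case
    using linear Suc.hyps(1) q \<open>q \<noteq> 0\<close> by auto
qed

text \<open>By multiplicativity only the linear factors matter, so a point is determined by its
  distances |T - a|. Points are identified below by this criterion.\<close>

lemma mseminorm_eqI:
  assumes "mseminorm av s" "mseminorm av s'" "\<And>a. s [:-a, 1:] = s' [:-a, 1:]"
  shows "s = s'"
proof
  fix p
  show "s p = s' p"
  proof (induction p rule: poly_linear_induct)
    case (const c)
    then show ?case
      using assms by (simp add: mseminorm_def)
  next
    case (linear a q)
    have "s ([:-a, 1:] * q) = s [:-a, 1:] * s q" "s' ([:-a, 1:] * q) = s' [:-a, 1:] * s' q"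
      using assms unfolding mseminorm_def by blast+
    then show ?case
      using linear assms(3) by metis
  qed
qed

lemma mseminorm_type1: "mseminorm av (\<lambda>f. av (poly f a))"
  by (simp add: mseminorm_def av.mult av.ultra)

text \<open>Modulo the kernel T equals a, so T - b has the value of the constant a - b.\<close>

lemma mseminorm_zero_type1:
  assumes s: "mseminorm av s" and "s [:-a, 1:] = 0"
  shows "Fin s = type1_pt av a"
proof -
  interpret s: mult_seminorm s
    using s mseminorm_iff by blast
  have "s = (\<lambda>f. av (poly f a))"
  proof (rule mseminorm_eqI[OF s mseminorm_type1])
    fix b
    have "[:-b, 1:] = [:a - b:] + [:-a, 1:]"
      by simp
    then have "s [:-b, 1:] = s [:a - b:]"
      using s.abs_diff_le[of "[:-b, 1:]" "[:a - b:]"] assms(2) by simp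
    then show "s [:-b, 1:] = av (poly [:-b, 1:] a)"
      using s by (simp add: mseminorm_def)
  qed
  then show ?thesis
    by (simp add: type1_pt_def)
qed

text \<open>The kernel of \<open>s\<close> is a prime ideal, so a nonzero polynomial in it has a
  linear factor in it.\<close>

lemma mseminorm_zero_root:
  assumes s: "mseminorm av s" and "s f = 0" "f \<noteq> 0"
  shows "\<exists>a. poly f a = 0 \<and> s [:-a, 1:] = 0"
proof -
  interpret s: mult_seminorm s
    using s mseminorm_iff by blast
  have "s f = 0 \<longrightarrow> f \<noteq> 0 \<longrightarrow> ?thesis"
  proof (induction f rule: poly_linear_induct)
    case (const c)
    then show ?case
      using s by (simp add: mseminorm_def)
  next
    case (linear a q)
    show ?case
    proof (intro impI)
      assume "s ([:-a, 1:] * q) = 0"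
      then consider "s [:-a, 1:] = 0" | "s q = 0"
        unfolding s.mult by auto
      then show "\<exists>b. poly ([:-a, 1:] * q) b = 0 \<and> s [:-b, 1:] = 0"
      proof cases
        case 1
        then show ?thesis
          by (intro exI[of _ a]) simp
      next
        case 2
        then show ?thesis
          using linear by auto
      qed
    qed
  qed
  then show ?thesis
    using assms by blast
qed

lemma coprime_iff_no_common_root:
  fixes P Q :: "'a poly"
  shows "coprime P Q \<longleftrightarrow> \<not> (\<exists>x. poly P x = 0 \<and> poly Q x = 0)"
proof
  assume PQ: "coprime P Q"
  show "\<not> (\<exists>x. poly P x = 0 \<and> poly Q x = 0)"
  proof
    assume "\<exists>x. poly P x = 0 \<and> poly Q x = 0"
    then obtain x where "[:-x, 1:] dvd P" "[:-x, 1:] dvd Q"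
      by (auto simp: poly_eq_0_iff_dvd)
    then have "is_unit [:-x, 1:]"
      using PQ coprime_common_divisor by blast
    then show False
      by (simp add: is_unit_pCons_iff)
  qed
next
  assume nr: "\<not> (\<exists>x. poly P x = 0 \<and> poly Q x = 0)"
  show "coprime P Q"
  proof (rule coprimeI)
    fix c assume c: "c dvd P" "c dvd Q"
    have "\<not> 0 < degree c"
      using closed c nr unfolding alg_closed_def
      by (metis dvd_trans poly_eq_0_iff_dvd)
    moreover have "c \<noteq> 0"
      using c nr by auto
    ultimately show "is_unit c"
      by (simp add: is_unit_iff_degree)
  qed
qed

text \<open>The seminorm of a binary form: \<open>hnorm z n F\<close> is \<open>|F|\<close> at \<open>z\<close> where \<open>F\<close> is regarded as a
  form of degree \<open>n\<close>, well defined up to the \<open>n\<close>-th power of a scalar depending on \<open>z\<close>.\<close>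
definition hnorm :: "'a bpt \<Rightarrow> nat \<Rightarrow> 'a poly \<Rightarrow> real" where
  "hnorm z n F = (case z of None \<Rightarrow> av (coeff F n) | Some s \<Rightarrow> s F)"

text \<open>\<open>[F : G]\<close>, as a pair of forms of degree \<open>d\<close>, sends \<open>z\<close> to \<open>w\<close>. The exact degree of the map does
  not enter, so that composites are described without knowing that no cancellation occurs.\<close>
definition maps_to :: "nat \<Rightarrow> 'a poly \<Rightarrow> 'a poly \<Rightarrow> 'a bpt \<Rightarrow> 'a bpt \<Rightarrow> bool" where
  "maps_to d F G z w \<longleftrightarrow> w \<in> berk av \<and>
     (\<exists>k>0. \<forall>n f. degree f \<le> n \<longrightarrow> hnorm z (n * d) (hom n f F G) = k ^ n * hnorm w n f)"

lemma hnorm_Infty [simp]: "hnorm Infty n F = av (coeff F n)"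
  and hnorm_Fin [simp]: "hnorm (Fin s) n F = s F"
  by (auto simp: hnorm_def)

lemma Infty_in_berk [simp]: "Infty \<in> berk av"
  and Fin_in_berk [simp]: "Fin s \<in> berk av \<longleftrightarrow> mseminorm av s"
  by (auto simp: berk_def)

lemma hnorm_smult: "z \<in> berk av \<Longrightarrow> hnorm z n (smult c F) = av c * hnorm z n F"
  by (cases z) (auto simp: av.mult mseminorm_smult)

lemma maps_to_in_berk: "maps_to d F G z w \<Longrightarrow> w \<in> berk av"
  by (simp add: maps_to_def)

text \<open>The case n = 1. Values on linear forms already determine the image point, so concrete
  images are computed from this alone.\<close>

lemma maps_to_linear:
  assumes "maps_to d F G z w"
  shows "\<exists>k>0. \<forall>a b. hnorm z d (smult a F + smult b G) = k * hnorm w 1 [:b, a:]"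
proof -
  obtain k where k: "0 < k"
    "\<And>n f. degree f \<le> n \<Longrightarrow> hnorm z (n * d) (hom n f F G) = k ^ n * hnorm w n f"
    using assms unfolding maps_to_def by blast
  have "hnorm z (1 * d) (hom 1 [:b, a:] F G) = k ^ 1 * hnorm w 1 [:b, a:]" for a b
    by (rule k(2)) simp
  then show ?thesis
    using k(1) unfolding hom_linear by (intro exI[of _ k]) auto
qed

lemma maps_to_unique:
  assumes "maps_to d F G z w" "maps_to d F G z w'"
  shows "w = w'"
proof -
  obtain k where k: "0 < k"
    "\<And>n f. degree f \<le> n \<Longrightarrow> hnorm z (n * d) (hom n f F G) = k ^ n * hnorm w n f"
    using assms(1) unfolding maps_to_def by blast
  obtain l where l: "0 < l"
    "\<And>n f. degree f \<le> n \<Longrightarrow> hnorm z (n * d) (hom n f F G) = l ^ n * hnorm w' n f"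
    using assms(2) unfolding maps_to_def by blast
  have eq: "k ^ n * hnorm w n f = l ^ n * hnorm w' n f" if "degree f \<le> n" for n f
    using k(2)[OF that] l(2)[OF that] by simp
  have wb: "w \<in> berk av" "w' \<in> berk av"
    using assms by (auto simp: maps_to_def)
  \<comment> \<open>The form 1 vanishes exactly at \<open>Infty\<close>: it separates
    \<open>Infty\<close> from the finite points, and for two finite points it gives k = l.\<close>
  have 1: "k * hnorm w 1 1 = l * hnorm w' 1 1"
    using eq[of 1 1] by simp
  show ?thesis
  proof (cases w)
    case None
    then show ?thesis
      using 1 k(1) l(1) wb by (cases w') (auto simp: mseminorm_iff mult_seminorm_def)
  next
    case w: (Some s)
    then show ?thesis
    proof (cases w')
      case None
      then show ?thesis
        using 1 k(1) l(1) wb w by (auto simp: mseminorm_iff mult_seminorm_def)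
    next
      case w': (Some s')
      have "k = l"
        using 1 wb w w' by (auto simp: mseminorm_iff mult_seminorm_def)
      have "s f = s' f" for f
        using eq[of f "degree f"] k(1) w w' \<open>k = l\<close> by simp
      then show ?thesis
        using w w' by auto
    qed
  qed
qed

lemma maps_to_comp:
  assumes 1: "maps_to d F G z w" and 2: "maps_to e P Q w x"
    and deg: "degree P \<le> e" "degree Q \<le> e"
  shows "maps_to (e * d) (hom e P F G) (hom e Q F G) z x"
proof -
  obtain k where k: "0 < k"
    "\<And>n f. degree f \<le> n \<Longrightarrow> hnorm z (n * d) (hom n f F G) = k ^ n * hnorm w n f"
    using 1 unfolding maps_to_def by blast
  obtain l where l: "0 < l"
    "\<And>n f. degree f \<le> n \<Longrightarrow> hnorm w (n * e) (hom n f P Q) = l ^ n * hnorm x n f"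
    using 2 unfolding maps_to_def by blast
  have "hnorm z (n * (e * d)) (hom n f (hom e P F G) (hom e Q F G)) = (k ^ e * l) ^ n * hnorm x n f"
    if "degree f \<le> n" for n f
  proof -
    have "hnorm z (n * (e * d)) (hom n f (hom e P F G) (hom e Q F G))
        = hnorm z (n * e * d) (hom (n * e) (hom n f P Q) F G)"
      by (simp add: hom_hom[OF deg] mult.assoc)
    also have "\<dots> = k ^ (n * e) * hnorm w (n * e) (hom n f P Q)"
      by (intro k(2) degree_hom_le deg)
    also have "\<dots> = (k ^ e * l) ^ n * hnorm x n f"
      unfolding l(2)[OF that] using power_mult[of k e n]
      by (simp add: power_mult_distrib mult.commute[of n e])
    finally show ?thesis .
  qed
  moreover have "0 < k ^ e * l"
    using k(1) l(1) by simp
  ultimately show ?thesis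
    using 2 unfolding maps_to_def by blast
qed

lemma hom_smult_right: "hom n f (smult c F) (smult c G) = smult (c ^ n) (hom n f F G)"
  unfolding hom_def smult_sum_right
proof (intro sum.cong refl)
  fix i assume "i \<in> {..n}"
  then have "c ^ n = c ^ i * c ^ (n - i)"
    by (simp flip: power_add)
  then show "smult (coeff f i) (smult c F ^ i * smult c G ^ (n - i))
      = smult (c ^ n) (smult (coeff f i) (F ^ i * G ^ (n - i)))"
    by (simp add: smult_power mult_ac)
qed

lemma maps_to_smult:
  assumes "maps_to d F G z w" "c \<noteq> 0" "z \<in> berk av"
  shows "maps_to d (smult c F) (smult c G) z w"
proof -
  obtain k where k: "0 < k"
    "\<And>n f. degree f \<le> n \<Longrightarrow> hnorm z (n * d) (hom n f F G) = k ^ n * hnorm w n f"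
    using assms(1) unfolding maps_to_def by blast
  have "hnorm z (n * d) (hom n f (smult c F) (smult c G)) = (av c * k) ^ n * hnorm w n f"
    if "degree f \<le> n" for n f
    by (simp add: hom_smult_right hnorm_smult assms(3) av.power k(2)[OF that] power_mult_distrib)
  moreover have "0 < av c * k"
    using k(1) assms(2) by simp
  ultimately show ?thesis
    using assms(1) unfolding maps_to_def by blast
qed

lemma maps_to_bact:
  assumes PQ: "coprime P Q" and deg: "0 < rdeg (P, Q)" and z: "z \<in> berk av"
  shows "maps_to (rdeg (P, Q)) P Q z (bact av (P, Q) z)"
proof -
  define d where "d = rdeg (P, Q)"
  have d: "degree P \<le> d" "degree Q \<le> d"
    by (auto simp: d_def rdeg_def)
  show ?thesis
  proof (cases z)
    case None
    \<comment> \<open>At \<open>Infty\<close> a form is evaluated at (1, 0), so f is evaluated at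
      the top coefficients of P and Q, which are not both 0.\<close>
    have top: "hnorm z (n * d) (hom n f P Q) = av (hval n f (coeff P d) (coeff Q d))" for n f
      using None by (simp add: coeff_hom_top[OF d])
    show ?thesis
    proof (cases "degree P > degree Q")
      case True
      then have "coeff Q d = 0" "coeff P d \<noteq> 0"
        by (auto simp: d_def rdeg_def coeff_eq_0)
      then have "hnorm z (n * d) (hom n f P Q) = av (coeff P d) ^ n * hnorm Infty n f" for n f
        unfolding top by (simp add: hval_0_right av.mult av.power)
      then show ?thesis
        using True None \<open>coeff P d \<noteq> 0\<close> unfolding maps_to_def d_def[symmetric]
        by (auto simp: bact_def intro!: exI[of _ "av (coeff P d)"])
    next
      case False
      then have q: "coeff Q d \<noteq> 0"
        using deg by (auto simp: d_def rdeg_def)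
      have "hnorm z (n * d) (hom n f P Q)
          = av (coeff Q d) ^ n * hnorm (type1_pt av (coeff P d / coeff Q d)) n f" if "degree f \<le> n" for n f
        unfolding top using q that by (simp add: hval_eq av.mult av.power type1_pt_def)
      then show ?thesis
        using False None q mseminorm_type1 unfolding maps_to_def d_def[symmetric]
        by (auto simp: bact_def type1_pt_def d_def[symmetric] intro!: exI[of _ "av (coeff Q d)"])
    qed
  next
    case z_eq: (Some s)
    then have ms: "mseminorm av s"
      using z by simp
    then interpret s: mult_seminorm s
      using mseminorm_iff by blast
    show ?thesis
    proof (cases "s Q = 0")
      case True
      \<comment> \<open>A seminorm that kills a nonzero polynomial is evaluation at some a; killing
        both P and Q, it would give them a common root.\<close>
      have sP: "0 < s P"
      proof (rule ccontr)
        assume "\<not> 0 < s P"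
        then have "s P = 0"
          using s.nonneg[of P] by linarith
        have nz: "P \<noteq> 0 \<or> Q \<noteq> 0"
          using PQ by auto
        have "\<exists>a. (poly P a = 0 \<or> poly Q a = 0) \<and> s [:-a, 1:] = 0"
          using mseminorm_zero_root[OF ms] True \<open>s P = 0\<close> nz by blast
        then obtain a where "s [:-a, 1:] = 0"
          by blast
        then have "s = (\<lambda>f. av (poly f a))"
          using mseminorm_zero_type1[OF ms] by (simp add: type1_pt_def)
        then show False
          using True \<open>s P = 0\<close> PQ unfolding coprime_iff_no_common_root by auto
      qed
      have "s (hom n f P Q) = s P ^ n * av (coeff f n)" for n f
      proof -
        have "hom n f P Q = (\<Sum>i<n. smult (coeff f i) (P ^ i * Q ^ (n - i))) + smult (coeff f n) (P ^ n)"
          unfolding hom_def by (simp add: lessThan_Suc_atMost[symmetric])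
        moreover have "s (\<Sum>i<n. smult (coeff f i) (P ^ i * Q ^ (n - i))) \<le> 0"
          using True by (intro s.sum_le) (auto simp: mseminorm_smult[OF ms] s.mult s.power power_0_left)
        ultimately have "s (hom n f P Q) = s (smult (coeff f n) (P ^ n))"
          using s.abs_diff_le[of "hom n f P Q" "smult (coeff f n) (P ^ n)"] by simp
        then show ?thesis
          by (simp add: mseminorm_smult[OF ms] s.power)
      qed
      then show ?thesis
        using sP True z_eq unfolding maps_to_def by (auto simp: bact_def)
    next
      case False
      then have sQ: "0 < s Q"
        using s.nonneg[of Q] by linarith
      define s' where "s' f = s (hom (degree f) f P Q) / s Q ^ degree f" for f
      \<comment> \<open>Any formal degree n above the exact one gives the same quotient; the
        ultrametric inequality for p + q requires a common n.\<close>
      have s': "s (hom n f P Q) = s Q ^ n * s' f" if "degree f \<le> n" for n f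
        using hom_raise[of f "degree f" "n - degree f" P Q] that sQ
        by (simp add: s'_def s.mult s.power field_simps flip: power_add)
      have "mseminorm av s'"
        unfolding mseminorm_def
      proof (intro conjI allI)
        fix p q c
        show "0 \<le> s' p"
          unfolding s'_def by simp
        show "s' [:c:] = av c"
          unfolding s'_def using ms by (simp add: hom_def mseminorm_def)
        show "s' (p * q) = s' p * s' q"
          using s'[of "p * q" "degree p + degree q"] s'[of p "degree p"] s'[of q "degree q"] sQ
          by (simp add: degree_mult_le hom_mult s.mult power_add mult_ac)
        define n where "n = max (degree p) (degree q)"
        have n: "degree p \<le> n" "degree q \<le> n" "degree (p + q) \<le> n"
          unfolding n_def by (auto simp: degree_add_le)
        have "s Q ^ n * s' (p + q) \<le> max (s Q ^ n * s' p) (s Q ^ n * s' q)"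
          unfolding s'[OF n(1), symmetric] s'[OF n(2), symmetric] s'[OF n(3), symmetric] hom_add
          by (rule s.ultra)
        also have "\<dots> = s Q ^ n * max (s' p) (s' q)"
          using sQ by (simp add: max_def)
        finally show "s' (p + q) \<le> max (s' p) (s' q)"
          using sQ by simp
      qed
      moreover have "bact av (P, Q) z = Fin s'"
        using False z_eq by (simp add: bact_def s'_def fun_eq_iff)
      ultimately show ?thesis
        using s' sQ z_eq unfolding maps_to_def by auto
    qed
  qed
qed

lemma bact_in_berk: "coprime P Q \<Longrightarrow> 0 < rdeg (P, Q) \<Longrightarrow> z \<in> berk av \<Longrightarrow> bact av (P, Q) z \<in> berk av"
  using maps_to_bact maps_to_in_berk by blast

section \<open>Moebius transformations\<close>

lemma rdeg_mob: "mob_ok m \<Longrightarrow> rdeg (mob m) = 1"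
  by (cases m) (auto simp: mob_ok_def mob_def rdeg_def)

lemma coprime_mob:
  fixes m :: "'a \<times> 'a \<times> 'a \<times> 'a"
  assumes "mob_ok m"
  shows "coprime (fst (mob m)) (snd (mob m))"
proof -
  obtain a b c d where m: "m = (a, b, c, d)"
    by (cases m)
  then have det: "a * d - b * c \<noteq> 0"
    using \<open>mob_ok m\<close> by (simp add: mob_ok_def)
  have False if "b + x * a = 0" "d + x * c = 0" for x
  proof -
    have "b = - (x * a)" "d = - (x * c)"
      using that by (simp_all add: eq_neg_iff_add_eq_0)
    then show False
      using det by (simp add: algebra_simps)
  qed
  then show ?thesis
    unfolding coprime_iff_no_common_root by (auto simp: m mob_def)
qed

abbreviation mact :: "'a \<times> 'a \<times> 'a \<times> 'a \<Rightarrow> 'a bpt \<Rightarrow> 'a bpt" where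
  "mact m \<equiv> bact av (mob m)"

lemma maps_to_mact:
  assumes "mob_ok m" "z \<in> berk av"
  shows "maps_to 1 (fst (mob m)) (snd (mob m)) z (mact m z)"
  using maps_to_bact[of "fst (mob m)" "snd (mob m)" z] assms rdeg_mob[of m] coprime_mob[of m] by simp

lemma mact_in_berk: "mob_ok m \<Longrightarrow> z \<in> berk av \<Longrightarrow> mact m z \<in> berk av"
  using maps_to_mact maps_to_in_berk by blast

section \<open>Matrix calculus for Moebius transformations\<close>

definition mmul :: "'a \<times> 'a \<times> 'a \<times> 'a \<Rightarrow> 'a \<times> 'a \<times> 'a \<times> 'a \<Rightarrow> 'a \<times> 'a \<times> 'a \<times> 'a" where
  "mmul m m' = (case m of (a, b, c, d) \<Rightarrow> case m' of (a', b', c', d') \<Rightarrow>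
     (a * a' + b * c', a * b' + b * d', c * a' + d * c', c * b' + d * d'))"

definition mscale :: "'a \<Rightarrow> 'a \<times> 'a \<times> 'a \<times> 'a \<Rightarrow> 'a \<times> 'a \<times> 'a \<times> 'a" where
  "mscale k m = (case m of (a, b, c, d) \<Rightarrow> (k * a, k * b, k * c, k * d))"

lemma mob_ok_inv: "mob_ok m \<Longrightarrow> mob_ok (mob_inv m)"
  by (cases m) (auto simp: mob_ok_def mob_inv_def algebra_simps)

lemma mob_inv_inv: "mob_inv (mob_inv m) = m"
  by (cases m) (simp add: mob_inv_def)

lemma mob_ok_mmul:
  assumes "mob_ok m" "mob_ok m'"
  shows "mob_ok (mmul m m')"
proof -
  obtain a b c d where m: "m = (a, b, c, d)" by (cases m)
  obtain a' b' c' d' where m': "m' = (a', b', c', d')" by (cases m')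
  have "(a * a' + b * c') * (c * b' + d * d') - (a * b' + b * d') * (c * a' + d * c')
      = (a * d - b * c) * (a' * d' - b' * c')"
    by (simp add: algebra_simps)
  moreover have "(a * d - b * c) * (a' * d' - b' * c') \<noteq> 0"
    using assms by (simp add: m m' mob_ok_def)
  ultimately have "(a * a' + b * c') * (c * b' + d * d') - (a * b' + b * d') * (c * a' + d * c') \<noteq> 0"
    by metis
  then show ?thesis
    by (simp add: m m' mob_ok_def mmul_def)
qed

lemma mob_ok_mscale:
  assumes "k \<noteq> 0" "mob_ok m"
  shows "mob_ok (mscale k m)"
proof -
  obtain a b c d where m: "m = (a, b, c, d)" by (cases m)
  have "k * a * (k * d) - k * b * (k * c) = k * k * (a * d - b * c)"
    by (simp add: algebra_simps)
  moreover have "k * k * (a * d - b * c) \<noteq> 0"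
    using assms by (simp add: m mob_ok_def)
  ultimately have "k * a * (k * d) - k * b * (k * c) \<noteq> 0"
    by metis
  then show ?thesis
    by (simp add: m mob_ok_def mscale_def)
qed

lemma mact_mmul:
  assumes "mob_ok m" "mob_ok m'" "z \<in> berk av"
  shows "mact (mmul m m') z = mact m (mact m' z)"
proof -
  obtain a b c d where m: "m = (a, b, c, d)" by (cases m)
  obtain a' b' c' d' where m': "m' = (a', b', c', d')" by (cases m')
  have "maps_to (1 * 1) (hom 1 [:b, a:] [:b', a':] [:d', c':]) (hom 1 [:d, c:] [:b', a':] [:d', c':])
      z (mact m (mact m' z))"
    using maps_to_comp[OF maps_to_mact[OF assms(2,3)] maps_to_mact[OF assms(1) mact_in_berk[OF assms(2,3)]]]
    by (simp add: m m' mob_def)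
  then have "maps_to 1 (fst (mob (mmul m m'))) (snd (mob (mmul m m'))) z (mact m (mact m' z))"
    unfolding hom_linear by (simp add: m m' mob_def mmul_def add.commute)
  then show ?thesis
    using maps_to_mact[OF mob_ok_mmul[OF assms(1,2)] assms(3)] maps_to_unique by blast
qed

lemma mact_mscale:
  assumes "mob_ok m" "k \<noteq> 0" "z \<in> berk av"
  shows "mact (mscale k m) z = mact m z"
proof -
  have "maps_to 1 (fst (mob (mscale k m))) (snd (mob (mscale k m))) z (mact m z)"
    using maps_to_smult[OF maps_to_mact[OF assms(1,3)] assms(2,3)]
    by (cases m) (simp add: mob_def mscale_def)
  then show ?thesis
    using maps_to_mact[OF mob_ok_mscale[OF assms(2,1)] assms(3)] maps_to_unique by blast
qed

lemma maps_to_id: "z \<in> berk av \<Longrightarrow> maps_to 1 [:0, 1:] 1 z z"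
  unfolding maps_to_def by (auto simp: hom_id intro!: exI[of _ 1])

text \<open>\<open>mob_inv\<close> is the adjugate matrix: its product with m is the determinant
  times the identity, and scalar matrices act trivially.\<close>

lemma mact_inv:
  assumes m: "mob_ok m" and z: "z \<in> berk av"
  shows "mact (mob_inv m) (mact m z) = z" "mact m (mact (mob_inv m) z) = z"
proof -
  have *: "mact (mob_inv m) (mact m z) = z" if m: "mob_ok m" for m
  proof -
    obtain a b c d where m': "m = (a, b, c, d)" by (cases m)
    define D where "D = a * d - b * c"
    have D: "D \<noteq> 0"
      using m by (simp add: D_def m' mob_ok_def)
    have "mmul (mob_inv m) m = mscale D (1, 0, 0, 1)"
      by (simp add: m' mmul_def mob_inv_def mscale_def D_def algebra_simps)
    then have "mact (mob_inv m) (mact m z) = mact (mscale D (1, 0, 0, 1)) z"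
      using mact_mmul[OF mob_ok_inv[OF m] m z] by simp
    also have "\<dots> = mact (1, 0, 0, 1) z"
      using D z by (intro mact_mscale) (auto simp: mob_ok_def)
    also have "\<dots> = z"
      using maps_to_mact[of "(1, 0, 0, 1)" z] maps_to_id[OF z] maps_to_unique z
      by (auto simp: mob_ok_def mob_def one_pCons)
    finally show ?thesis .
  qed
  show "mact (mob_inv m) (mact m z) = z"
    by (rule *[OF m])
  show "mact m (mact (mob_inv m) z) = z"
    using *[OF mob_ok_inv[OF m]] by (simp add: mob_inv_inv)
qed

end

section \<open>Disks and thickenings\<close>

context alg_closed_nonarch
begin

lemma mseminorm_disk:
  assumes "0 \<le> r"
  shows "mseminorm av (\<lambda>f. gnorm av r (pcompose f [:a, 1:]))"
proof -
  interpret g: mult_seminorm "gnorm av r"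
    using av.mult_seminorm_gnorm[OF assms] .
  show ?thesis
    unfolding mseminorm_def
    by (auto simp: pcompose_mult pcompose_add g.mult g.ultra)
qed

lemma disk_pt_eq: "disk_pt av a r = Fin (\<lambda>f. gnorm av r (pcompose f [:a, 1:]))"
  by (simp add: disk_pt_def gnorm_def degree_pcompose)

lemma disk_pt_in_berk: "0 \<le> r \<Longrightarrow> disk_pt av a r \<in> berk av"
  by (simp add: disk_pt_eq mseminorm_disk)

lemma gnorm_disk_linear:
  "0 \<le> r \<Longrightarrow> gnorm av r (pcompose [:-b, 1:] [:a, 1:]) = max (av (a - b)) r"
  by (simp add: pcompose_pCons av.gnorm_linear)

lemma gauss_pt_eq: "gauss_pt av = Fin (gnorm av 1)"
  by (simp add: gauss_pt_def disk_pt_eq)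

lemma mseminorm_gauss: "mseminorm av (gnorm av 1)"
  using mseminorm_disk[of 1 0] by simp

lemma gauss_in_berk [simp]: "gauss_pt av \<in> berk av"
  by (simp add: gauss_pt_eq mseminorm_gauss)

text \<open>\<open>thicken s r\<close> is the seminorm \<open>f \<mapsto> max\<^sub>i s(f\<^sub>i) r^i\<close> with \<open>f(T + h) = \<Sum>\<^sub>i f\<^sub>i(T) h^i\<close>;
  for varying \<open>r\<close> it is the path from \<open>s\<close> to infinity.\<close>
definition taylor :: "'a poly \<Rightarrow> 'a poly poly" where
  "taylor f = pcompose (map_poly (\<lambda>c. [:c:]) f) [:[:0, 1:], 1:]"

definition thicken :: "('a poly \<Rightarrow> real) \<Rightarrow> real \<Rightarrow> 'a poly \<Rightarrow> real" where
  "thicken s r f = gnorm s r (taylor f)"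

lemma const_poly_sum: "[:sum f A:] = (\<Sum>i\<in>A. [:f i:])"
  using monom_sum[of f A 0] by (simp add: monom_0)

lemma taylor_mult: "taylor (p * q) = taylor p * taylor q"
proof -
  have "map_poly (\<lambda>c. [:c:]) (p * q) = map_poly (\<lambda>c. [:c:]) p * map_poly (\<lambda>c. [:c:]) q"
    by (intro poly_eqI) (simp add: coeff_map_poly coeff_mult const_poly_sum mult.commute)
  then show ?thesis
    by (simp add: taylor_def pcompose_mult)
qed

lemma taylor_add: "taylor (p + q) = taylor p + taylor q"
proof -
  have "map_poly (\<lambda>c. [:c:]) (p + q) = map_poly (\<lambda>c. [:c:]) p + map_poly (\<lambda>c. [:c:]) q"
    by (intro poly_eqI) (simp add: coeff_map_poly)
  then show ?thesis
    by (simp add: taylor_def pcompose_add)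
qed

lemma taylor_const: "taylor [:c:] = [:[:c:]:]"
  by (simp add: taylor_def map_poly_pCons)

lemma taylor_linear: "taylor [:b, 1:] = [:[:b, 1:], 1:]"
  by (simp add: taylor_def map_poly_pCons pcompose_pCons one_pCons)

lemma mseminorm_thicken:
  assumes "mseminorm av s" "0 \<le> r"
  shows "mseminorm av (thicken s r)"
proof -
  interpret s: mult_seminorm s
    using assms mseminorm_iff by blast
  interpret g: mult_seminorm "gnorm s r"
    using s.mult_seminorm_gnorm[OF assms(2)] .
  show ?thesis
    using assms unfolding mseminorm_def
    by (auto simp: thicken_def taylor_mult taylor_add taylor_const g.mult g.ultra)
qed

lemma thicken_linear:
  assumes "mseminorm av s" "0 \<le> r"
  shows "thicken s r [:b, 1:] = max (s [:b, 1:]) r"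
proof -
  interpret s: mult_seminorm s
    using assms mseminorm_iff by blast
  show ?thesis
    using assms(2) by (simp add: thicken_def taylor_linear s.gnorm_linear)
qed

lemma thicken_0:
  assumes "mseminorm av s"
  shows "thicken s 0 = s"
proof (rule mseminorm_eqI[OF mseminorm_thicken[OF assms] assms])
  show "thicken s 0 [:-a, 1:] = s [:-a, 1:]" for a
    using assms unfolding thicken_linear[OF assms order_refl]
    by (intro max_absorb1) (simp add: mseminorm_def)
qed simp

text \<open>T - a and -a differ by T, whose value is at most r, so their values agree once cut off
  below at r.\<close>

lemma mseminorm_linear_le:
  assumes "mseminorm av s" "s [:0, 1:] \<le> r"
  shows "max (s [:-a, 1:]) r = max (av a) r"
proof -
  interpret s: mult_seminorm s
    using assms mseminorm_iff by blast
  have "s [:-a:] = av a"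
    using assms(1) by (simp add: mseminorm_def)
  then show ?thesis
    using s.ultra[of "[:-a:]" "[:0, 1:]"] s.ultra_diff[of "[:-a, 1:]" "[:0, 1:]"] assms(2)
    by (auto simp: max_def split: if_splits)
qed

text \<open>Once r reaches |T|, the path from \<open>s\<close> towards infinity has merged with the
  path from the origin. This merging makes the open disk connected.\<close>

lemma Fin_thicken_eq_disk:
  assumes "mseminorm av s" "s [:0, 1:] \<le> r" "0 \<le> r"
  shows "Fin (thicken s r) = disk_pt av 0 r"
proof -
  have "thicken s r = (\<lambda>f. gnorm av r (pcompose f [:0, 1:]))"
  proof (rule mseminorm_eqI[OF mseminorm_thicken[OF assms(1,3)] mseminorm_disk[OF assms(3)]])
    show "thicken s r [:-a, 1:] = gnorm av r (pcompose [:-a, 1:] [:0, 1:])" for a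
      unfolding gnorm_disk_linear[OF assms(3)] thicken_linear[OF assms(1,3)]
        mseminorm_linear_le[OF assms(1,2)]
      by simp
  qed
  then show ?thesis
    by (simp add: disk_pt_eq)
qed

section \<open>The topology\<close>

text \<open>The functions \<open>theta n F\<close> are globally continuous homogeneous coordinates, which treat
  \<open>Infty\<close> on the same footing as the other points.\<close>
definition theta :: "nat \<Rightarrow> 'a poly \<Rightarrow> 'a bpt \<Rightarrow> real" where
  "theta n F z = hnorm z n F / max (hnorm z 1 [:0, 1:]) (hnorm z 1 1) ^ n"

lemma theta_Infty: "theta n F Infty = av (coeff F n)"
  by (simp add: theta_def)

lemma theta_Fin: "mseminorm av s \<Longrightarrow> theta n F (Fin s) = s F / max (s [:0, 1:]) 1 ^ n"
  by (simp add: theta_def mseminorm_iff mult_seminorm_def)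

lemma topspace_berk_top [simp]: "topspace (berk_top av) = berk av"
proof -
  have "x \<in> (\<Union>({ {z. \<exists>s. z = Fin s \<and> s f \<in> U} | f U. open U } \<union>
         { {z. z = Infty \<or> (\<exists>s. z = Fin s \<and> s [:0, 1:] > R)} | R. True }))" for x :: "'a bpt"
  proof (cases x)
    case None
    then show ?thesis
      by (intro UnionI[of "{z. z = Infty \<or> (\<exists>s. z = Fin s \<and> s [:0, 1:] > 0)}"]) auto
  next
    case (Some s)
    then show ?thesis
      by (intro UnionI[of "{z. \<exists>s. z = Fin s \<and> s 0 \<in> UNIV}"]) (blast intro: open_UNIV, auto)
  qed
  then have "(\<Union>({ {z. \<exists>s. z = Fin s \<and> s f \<in> U} | f U. open U } \<union>
         { {z. z = Infty \<or> (\<exists>s. z = Fin s \<and> s [:0, 1:] > R)} | R. True })) = (UNIV :: 'a bpt set)"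
    by blast
  then show ?thesis
    unfolding berk_top_def topspace_subtopology topology_generated_by_topspace by simp
qed

lemma openin_berk_eval:
  assumes "open U"
  shows "openin (berk_top av) ({z. \<exists>s. z = Fin s \<and> s f \<in> U} \<inter> berk av)"
  unfolding berk_top_def openin_subtopology
  using assms
  by (intro exI[of _ "{z. \<exists>s. z = Fin s \<and> s f \<in> U}"] conjI refl topology_generated_by_Basis) blast

lemma openin_berk_Infty:
  "openin (berk_top av) ({z. z = Infty \<or> (\<exists>s. z = Fin s \<and> s [:0, 1:] > R)} \<inter> berk av)"
  unfolding berk_top_def openin_subtopology
  by (intro exI[of _ "{z. z = Infty \<or> (\<exists>s. z = Fin s \<and> s [:0, 1:] > R)}"] conjI refl
      topology_generated_by_Basis) blast

lemma continuous_map_realI: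
  fixes f :: "'c \<Rightarrow> real"
  assumes "\<And>x e. x \<in> topspace X \<Longrightarrow> 0 < e \<Longrightarrow> \<exists>W. openin X W \<and> x \<in> W \<and> (\<forall>y\<in>W. \<bar>f y - f x\<bar> < e)"
  shows "continuous_map X euclideanreal f"
  unfolding continuous_map_def
proof (intro conjI allI impI)
  fix U :: "real set" assume "openin euclideanreal U"
  then have U: "open U"
    by simp
  show "openin X {x \<in> topspace X. f x \<in> U}"
  proof (subst openin_subopen, clarify)
    fix x assume x: "x \<in> topspace X" "f x \<in> U"
    then obtain e where e: "0 < e" "\<And>y. \<bar>y - f x\<bar> < e \<Longrightarrow> y \<in> U"
      using U unfolding open_dist dist_real_def by blast
    then obtain W where "openin X W" "x \<in> W" "\<forall>y\<in>W. \<bar>f y - f x\<bar> < e"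
      using assms[OF x(1) e(1)] by blast
    then show "\<exists>T. openin X T \<and> x \<in> T \<and> T \<subseteq> {x \<in> topspace X. f x \<in> U}"
      using e(2) openin_subset[of X W] by (intro exI[of _ W]) auto
  qed
qed simp

lemma mseminorm_monom:
  assumes "mseminorm av s"
  shows "s (monom c i) = av c * s [:0, 1:] ^ i"
proof -
  interpret s: mult_seminorm s
    using assms mseminorm_iff by blast
  show ?thesis
    by (simp add: monom_altdef mseminorm_smult[OF assms] s.power)
qed

text \<open>Near infinity the formal leading term dominates: every lower term is smaller by a factor
  of at least |T|. This is the continuity of \<open>theta\<close> at \<open>Infty\<close>.\<close>

lemma mseminorm_top_approx:
  assumes ms: "mseminorm av s" and F: "degree F \<le> n" and T: "1 \<le> s [:0, 1:]"
  shows "\<bar>s F - av (coeff F n) * s [:0, 1:] ^ n\<bar> * s [:0, 1:] \<le> gnorm av 1 F * s [:0, 1:] ^ n"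
proof -
  interpret s: mult_seminorm s
    using ms mseminorm_iff by blast
  have M: "0 \<le> gnorm av 1 F"
    by (rule av.gnorm_nonneg) simp
  have "F = (\<Sum>i\<le>n. monom (coeff F i) i)"
    using poly_as_sum_of_monoms'[OF F] by simp
  also have "\<dots> = (\<Sum>i<n. monom (coeff F i) i) + monom (coeff F n) n"
    by (simp add: lessThan_Suc_atMost[symmetric])
  finally have "F - monom (coeff F n) n = (\<Sum>i<n. monom (coeff F i) i)"
    by (simp add: algebra_simps)
  moreover have "s (\<Sum>i<n. monom (coeff F i) i) \<le> gnorm av 1 F * s [:0, 1:] ^ n / s [:0, 1:]"
  proof (rule s.sum_le)
    fix i assume "i \<in> {..<n}"
    have "av (coeff F i) * s [:0, 1:] ^ i * s [:0, 1:] = av (coeff F i) * s [:0, 1:] ^ Suc i"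
      by simp
    also have "\<dots> \<le> gnorm av 1 F * s [:0, 1:] ^ n"
      using av.gnorm_ge[of 1 F i] T M \<open>i \<in> {..<n}\<close> by (intro mult_mono power_increasing) auto
    finally show "s (monom (coeff F i) i) \<le> gnorm av 1 F * s [:0, 1:] ^ n / s [:0, 1:]"
      using T by (simp add: mseminorm_monom[OF ms] pos_le_divide_eq)
  qed (use M T in auto)
  ultimately have "\<bar>s F - s (monom (coeff F n) n)\<bar> \<le> gnorm av 1 F * s [:0, 1:] ^ n / s [:0, 1:]"
    using s.abs_diff_le[of F "monom (coeff F n) n"] by simp
  then show ?thesis
    using T by (simp add: mseminorm_monom[OF ms] pos_le_divide_eq)
qed

lemma continuous_theta:
  assumes F: "degree F \<le> n"
  shows "continuous_map (berk_top av) euclideanreal (theta n F)"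
proof (rule continuous_map_realI)
  fix z and e :: real assume z: "z \<in> topspace (berk_top av)" and e: "0 < e"
  show "\<exists>W. openin (berk_top av) W \<and> z \<in> W \<and> (\<forall>y\<in>W. \<bar>theta n F y - theta n F z\<bar> < e)"
  proof (cases z)
    case None
    define M where "M = gnorm av 1 F"
    \<comment> \<open>The bound 1 makes |T| the larger homogeneous coordinate; the bound M / e
      pushes the relative error M / |T| below e.\<close>
    define R where "R = max 1 (M / e)"
    have "\<bar>theta n F (Fin s) - av (coeff F n)\<bar> < e" if s: "mseminorm av s" "R < s [:0, 1:]" for s
    proof -
      define t where "t = s [:0, 1:]"
      have t: "1 < t" "M / e < t"
        using s(2) by (auto simp: t_def R_def)
      have "\<bar>s F - av (coeff F n) * t ^ n\<bar> * t \<le> M * t ^ n"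
        using mseminorm_top_approx[OF s(1) F] t by (simp add: t_def M_def)
      also have "M * t ^ n < e * t * t ^ n"
        using t e by (intro mult_strict_right_mono) (auto simp: field_simps)
      finally have "\<bar>s F - av (coeff F n) * t ^ n\<bar> < e * t ^ n"
        using t by (simp add: mult_ac)
      moreover have "theta n F (Fin s) - av (coeff F n) = (s F - av (coeff F n) * t ^ n) / t ^ n"
        using t by (simp add: theta_Fin[OF s(1)] diff_divide_distrib flip: t_def)
      ultimately show ?thesis
        using t by (simp add: abs_divide pos_divide_less_eq)
    qed
    then show ?thesis
      using None e
      by (intro exI[of _ "{z. z = Infty \<or> (\<exists>s. z = Fin s \<and> s [:0, 1:] > R)} \<inter> berk av"]
          conjI openin_berk_Infty) (auto simp: theta_Infty)
  next
    case (Some s)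
    \<comment> \<open>The affine part, written as the condition that the value at 0 lies in all of
      the reals, so that it is visibly a basic open set.\<close>
    define A where "A = {z. \<exists>s. z = Fin s \<and> s (0 :: 'a poly) \<in> (UNIV :: real set)} \<inter> berk av"
    have A: "openin (berk_top av) A"
      unfolding A_def by (rule openin_berk_eval) simp
    have tA: "topspace (subtopology (berk_top av) A) = A"
      using openin_subset[OF A] by (auto simp: topspace_subtopology)
    have h: "continuous_map (subtopology (berk_top av) A) euclideanreal (\<lambda>z. hnorm z k G)" for k G
      unfolding continuous_map_def
    proof (intro conjI allI impI)
      fix U :: "real set" assume "openin euclideanreal U"
      then have "openin (berk_top av) ({z. \<exists>s. z = Fin s \<and> s G \<in> U} \<inter> berk av)"
        by (intro openin_berk_eval) simp
      moreover have "{x \<in> topspace (subtopology (berk_top av) A). hnorm x k G \<in> U}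
          = A \<inter> ({z. \<exists>s. z = Fin s \<and> s G \<in> U} \<inter> berk av)"
        unfolding tA by (auto simp: A_def)
      ultimately show "openin (subtopology (berk_top av) A)
          {x \<in> topspace (subtopology (berk_top av) A). hnorm x k G \<in> U}"
        using openin_Int[OF A] by (simp only: openin_open_subtopology[OF A] inf_le1)
    qed simp
    have "continuous_map (subtopology (berk_top av) A) euclideanreal (theta n F)"
      unfolding theta_def
    proof (intro continuous_intros h)
      fix x assume "x \<in> topspace (subtopology (berk_top av) A)"
      then obtain s where "x = Fin s" "mseminorm av s"
        unfolding tA by (auto simp: A_def)
      then show "max (hnorm x 1 [:0, 1:]) (hnorm x 1 1) ^ n \<noteq> 0"
        by (simp add: mseminorm_iff mult_seminorm_def)
    qed
    then have "openin (subtopology (berk_top av) A)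
        {x \<in> topspace (subtopology (berk_top av) A). theta n F x \<in> ball (theta n F z) e}"
      by (rule openin_continuous_map_preimage) simp
    then have "openin (berk_top av) {x \<in> A. theta n F x \<in> ball (theta n F z) e}"
      unfolding tA using A by (simp add: openin_open_subtopology)
    then show ?thesis
      using Some z e
      by (intro exI[of _ "{x \<in> A. theta n F x \<in> ball (theta n F z) e}"])
        (auto simp: A_def dist_real_def)
  qed
qed

text \<open>The coordinates \<open>theta\<close> generate the topology: \<open>theta 1 1\<close>
  vanishes only at \<open>Infty\<close>; off it, the value at f is \<open>theta (degree f) f\<close>
  divided by the matching power of \<open>theta 1 1\<close>; and |T| > R is an inequality between
  \<open>theta 1 [:0, 1:]\<close> and R times \<open>theta 1 1\<close>.\<close>

lemma continuous_map_into_berk: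
  assumes h: "\<And>x. x \<in> topspace X \<Longrightarrow> h x \<in> berk av"
    and th: "\<And>n F. degree F \<le> n \<Longrightarrow> continuous_map X euclideanreal (\<lambda>x. theta n F (h x))"
  shows "continuous_map X (berk_top av) h"
proof -
  define B where "B = { {z. \<exists>s. z = Fin s \<and> s f \<in> U} | (f :: 'a poly) U. open (U :: real set) } \<union>
         { {z. z = Infty \<or> (\<exists>s. z = Fin s \<and> s [:0, 1:] > R)} | (R :: real). True }"
  have "openin X (h -` V \<inter> topspace X)" if "V \<in> B" for V
  proof -
    have "(\<exists>f U. V = {z. \<exists>s. z = Fin s \<and> s f \<in> U} \<and> open U) \<or>
      (\<exists>R. V = {z. z = Infty \<or> (\<exists>s. z = Fin s \<and> s [:0, 1:] > R)} \<and> True)"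
      using that unfolding B_def Un_iff mem_Collect_eq .
    then show ?thesis
    proof (elim disjE exE conjE)
      fix f U assume 1: "V = {z. \<exists>s. z = Fin s \<and> s f \<in> U}" "open U"
      define p where "p x = theta 1 1 (h x)" for x
      define q where "q x = theta (degree f) f (h x)" for x
      define A where "A = {x \<in> topspace X. p x \<in> {0<..}}"
      have p: "continuous_map X euclideanreal p" and q: "continuous_map X euclideanreal q"
        unfolding p_def q_def by (rule th; simp)+
      have A: "openin X A"
        unfolding A_def by (rule openin_continuous_map_preimage[OF p]) simp
      have tA: "topspace (subtopology X A) = A"
        using openin_subset[OF A] by (auto simp: topspace_subtopology)
      have "continuous_map (subtopology X A) euclideanreal (\<lambda>x. q x / p x ^ degree f)"
        by (intro continuous_intros continuous_map_from_subtopology p q) (auto simp: A_def)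
      then have "openin (subtopology X A) {x \<in> topspace (subtopology X A). q x / p x ^ degree f \<in> U}"
        using 1 by (intro openin_continuous_map_preimage) auto
      then have "openin X {x \<in> A. q x / p x ^ degree f \<in> U}"
        unfolding tA using A by (simp add: openin_open_subtopology)
      moreover have "x \<in> A \<and> q x / p x ^ degree f \<in> U \<longleftrightarrow> h x \<in> V" if x: "x \<in> topspace X" for x
      proof (cases "h x")
        case None
        then show ?thesis
          by (simp add: A_def p_def theta_Infty 1)
      next
        case (Some s)
        then have s: "mseminorm av s"
          using h[OF x] by simp
        then have "s 1 = 1"
          by (simp add: mseminorm_iff mult_seminorm_def)
        have "0 < max (s [:0, 1:]) 1"
          by simp
        then show ?thesis
          using x Some \<open>s 1 = 1\<close>
          by (simp add: A_def p_def q_def theta_Fin[OF s] 1 power_divide del: less_max_iff_disj)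
      qed
      then have "{x \<in> A. q x / p x ^ degree f \<in> U} = h -` V \<inter> topspace X"
        using tA openin_subset[OF A] by auto
      ultimately show ?thesis
        by simp
    next
      fix R assume 2: "V = {z. z = Infty \<or> (\<exists>s. z = Fin s \<and> s [:0, 1:] > R)}"
      have "continuous_map X euclideanreal (\<lambda>x. theta 1 [:0, 1:] (h x) - R * theta 1 1 (h x))"
        by (intro continuous_intros th) auto
      then have "openin X {x \<in> topspace X. theta 1 [:0, 1:] (h x) - R * theta 1 1 (h x) \<in> {0<..}}"
        by (rule openin_continuous_map_preimage) simp
      moreover have "theta 1 [:0, 1:] (h x) - R * theta 1 1 (h x) \<in> {0<..} \<longleftrightarrow> h x \<in> V"
        if x: "x \<in> topspace X" for x
      proof (cases "h x")
        case None
        then show ?thesis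
          by (simp add: theta_Infty 2)
      next
        case (Some s)
        then have s: "mseminorm av s"
          using h[OF x] by simp
        then have "s 1 = 1"
          by (simp add: mseminorm_iff mult_seminorm_def)
        define m where "m = max (s [:0, 1:]) 1"
        have "0 < m"
          unfolding m_def by simp
        then show ?thesis
          using Some \<open>s 1 = 1\<close> by (simp add: theta_Fin[OF s] 2 divide_less_cancel flip: m_def)
      qed
      then have "{x \<in> topspace X. theta 1 [:0, 1:] (h x) - R * theta 1 1 (h x) \<in> {0<..}}
          = h -` V \<inter> topspace X"
        by blast
      ultimately show ?thesis
        by simp
    qed
  qed
  moreover have "h ` topspace X \<subseteq> \<Union>B"
  proof -
    have "berk av \<subseteq> \<Union>B"
      using topspace_berk_top
      unfolding berk_top_def topspace_subtopology topology_generated_by_topspace B_def by blast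
    then show ?thesis
      using h by blast
  qed
  ultimately have "continuous_map X (topology_generated_by B) h"
    by (intro continuous_on_generated_topo) auto
  then show ?thesis
    using h unfolding berk_top_def B_def continuous_map_in_subtopology by blast
qed

lemma continuous_bact:
  assumes PQ: "coprime P Q" "0 < rdeg (P, Q)"
  shows "continuous_map (berk_top av) (berk_top av) (bact av (P, Q))"
proof (rule continuous_map_into_berk)
  show "bact av (P, Q) x \<in> berk av" if "x \<in> topspace (berk_top av)" for x
    using bact_in_berk[OF PQ] that by simp
  define d where "d = rdeg (P, Q)"
  have d: "degree P \<le> d" "degree Q \<le> d"
    by (auto simp: d_def rdeg_def)
  fix n and F :: "'a poly" assume F: "degree F \<le> n"
  have mpos: "0 < max (hnorm z 1 [:0, 1:]) (hnorm z 1 1)" if "z \<in> berk av" for z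
    using that by (cases z) (auto simp: mseminorm_iff mult_seminorm_def less_max_iff_disj)
  \<comment> \<open>The unknown scale k from \<open>maps_to\<close> occurs to the n-th power in
    numerator and denominator and cancels. Since k > 0, the maximum cannot vanish.\<close>
  have *: "max (theta d P z) (theta d Q z) \<noteq> 0 \<and>
     theta n F (bact av (P, Q) z) = theta (n * d) (hom n F P Q) z / max (theta d P z) (theta d Q z) ^ n"
    if z: "z \<in> berk av" for z
  proof -
    define w where "w = bact av (P, Q) z"
    have w: "w \<in> berk av"
      unfolding w_def using bact_in_berk[OF PQ z] .
    obtain k where k: "0 < k"
      "\<And>n f. degree f \<le> n \<Longrightarrow> hnorm z (n * d) (hom n f P Q) = k ^ n * hnorm w n f"
      using maps_to_bact[OF PQ z] unfolding maps_to_def w_def d_def by blast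
    define m where "m = max (hnorm z 1 [:0, 1:]) (hnorm z 1 1)"
    define m' where "m' = max (hnorm w 1 [:0, 1:]) (hnorm w 1 1)"
    have pos: "0 < m" "0 < m'"
      unfolding m_def m'_def using mpos z w by blast+
    have "theta d P z = k * hnorm w 1 [:0, 1:] / m ^ d" "theta d Q z = k * hnorm w 1 1 / m ^ d"
      using k(2)[of "[:0, 1:]" 1] k(2)[of 1 1] by (simp_all add: theta_def hom_def m_def)
    then have mx: "max (theta d P z) (theta d Q z) = k * m' / m ^ d"
      using pos k(1) unfolding m'_def
      by (smt (verit) divide_right_mono max_def mult_left_mono zero_le_power)
    have "theta (n * d) (hom n F P Q) z = k ^ n * hnorm w n F / (m ^ d) ^ n"
      unfolding theta_def k(2)[OF F] m_def[symmetric]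
      using power_mult[of m d n] by (simp add: mult.commute[of n d])
    moreover have "theta n F w = hnorm w n F / m' ^ n"
      by (simp add: theta_def m'_def)
    ultimately show ?thesis
      using pos k(1) unfolding mx w_def[symmetric]
      by (simp add: power_divide power_mult_distrib)
  qed
  have "continuous_map (berk_top av) euclideanreal
     (\<lambda>z. theta (n * d) (hom n F P Q) z / max (theta d P z) (theta d Q z) ^ n)"
    using * d by (intro continuous_intros continuous_theta degree_hom_le) auto
  then show "continuous_map (berk_top av) euclideanreal (\<lambda>z. theta n F (bact av (P, Q) z))"
    using * by (subst continuous_map_eq[of _ _ _ _]) (auto elim!: continuous_map_eq)
qed

lemma continuous_mact: "mob_ok m \<Longrightarrow> continuous_map (berk_top av) (berk_top av) (mact m)"
  using continuous_bact[of "fst (mob m)" "snd (mob m)"] rdeg_mob[of m] coprime_mob[of m] by simp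

lemma continuous_thicken:
  assumes s: "mseminorm av s"
  shows "continuous_map (top_of_set {0..}) (berk_top av) (\<lambda>r. Fin (thicken s r))"
proof (rule continuous_map_into_berk)
  show "Fin (thicken s r) \<in> berk av" if "r \<in> topspace (top_of_set {0..})" for r
    using that by (simp add: mseminorm_thicken[OF s])
  fix n F
  have "continuous_on {0..} (\<lambda>r. thicken s r F / max (thicken s r [:0, 1:]) 1 ^ n)"
    unfolding thicken_def by (intro continuous_intros continuous_on_gnorm) auto
  then have "continuous_on {0..} (\<lambda>r. theta n F (Fin (thicken s r)))"
    by (rule continuous_on_eq) (simp add: theta_Fin mseminorm_thicken[OF s])
  then show "continuous_map (top_of_set {0..}) euclideanreal (\<lambda>r. theta n F (Fin (thicken s r)))"
    by simp
qed

end

section \<open>Directions at a type 2 point\<close>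

text \<open>In a partition into open sets the complement of a block is a union of open blocks, so
  blocks are clopen; a connected clopen set is a component.\<close>

lemma connected_components_of_eqI:
  assumes conn: "\<And>W. W \<in> \<W> \<Longrightarrow> connectedin X W \<and> openin X W \<and> W \<noteq> {}"
    and disj: "\<And>W W'. W \<in> \<W> \<Longrightarrow> W' \<in> \<W> \<Longrightarrow> W \<inter> W' \<noteq> {} \<Longrightarrow> W = W'"
    and cover: "\<Union>\<W> = topspace X"
  shows "connected_components_of X = \<W>"
proof -
  have comp: "connected_component_of_set X x = W" if W: "W \<in> \<W>" and x: "x \<in> W" for W x
  proof
    have "closedin X W"
    proof -
      have "topspace X - W = \<Union>(\<W> - {W})"
        using cover disj W by blast
      then have "openin X (topspace X - W)"
        using conn by auto
      then show ?thesis
        using conn[OF W] openin_subset by (auto simp: closedin_def)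
    qed
    then have "connected_component_of_set X x \<subseteq> W \<or> disjnt (connected_component_of_set X x) W"
      using conn[OF W] by (intro connectedin_clopen_cases) (auto simp: connectedin_connected_component_of)
    moreover have "x \<in> connected_component_of_set X x"
      using W x cover by (auto simp: connected_component_of_refl)
    ultimately show "connected_component_of_set X x \<subseteq> W"
      using x by (auto simp: disjnt_def)
    show "W \<subseteq> connected_component_of_set X x"
      using conn[OF W] x by (intro connected_component_of_maximal) auto
  qed
  show ?thesis
  proof
    show "connected_components_of X \<subseteq> \<W>"
      unfolding connected_components_of_def using cover comp by blast
    show "\<W> \<subseteq> connected_components_of X"
    proof
      fix W assume W: "W \<in> \<W>"
      then obtain x where "x \<in> W"
        using conn by blast
      then show "W \<in> connected_components_of X"
        unfolding connected_components_of_def using comp[OF W] cover W by blast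
    qed
  qed
qed

context alg_closed_nonarch
begin

text \<open>The direction at the Gauss point containing 0. Comparing two forms excludes
  \<open>Infty\<close> without a case distinction and passes through \<open>maps_to\<close>.\<close>

definition open_disk :: "'a bpt set" where
  "open_disk = {z \<in> berk av. hnorm z 1 [:0, 1:] < hnorm z 1 1}"

lemma Infty_notin_open_disk [simp]: "Infty \<notin> open_disk"
  by (simp add: open_disk_def)

lemma Fin_in_open_disk: "Fin s \<in> open_disk \<longleftrightarrow> mseminorm av s \<and> s [:0, 1:] < 1"
  by (auto simp: open_disk_def mseminorm_iff mult_seminorm_def)

lemma maps_to_open_disk_iff:
  assumes "maps_to d F G z w"
  shows "w \<in> open_disk \<longleftrightarrow> hnorm z d F < hnorm z d G"
proof -
  obtain k where k: "0 < k" "\<And>a b. hnorm z d (smult a F + smult b G) = k * hnorm w 1 [:b, a:]"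
    using maps_to_linear[OF assms] by blast
  show ?thesis
    using k(1) k(2)[of 1 0] k(2)[of 0 1] maps_to_in_berk[OF assms]
    by (simp add: open_disk_def one_pCons)
qed

lemma type1_0_in_open_disk: "type1_pt av 0 \<in> open_disk"
  using mseminorm_type1[of 0] by (simp add: type1_pt_def Fin_in_open_disk)

lemma openin_open_disk: "openin (berk_top av) open_disk"
proof -
  have "continuous_map (berk_top av) euclideanreal (\<lambda>z. theta 1 1 z - theta 1 [:0, 1:] z)"
    by (intro continuous_intros continuous_theta) auto
  then have "openin (berk_top av)
      {z \<in> topspace (berk_top av). theta 1 1 z - theta 1 [:0, 1:] z \<in> {0<..}}"
    by (rule openin_continuous_map_preimage) simp
  moreover have "theta 1 1 z - theta 1 [:0, 1:] z \<in> {0<..} \<longleftrightarrow> hnorm z 1 [:0, 1:] < hnorm z 1 1"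
    if "z \<in> berk av" for z
  proof (cases z)
    case None
    then show ?thesis
      by (simp add: theta_Infty)
  next
    case (Some s)
    then have s: "mseminorm av s"
      using that by simp
    have "0 < max (s [:0, 1:]) 1"
      by simp
    then show ?thesis
      using Some by (simp add: theta_Fin[OF s] divide_less_cancel del: less_max_iff_disj)
  qed
  ultimately show ?thesis
    unfolding open_disk_def by (simp cong: conj_cong)
qed

text \<open>Each path stops short of radius 1 and thus stays in the disk; united with the path of
  the origin it is connected, and all these unions share the origin.\<close>

lemma connectedin_open_disk: "connectedin (berk_top av) open_disk"
proof -
  define \<Gamma> where "\<Gamma> s = (\<lambda>r. Fin (thicken s r)) ` {0..<1}" for s
  define origin where "origin = (\<lambda>f. av (poly f 0))"
  have origin: "mseminorm av origin"
    unfolding origin_def by (rule mseminorm_type1)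
  have \<Gamma>: "connectedin (berk_top av) (\<Gamma> s)" if "mseminorm av s" for s
    unfolding \<Gamma>_def
    by (rule connectedin_continuous_map_image[OF continuous_thicken[OF that]])
      (auto simp: connectedin_subtopology)
  have sub: "\<Gamma> s \<subseteq> open_disk" if "Fin s \<in> open_disk" for s
    using that by (auto simp: \<Gamma>_def Fin_in_open_disk mseminorm_thicken thicken_linear)
  have origin_disk: "Fin origin \<in> open_disk"
    using type1_0_in_open_disk by (simp add: type1_pt_def origin_def)
  have self: "Fin s \<in> \<Gamma> s" if "mseminorm av s" for s
    unfolding \<Gamma>_def using thicken_0[OF that] by (intro image_eqI[of _ _ 0]) auto
  have meet: "\<Gamma> s \<inter> \<Gamma> origin \<noteq> {}" if "Fin s \<in> open_disk" for s
  proof -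
    \<comment> \<open>The radius at which the two paths merge; it is below 1 exactly because the
      point lies in the disk.\<close>
    define r where "r = s [:0, 1:]"
    have s: "mseminorm av s" and r: "0 \<le> r" "r < 1"
      using that by (auto simp: r_def Fin_in_open_disk mseminorm_def)
    have "Fin (thicken s r) = Fin (thicken origin r)"
      using Fin_thicken_eq_disk[OF s] Fin_thicken_eq_disk[OF origin] r by (simp add: r_def origin_def)
    moreover have "Fin (thicken s r) \<in> \<Gamma> s" "Fin (thicken origin r) \<in> \<Gamma> origin"
      using r unfolding \<Gamma>_def by auto
    ultimately show ?thesis
      by auto
  qed
  have "connectedin (berk_top av) (\<Union>((\<lambda>s. \<Gamma> s \<union> \<Gamma> origin) ` {s. Fin s \<in> open_disk}))"
  proof (rule connectedin_Union)
    show "connectedin (berk_top av) S" if "S \<in> (\<lambda>s. \<Gamma> s \<union> \<Gamma> origin) ` {s. Fin s \<in> open_disk}" for S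
      using that meet \<Gamma> origin by (auto intro!: connectedin_Un simp: Fin_in_open_disk)
    show "\<Inter>((\<lambda>s. \<Gamma> s \<union> \<Gamma> origin) ` {s. Fin s \<in> open_disk}) \<noteq> {}"
      using self[OF origin] by blast
  qed
  moreover have "\<Union>((\<lambda>s. \<Gamma> s \<union> \<Gamma> origin) ` {s. Fin s \<in> open_disk}) = open_disk"
  proof
    show "open_disk \<subseteq> \<Union>((\<lambda>s. \<Gamma> s \<union> \<Gamma> origin) ` {s. Fin s \<in> open_disk})"
    proof
      fix z assume z: "z \<in> open_disk"
      then obtain s where "z = Fin s" "mseminorm av s"
        by (cases z) (auto simp: Fin_in_open_disk)
      then show "z \<in> \<Union>((\<lambda>s. \<Gamma> s \<union> \<Gamma> origin) ` {s. Fin s \<in> open_disk})"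
        using z self by blast
    qed
  qed (use sub origin_disk in blast)
  ultimately show ?thesis
    by simp
qed

text \<open>\<open>GL_2\<close> of the valuation ring. Up to scalars it is the stabiliser of the
  Gauss point: see \<open>mact_gauss\<close> and \<open>gauss_fixed_unimod\<close>.\<close>

definition unimod :: "'a \<times> 'a \<times> 'a \<times> 'a \<Rightarrow> bool" where
  "unimod m \<longleftrightarrow> (case m of (a, b, c, d) \<Rightarrow>
     av a \<le> 1 \<and> av b \<le> 1 \<and> av c \<le> 1 \<and> av d \<le> 1 \<and> av (a * d - b * c) = 1)"

lemma unimod_mob_ok: "unimod m \<Longrightarrow> mob_ok m"
  by (cases m) (auto simp: unimod_def mob_ok_def)

lemma unimod_inv: "unimod m \<Longrightarrow> unimod (mob_inv m)"
  by (cases m) (auto simp: unimod_def mob_inv_def mult.commute)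

lemma av_mult_le: "av x \<le> 1 \<Longrightarrow> av y \<le> c \<Longrightarrow> av (x * y) \<le> c"
  using mult_mono[of "av x" 1 "av y" c] by (simp add: av.mult)

lemma unimod_mmul:
  assumes "unimod m" "unimod m'"
  shows "unimod (mmul m m')"
proof -
  obtain a b c d where m: "m = (a, b, c, d)" by (cases m)
  obtain a' b' c' d' where m': "m' = (a', b', c', d')" by (cases m')
  have "(a * a' + b * c') * (c * b' + d * d') - (a * b' + b * d') * (c * a' + d * c')
      = (a * d - b * c) * (a' * d' - b' * c')"
    by (simp add: algebra_simps)
  then show ?thesis
    using assms by (auto simp: m m' unimod_def mmul_def av.mult intro!: av.add_le av_mult_le)
qed

text \<open>Integral matrices do not increase the maximum norm; Cramer's rule with a unit
  determinant gives the reverse inequality.\<close>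

lemma unimod_max:
  assumes "unimod (a, b, c, d)"
  shows "max (av (a * x + b * y)) (av (c * x + d * y)) = max (av x) (av y)"
proof (rule antisym)
  have i: "av a \<le> 1" "av b \<le> 1" "av c \<le> 1" "av d \<le> 1" and det: "av (a * d - b * c) = 1"
    using assms by (auto simp: unimod_def)
  show "max (av (a * x + b * y)) (av (c * x + d * y)) \<le> max (av x) (av y)"
    using i by (auto intro!: av.add_le av_mult_le)
  define X where "X = a * x + b * y"
  define Y where "Y = c * x + d * y"
  have "(a * d - b * c) * x = d * X - b * Y" "(a * d - b * c) * y = a * Y - c * X"
    by (simp_all add: X_def Y_def algebra_simps)
  then have "av x = av (d * X - b * Y)" "av y = av (a * Y - c * X)"
    using det av.mult[of "a * d - b * c"] by (metis mult_1)+
  moreover have "av (d * X - b * Y) \<le> max (av X) (av Y)" "av (a * Y - c * X) \<le> max (av X) (av Y)"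
    using i by (auto intro!: av.diff_le av_mult_le)
  ultimately show "max (av x) (av y) \<le> max (av (a * x + b * y)) (av (c * x + d * y))"
    unfolding X_def Y_def by simp
qed

lemma mact_gauss:
  assumes m: "unimod m"
  shows "mact m (gauss_pt av) = gauss_pt av"
proof -
  obtain a b c d where m': "m = (a, b, c, d)" by (cases m)
  define w where "w = mact m (gauss_pt av)"
  have mt: "maps_to 1 [:b, a:] [:d, c:] (gauss_pt av) w"
    using maps_to_mact[OF unimod_mob_ok[OF m] gauss_in_berk] by (simp add: m' mob_def w_def)
  obtain k where k: "0 < k"
    "\<And>p q. hnorm (gauss_pt av) 1 (smult p [:b, a:] + smult q [:d, c:]) = k * hnorm w 1 [:q, p:]"
    using maps_to_linear[OF mt] by blast
  \<comment> \<open>The coefficients of p (a T + b) + q (c T + d) come from (p, q) by the transposed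
    matrix.\<close>
  have um: "unimod (a, c, b, d)"
    using m by (simp add: m' unimod_def mult.commute)
  have kk: "max (av p) (av q) = k * hnorm w 1 [:q, p:]" for p q
    using k(2)[of p q] unimod_max[OF um, of p q]
    by (simp add: gauss_pt_eq av.gnorm_linear mult.commute max.commute)
  have w: "w \<in> berk av"
    using maps_to_in_berk[OF mt] .
  obtain s where s: "w = Fin s" "mseminorm av s"
    using kk[of 0 1] w by (cases w) auto
  have "k = 1"
    using kk[of 0 1] s by (simp add: mseminorm_def)
  have "s [:-x, 1:] = gnorm av 1 [:-x, 1:]" for x
    using kk[of 1 "- x"] s(1) \<open>k = 1\<close> by (simp add: av.gnorm_linear max.commute)
  then have "s = gnorm av 1"
    by (rule mseminorm_eqI[OF s(2) mseminorm_gauss])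
  then show ?thesis
    using s by (simp add: w_def gauss_pt_eq)
qed

text \<open>Fixing the Gauss point means that the matrix multiplies maximum norms by a constant l.
  Eliminating one coefficient at a time shows that the determinant has absolute value l squared, so
  dividing by an entry of absolute value l gives a unit determinant.\<close>

lemma gauss_fixed_unimod:
  assumes m: "mob_ok m" and fixed: "mact m (gauss_pt av) = gauss_pt av"
  obtains k where "k \<noteq> 0" "unimod (mscale k m)"
proof -
  obtain a b c d where m': "m = (a, b, c, d)" by (cases m)
  have mt: "maps_to 1 [:b, a:] [:d, c:] (gauss_pt av) (gauss_pt av)"
    using maps_to_mact[OF m gauss_in_berk] fixed by (simp add: m' mob_def)
  obtain l where l: "0 < l"
    "\<And>p q. hnorm (gauss_pt av) 1 (smult p [:b, a:] + smult q [:d, c:])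
       = l * hnorm (gauss_pt av) 1 [:q, p:]"
    using maps_to_linear[OF mt] by blast
  have ll: "max (av (p * b + q * d)) (av (p * a + q * c)) = l * max (av q) (av p)" for p q
    using l(2)[of p q] by (simp add: gauss_pt_eq av.gnorm_linear)
  have l1: "max (av b) (av a) = l" "max (av d) (av c) = l"
    using ll[of 1 0] ll[of 0 1] by simp_all
  define D where "D = a * d - b * c"
  have D: "D \<noteq> 0"
    using m by (simp add: m' D_def mob_ok_def)
  \<comment> \<open>The combination with p = c and q = -a kills the coefficient of T and leaves
    minus the determinant as constant term.\<close>
  have "c * b + - a * d = - D" "c * a + - a * c = 0"
    by (simp_all add: D_def algebra_simps)
  then have "av D = l * max (av a) (av c)"
    using ll[of c "- a"] by simp
  moreover have "av D = l * max (av b) (av d)"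
    using ll[of d "- b"] by (simp add: D_def algebra_simps)
  ultimately have "max (av a) (av c) = max (av b) (av d)"
    using l(1) by simp
  then have "max (av a) (av c) = l"
    using l1 by (auto simp: max_def split: if_splits)
  then have DL: "av D = l * l"
    using \<open>av D = l * max (av a) (av c)\<close> by simp
  obtain e where e: "av e = l" "e \<noteq> 0"
    using l1(1) l(1) by (metis max_def av_pos)
  have "av a \<le> l" "av b \<le> l" "av c \<le> l" "av d \<le> l"
    using l1 by auto
  moreover have "1 / e * a * (1 / e * d) - 1 / e * b * (1 / e * c) = D / (e * e)"
    using e(2) by (simp add: D_def field_simps)
  ultimately have "unimod (mscale (1 / e) m)"
    using e DL l(1) by (simp add: unimod_def mscale_def m' av_divide av.mult)
  then show ?thesis
    using that[of "1 / e"] e by simp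
qed

lemma image_open_disk_iff:
  assumes "mob_ok m"
  shows "z \<in> mact m ` open_disk \<longleftrightarrow> z \<in> berk av \<and> mact (mob_inv m) z \<in> open_disk"
proof
  assume "z \<in> mact m ` open_disk"
  then show "z \<in> berk av \<and> mact (mob_inv m) z \<in> open_disk"
    using assms mact_inv(1)[OF assms] mact_in_berk[OF assms] by (auto simp: open_disk_def)
next
  assume "z \<in> berk av \<and> mact (mob_inv m) z \<in> open_disk"
  then show "z \<in> mact m ` open_disk"
    using mact_inv(2)[OF assms, of z] by (metis imageI)
qed

lemma in_translated_disk:
  assumes "mseminorm av s" "s [:-a, 1:] < 1"
  shows "Fin s \<in> mact (1, a, 0, 1) ` open_disk"
proof -
  have ok: "mob_ok (1, a, 0, 1)"
    by (simp add: mob_ok_def)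
  have "s [:1:] = 1"
    using assms by (simp add: mseminorm_def)
  moreover have "Fin s \<in> berk av"
    using assms by simp
  ultimately show ?thesis
    using assms maps_to_open_disk_iff[OF maps_to_mact[OF mob_ok_inv[OF ok], of "Fin s"]]
    unfolding image_open_disk_iff[OF ok] by (simp add: mob_inv_def mob_def)
qed

lemma in_infinite_disk:
  assumes "z \<in> berk av" "hnorm z 1 1 < hnorm z 1 [:0, 1:]"
  shows "z \<in> mact (0, 1, 1, 0) ` open_disk"
proof -
  have ok: "mob_ok (0, 1, 1, 0)"
    by (simp add: mob_ok_def)
  have "hnorm z 1 [:-1:] = hnorm z 1 1" "hnorm z 1 [:0, -1:] = hnorm z 1 [:0, 1:]"
    using hnorm_smult[OF assms(1), of 1 "-1" 1] hnorm_smult[OF assms(1), of 1 "-1" "[:0, 1:]"]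
    by (simp_all add: one_pCons)
  then show ?thesis
    using assms maps_to_open_disk_iff[OF maps_to_mact[OF mob_ok_inv[OF ok], of z]]
    unfolding image_open_disk_iff[OF ok] by (simp add: mob_inv_def mob_def)
qed

lemma unimod_translation: "av a \<le> 1 \<Longrightarrow> unimod (1, a, 0, 1)"
  and unimod_inversion: "unimod (0, 1, 1, 0)"
  by (auto simp: unimod_def)

text \<open>A point with |T| at most 1 outside all residue disks satisfies |T - a| = 1 for every
  integral a, hence agrees with the Gauss norm on all linear polynomials.\<close>

lemma direction_cover:
  assumes z: "z \<in> berk av" and ne: "z \<noteq> gauss_pt av"
  shows "\<exists>m. unimod m \<and> z \<in> mact m ` open_disk"
proof (cases "hnorm z 1 1 < hnorm z 1 [:0, 1:]")
  case True
  then show ?thesis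
    using in_infinite_disk[OF z] unimod_inversion by blast
next
  case False
  then obtain s where s: "z = Fin s" "mseminorm av s"
    using z by (cases z) auto
  have T: "s [:0, 1:] \<le> 1"
    using False s by (simp add: mseminorm_iff mult_seminorm_def)
  have "\<exists>a. av a \<le> 1 \<and> s [:-a, 1:] < 1"
  proof (rule ccontr)
    assume no: "\<not> (\<exists>a. av a \<le> 1 \<and> s [:-a, 1:] < 1)"
    have "s = gnorm av 1"
    proof (rule mseminorm_eqI[OF s(2) mseminorm_gauss])
      fix a
      have "max (s [:-a, 1:]) 1 = max (av a) 1"
        by (rule mseminorm_linear_le[OF s(2) T])
      moreover have "1 \<le> s [:-a, 1:] \<or> 1 < av a"
        using no not_le by blast
      ultimately show "s [:-a, 1:] = gnorm av 1 [:-a, 1:]"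
        by (auto simp: av.gnorm_linear max_def split: if_splits)
    qed
    then show False
      using ne s by (simp add: gauss_pt_eq)
  qed
  then show ?thesis
    using in_translated_disk[OF s(2)] unimod_translation s(1) by blast
qed

text \<open>If the disk and its image meet, then |b| < 1 and |a| = |d| = 1. These conditions hold
  for the adjugate too, so one computation settles both inclusions.\<close>

lemma unimod_image_subset:
  assumes m: "unimod m" and w: "w \<in> open_disk" "mact m w \<in> open_disk"
  shows "mact m ` open_disk \<subseteq> open_disk" "mact (mob_inv m) ` open_disk \<subseteq> open_disk"
proof -
  obtain a b c d where m': "m = (a, b, c, d)" by (cases m)
  have i: "av a \<le> 1" "av b \<le> 1" "av c \<le> 1" "av d \<le> 1" and det: "av (a * d - b * c) = 1"
    using m by (auto simp: m' unimod_def)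
  have lin: "s [:p, q:] \<le> max (av p) (av q * s [:0, 1:])"
    if "mseminorm av s" for s p q
  proof -
    interpret s: mult_seminorm s
      using that mseminorm_iff by blast
    have e: "s [:p:] = av p" "s (smult q [:0, 1:]) = av q * s [:0, 1:]"
      using that mseminorm_smult[OF that, of q "[:0, 1:]"] by (simp_all add: mseminorm_def)
    show "s [:p, q:] \<le> max (av p) (av q * s [:0, 1:])"
      using s.ultra[of "[:p:]" "smult q [:0, 1:]"] e by simp
  qed
  have le: "av q * t < 1" if "av q \<le> 1" "t < 1" "0 \<le> t" for q t
    using that mult_left_le_one_le[of t "av q"] by (simp add: mult.commute) 
  obtain s where s: "w = Fin s" "mseminorm av s" "s [:0, 1:] < 1" "0 \<le> s [:0, 1:]"
    using w by (cases w) (auto simp: Fin_in_open_disk mseminorm_def)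
  have "s [:b, a:] < s [:d, c:]"
    using maps_to_open_disk_iff[OF maps_to_mact[OF unimod_mob_ok[OF m], of w]] w s
    by (simp add: m' mob_def)
  also have "\<dots> \<le> 1"
    using lin[OF s(2), of d c] i(4) le[OF i(3) s(3,4)] by linarith
  finally have b1: "s [:b, a:] < 1" .
  have b: "av b < 1"
  proof -
    interpret s: mult_seminorm s
      using s(2) mseminorm_iff by blast
    have "s [:b:] = s ([:b, a:] - smult a [:0, 1:])"
      by simp
    also have "\<dots> < 1"
      using le[OF i(1) s(3,4)] mseminorm_smult[OF s(2), of a "[:0, 1:]"] by (intro s.diff_lt b1) simp
    finally show ?thesis
      using s(2) by (simp add: mseminorm_def)
  qed
  \<comment> \<open>With |b c| < 1 the unit determinant must come from a d, and two integral factors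
    with unit product are units.\<close>
  have "av (b * c) < 1"
    using le[OF i(3) b] by (simp add: av.mult mult.commute)
  then have ad: "av a * av d = 1"
    using av.eq_if_close[of "a * d - b * c" "a * d"] av.add_lt[of "a * d - b * c" 1 "b * c"] det
      av.add_eq_dominant[of "b * c" "a * d - b * c"]
    by (simp add: av.mult)
  have a: "av a = 1" "av d = 1"
    using ad i(1,4) mult_le_one[of "av a" "av d"] mult_left_le_one_le[of "av d" "av a"]
      mult_left_le_one_le[of "av a" "av d"]
    by (auto simp: mult.commute)
  have main: "mact n ` open_disk \<subseteq> open_disk"
    if n: "unimod n" "n = (a', b', c', d')" "av b' < 1" "av d' = 1" for n a' b' c' d'
  proof
    fix x assume "x \<in> mact n ` open_disk"
    then obtain y where y: "y \<in> open_disk" "x = mact n y"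
      by blast
    then obtain s where s: "y = Fin s" "mseminorm av s" "s [:0, 1:] < 1" "0 \<le> s [:0, 1:]"
      by (cases y) (auto simp: Fin_in_open_disk mseminorm_def)
    have ac: "av a' \<le> 1" "av c' \<le> 1"
      using n by (auto simp: unimod_def)
    interpret s: mult_seminorm s
      using s(2) mseminorm_iff by blast
    have "s [:b', a':] < 1"
      using lin[OF s(2), of b' a'] n(3) le[OF ac(1) s(3,4)] by linarith
    moreover have "s [:d', c':] = s [:d':]"
      using s.eq_if_close[of "[:d', c':]" "[:d':]"] le[OF ac(2) s(3,4)] n(4) s(2)
        mseminorm_smult[OF s(2), of c' "[:0, 1:]"]
      by (simp add: mseminorm_def)
    moreover have "s [:d':] = 1"
      using s(2) n(4) by (simp add: mseminorm_def)
    ultimately show "x \<in> open_disk"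
      using maps_to_open_disk_iff[OF maps_to_mact[OF unimod_mob_ok[OF n(1)], of y]] y s
      by (simp add: n(2) mob_def)
  qed
  show "mact m ` open_disk \<subseteq> open_disk"
    using main[OF m m' b a(2)] .
  show "mact (mob_inv m) ` open_disk \<subseteq> open_disk"
    using main[OF unimod_inv[OF m], of d "- b" "- c" a] b a(1) by (simp add: m' mob_inv_def)
qed

lemma unimod_image_eq:
  assumes m: "unimod m" and w: "mact m ` open_disk \<inter> open_disk \<noteq> {}"
  shows "mact m ` open_disk = open_disk"
proof
  obtain w where w: "w \<in> open_disk" "mact m w \<in> open_disk"
    using assms by blast
  show "mact m ` open_disk \<subseteq> open_disk"
    by (rule unimod_image_subset(1)[OF m w])
  show "open_disk \<subseteq> mact m ` open_disk"
  proof
    fix z assume z: "z \<in> open_disk"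
    then have "mact (mob_inv m) z \<in> open_disk" "z \<in> berk av"
      using unimod_image_subset(2)[OF m w] by (auto simp: open_disk_def)
    then show "z \<in> mact m ` open_disk"
      using image_open_disk_iff[OF unimod_mob_ok[OF m]] by blast
  qed
qed

section \<open>Directions as images of the open unit disk\<close>

definition direction :: "'a \<times> 'a \<times> 'a \<times> 'a \<Rightarrow> 'a bpt set" where
  "direction m = mact m ` open_disk"

lemma open_disk_berk: "z \<in> open_disk \<Longrightarrow> z \<in> berk av"
  by (simp add: open_disk_def)

lemma direction_mmul:
  assumes "mob_ok s" "mob_ok m"
  shows "direction (mmul s m) = mact s ` direction m"
  using mact_mmul[OF assms open_disk_berk] by (auto simp: direction_def)

lemma direction_iff:
  "mob_ok m \<Longrightarrow> z \<in> direction m \<longleftrightarrow> z \<in> berk av \<and> mact (mob_inv m) z \<in> open_disk"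
  unfolding direction_def by (rule image_open_disk_iff)

lemma openin_direction: "mob_ok m \<Longrightarrow> openin (berk_top av) (direction m)"
proof -
  assume m: "mob_ok m"
  have "direction m = {z \<in> topspace (berk_top av). mact (mob_inv m) z \<in> open_disk}"
    using direction_iff[OF m] by auto
  then show ?thesis
    using openin_continuous_map_preimage[OF continuous_mact[OF mob_ok_inv[OF m]] openin_open_disk]
    by simp
qed

lemma connectedin_direction: "mob_ok m \<Longrightarrow> connectedin (berk_top av) (direction m)"
  unfolding direction_def
  using connectedin_continuous_map_image[OF continuous_mact connectedin_open_disk] .

lemma gauss_notin_open_disk: "gauss_pt av \<notin> open_disk"
  by (simp add: gauss_pt_eq Fin_in_open_disk av.gnorm_linear)

text \<open>Pulling back by s and m reduces the claim to the unimodular matrix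
  \<open>mmul (mob_inv m) m'\<close>, whose image of the disk meets the disk.\<close>

lemma direction_meet_eq:
  assumes s: "mob_ok s" and m: "unimod m" "unimod m'"
    and meet: "direction (mmul s m) \<inter> direction (mmul s m') \<noteq> {}"
  shows "direction (mmul s m) = direction (mmul s m')"
proof -
  have ok: "mob_ok m" "mob_ok m'"
    using m unimod_mob_ok by auto
  obtain w w' where w: "w \<in> open_disk" "w' \<in> open_disk" "mact s (mact m w) = mact s (mact m' w')"
    using meet unfolding direction_mmul[OF s ok(1)] direction_mmul[OF s ok(2)]
    unfolding direction_def by auto
  define n where "n = mmul (mob_inv m) m'"
  have n: "unimod n"
    unfolding n_def using m by (intro unimod_mmul unimod_inv)
  have nact: "mact n x = mact (mob_inv m) (mact m' x)" if "x \<in> berk av" for x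
    unfolding n_def using mact_mmul[OF mob_ok_inv[OF ok(1)] ok(2) that] .
  have "mact m w = mact m' w'"
    using w mact_inv(1)[OF s] mact_in_berk ok open_disk_berk by metis
  then have "mact n w' = w"
    using nact mact_inv(1)[OF ok(1)] w open_disk_berk by metis
  then have "mact n ` open_disk = open_disk"
    using unimod_image_eq[OF n] w by blast
  then have "direction m = mact m ` mact n ` open_disk"
    by (simp add: direction_def)
  also have "\<dots> = direction m'"
    unfolding direction_def image_image
    using nact mact_inv(2)[OF ok(1)] mact_in_berk[OF ok(2)] open_disk_berk
    by (intro image_cong) auto
  finally show ?thesis
    unfolding direction_mmul[OF s ok(1)] direction_mmul[OF s ok(2)] by simp
qed

lemma dirs_eq:
  assumes s: "mob_ok s"
  shows "dirs av (mact s (gauss_pt av)) = {direction (mmul s m) | m. unimod m}"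
  unfolding dirs_def
proof (rule connected_components_of_eqI)
  define xi where "xi = mact s (gauss_pt av)"
  have ok: "mob_ok m" "mob_ok (mmul s m)" if "unimod m" for m
    using that s mob_ok_mmul unimod_mob_ok by auto
  have xi: "mact (mob_inv (mmul s m)) xi = gauss_pt av" "xi \<in> berk av" if "unimod m" for m
  proof -
    have "xi = mact (mmul s m) (gauss_pt av)"
      using that mact_mmul[OF s ok(1)] by (simp add: xi_def mact_gauss)
    then show "mact (mob_inv (mmul s m)) xi = gauss_pt av" "xi \<in> berk av"
      using mact_inv(1)[OF ok(2)] mact_in_berk[OF ok(2)] that by auto
  qed
  have sub: "direction (mmul s m) \<subseteq> berk av - {xi}" if "unimod m" for m
    using xi[OF that] direction_iff[OF ok(2)[OF that]] gauss_notin_open_disk by auto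
  fix W assume "W \<in> {direction (mmul s m) | m. unimod m}"
  then obtain m where m: "W = direction (mmul s m)" "unimod m"
    by blast
  show "connectedin (subtopology (berk_top av) (berk av - {mact s (gauss_pt av)})) W \<and>
     openin (subtopology (berk_top av) (berk av - {mact s (gauss_pt av)})) W \<and> W \<noteq> {}"
  proof (intro conjI)
    show "connectedin (subtopology (berk_top av) (berk av - {mact s (gauss_pt av)})) W"
      using m sub[OF m(2)] connectedin_direction[OF ok(2)] by (simp add: connectedin_subtopology xi_def)
    show "openin (subtopology (berk_top av) (berk av - {mact s (gauss_pt av)})) W"
      unfolding openin_subtopology
      using m sub[OF m(2)] openin_direction[OF ok(2)] by (intro exI[of _ W]) (auto simp: xi_def)
    show "W \<noteq> {}"
      using m type1_0_in_open_disk by (auto simp: direction_def)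
  qed
next
  fix W W' assume "W \<in> {direction (mmul s m) | m. unimod m}" "W' \<in> {direction (mmul s m) | m. unimod m}"
    "W \<inter> W' \<noteq> {}"
  then show "W = W'"
    using direction_meet_eq[OF s] by blast
next
  define xi where "xi = mact s (gauss_pt av)"
  have ok: "mob_ok m" "mob_ok (mmul s m)" if "unimod m" for m
    using that s mob_ok_mmul unimod_mob_ok by auto
  have 1: "direction (mmul s m) \<subseteq> berk av - {xi}" if "unimod m" for m
  proof -
    have "xi = mact (mmul s m) (gauss_pt av)"
      using that mact_mmul[OF s ok(1)] by (simp add: xi_def mact_gauss)
    then have "mact (mob_inv (mmul s m)) xi = gauss_pt av"
      using mact_inv(1)[OF ok(2)] that by auto
    then show ?thesis
      using direction_iff[OF ok(2)[OF that]] gauss_notin_open_disk by auto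
  qed
  have 2: "\<exists>m. unimod m \<and> z \<in> direction (mmul s m)" if z: "z \<in> berk av" "z \<noteq> xi" for z
  proof -
    define y where "y = mact (mob_inv s) z"
    have y: "y \<in> berk av" "mact s y = z"
      unfolding y_def using mact_in_berk[OF mob_ok_inv[OF s]] mact_inv(2)[OF s] z by auto
    then have "y \<noteq> gauss_pt av"
      using z by (auto simp: xi_def)
    then obtain m where m: "unimod m" "y \<in> direction m"
      using direction_cover[OF y(1)] by (auto simp: direction_def)
    then have "z \<in> direction (mmul s m)"
      using direction_mmul[OF s ok(1)[OF m(1)]] y(2) by auto
    then show ?thesis
      using m(1) by blast
  qed
  have tX: "topspace (subtopology (berk_top av) (berk av - {mact s (gauss_pt av)})) = berk av - {xi}"
    by (auto simp: topspace_subtopology xi_def)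
  show "\<Union>{direction (mmul s m) | m. unimod m}
      = topspace (subtopology (berk_top av) (berk av - {mact s (gauss_pt av)}))"
    unfolding tX
  proof (intro equalityI subsetI)
    fix z assume "z \<in> \<Union>{direction (mmul s m) | m. unimod m}"
    then obtain m where "unimod m" "z \<in> direction (mmul s m)"
      by blast
    then show "z \<in> berk av - {xi}"
      using subsetD[OF 1] by simp
  next
    fix z assume "z \<in> berk av - {xi}"
    then obtain m where "unimod m" "z \<in> direction (mmul s m)"
      using 2[of z] by blast
    then show "z \<in> \<Union>{direction (mmul s m) | m. unimod m}"
      by (intro UnionI[of "direction (mmul s m)"] CollectI exI[of _ m] conjI refl)
  qed
qed

text \<open>The disk points of radius r < 1 lie in the open disk and tend to the Gauss point as r
  tends to 1. So each direction has points arbitrarily near its base point, which makes the germ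
  condition in \<open>tmap\<close> determine its value.\<close>

lemma direction_accumulates:
  assumes s: "mob_ok s" and v: "v \<in> dirs av (mact s (gauss_pt av))"
    and U: "openin (berk_top av) U" "mact s (gauss_pt av) \<in> U"
  shows "U \<inter> v \<noteq> {}"
proof -
  obtain m where m: "unimod m" "v = direction (mmul s m)"
    using v unfolding dirs_eq[OF s] by blast
  define n where "n = mmul s m"
  have n: "mob_ok n" and ng: "mact n (gauss_pt av) = mact s (gauss_pt av)"
    using s m mob_ok_mmul unimod_mob_ok mact_mmul by (auto simp: n_def mact_gauss)
  define origin where "origin = (\<lambda>f. av (poly f 0))"
  have origin: "mseminorm av origin" "origin [:0, 1:] = 0"
    unfolding origin_def using mseminorm_type1 by auto
  have "continuous_map (top_of_set {0..}) (berk_top av) (mact n \<circ> (\<lambda>r. Fin (thicken origin r)))"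
    using continuous_thicken[OF origin(1)] continuous_mact[OF n] by (rule continuous_map_compose)
  then have "openin (top_of_set {0..}) {r \<in> {0..}. mact n (Fin (thicken origin r)) \<in> U}"
    using openin_continuous_map_preimage[OF _ U(1)] by fastforce
  moreover have "Fin (thicken origin 1) = gauss_pt av"
    using Fin_thicken_eq_disk[OF origin(1), of 1] origin(2) by (simp add: gauss_pt_def)
  then have "1 \<in> {r \<in> {0..}. mact n (Fin (thicken origin r)) \<in> U}"
    using ng U(2) by simp
  ultimately obtain e where e: "0 < e"
    "\<And>r. 0 \<le> r \<Longrightarrow> dist r 1 < e \<Longrightarrow> mact n (Fin (thicken origin r)) \<in> U"
    unfolding openin_euclidean_subtopology_iff by (metis (no_types, lifting) mem_Collect_eq atLeast_iff)
  \<comment> \<open>The cut-off at 0 keeps the radius nonnegative when e exceeds 2.\<close>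
  define r where "r = max 0 (1 - e / 2)"
  have r: "0 \<le> r" "r < 1" "dist r 1 < e"
    using e(1) by (auto simp: r_def dist_real_def)
  have "Fin (thicken origin r) \<in> open_disk"
    using r origin by (simp add: Fin_in_open_disk mseminorm_thicken thicken_linear)
  then have "mact n (Fin (thicken origin r)) \<in> U \<inter> v"
    using e(2)[OF r(1,3)] by (simp add: m(2) direction_def n_def)
  then show ?thesis
    by blast
qed

text \<open>Existence takes the whole line as neighbourhood; for uniqueness, a point of v inside a
  competing neighbourhood has its image in both candidate directions.\<close>

lemma tmap_eq:
  assumes s: "mob_ok s" and xi: "xi = mact s (gauss_pt av)" and fixed: "bact av phi xi = xi"
    and v: "v \<in> dirs av xi" and w: "w \<in> dirs av xi" and sub: "bact av phi ` v \<subseteq> w"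
  shows "tmap av phi xi v = w"
  unfolding tmap_def fixed
proof (rule the_equality)
  have "xi \<in> berk av"
    using mact_in_berk[OF s] xi by simp
  moreover have "openin (berk_top av) (berk av)"
    using openin_topspace[of "berk_top av"] by simp
  ultimately show "w \<in> dirs av xi \<and> (\<exists>U. openin (berk_top av) U \<and> xi \<in> U \<and> bact av phi ` (U \<inter> v) \<subseteq> w)"
    using w sub by blast
next
  fix w' assume w': "w' \<in> dirs av xi \<and> (\<exists>U. openin (berk_top av) U \<and> xi \<in> U \<and> bact av phi ` (U \<inter> v) \<subseteq> w')"
  then obtain U where U: "openin (berk_top av) U" "xi \<in> U" "bact av phi ` (U \<inter> v) \<subseteq> w'"
    by blast
  then obtain x where "x \<in> U \<inter> v"
    using direction_accumulates[OF s] v xi by blast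
  then have "bact av phi x \<in> w' \<inter> w"
    using U sub by blast
  then show "w' = w"
    using connected_components_of_overlap[of w' _ w] w w' unfolding dirs_def by auto
qed

end

section \<open>Integral polynomials and reduction\<close>

context alg_closed_nonarch
begin

sublocale g: mult_seminorm "gnorm av 1"
  by (rule av.mult_seminorm_gnorm) simp

lemma intp_iff: "intp av p \<longleftrightarrow> gnorm av 1 p \<le> 1"
proof
  show "intp av p \<Longrightarrow> gnorm av 1 p \<le> 1"
    by (rule av.gnorm_le) (simp add: intp_def)
  show "gnorm av 1 p \<le> 1 \<Longrightarrow> intp av p"
    unfolding intp_def using av.gnorm_ge[of 1 p] by (auto intro: order_trans)
qed

lemma gnorm_lt_iff: "gnorm av 1 p < 1 \<longleftrightarrow> (\<forall>i. av (coeff p i) < 1)"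
proof
  show "gnorm av 1 p < 1 \<Longrightarrow> \<forall>i. av (coeff p i) < 1"
    using av.gnorm_ge[of 1 p] by (auto intro: order.strict_trans1)
  show "\<forall>i. av (coeff p i) < 1 \<Longrightarrow> gnorm av 1 p < 1"
    by (rule av.gnorm_lt) simp
qed

text \<open>Congruence modulo the maximal ideal becomes a strict inequality of Gauss norms, so
  residual arguments become ultrametric estimates.\<close>

lemma congm_iff: "congm av p q \<longleftrightarrow> gnorm av 1 (p - q) < 1"
  by (simp add: congm_def gnorm_lt_iff)

lemma gnorm_eq_1_iff: "gnorm av 1 p = 1 \<longleftrightarrow> intp av p \<and> (\<exists>i. av (coeff p i) = 1)"
  using gnorm_lt_iff[of p] intp_iff[of p] unfolding intp_def
  by (metis antisym_conv2 order_le_less)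

lemma gnorm_smult: "gnorm av 1 (smult c p) = av c * gnorm av 1 p"
  using mseminorm_smult[OF mseminorm_gauss] .

lemma coeff_le_gnorm: "av (coeff p i) \<le> gnorm av 1 p"
  using av.gnorm_ge[of 1 p i] by simp

lemma poly_le_gnorm:
  assumes "mseminorm av s" "s [:0, 1:] \<le> 1"
  shows "s p \<le> gnorm av 1 p"
proof -
  interpret s: mult_seminorm s
    using assms mseminorm_iff by blast
  have "s p = s (\<Sum>i\<le>degree p. monom (coeff p i) i)"
    by (simp add: poly_as_sum_of_monoms)
  also have "\<dots> \<le> gnorm av 1 p"
  proof (rule s.sum_le)
    fix i
    have "s (monom (coeff p i) i) \<le> av (coeff p i) * 1"
      unfolding mseminorm_monom[OF assms(1)] using assms(2)
      by (intro mult_left_mono power_le_one) auto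
    then show "s (monom (coeff p i) i) \<le> gnorm av 1 p"
      using coeff_le_gnorm[of p i] by simp
  qed auto
  finally show ?thesis .
qed

lemma eval_le_gnorm: "av a \<le> 1 \<Longrightarrow> av (poly p a) \<le> gnorm av 1 p"
  using poly_le_gnorm[OF mseminorm_type1[of a], of p] by simp

lemma hval_le_gnorm:
  assumes "av x \<le> 1" "av y \<le> 1"
  shows "av (hval n p x y) \<le> gnorm av 1 p"
  unfolding hval_def
proof (rule av.sum_le)
  fix i
  have "av (coeff p i * x ^ i * y ^ (n - i)) = av (coeff p i) * (av x ^ i * av y ^ (n - i))"
    by (simp add: av.mult av.power)
  also have "\<dots> \<le> av (coeff p i) * 1"
    using assms by (intro mult_left_mono mult_le_one power_le_one zero_le_power) auto
  finally show "av (coeff p i * x ^ i * y ^ (n - i)) \<le> gnorm av 1 p"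
    using coeff_le_gnorm[of p i] by simp
qed auto

lemma gnorm_hom_le:
  assumes "gnorm av 1 U \<le> 1" "gnorm av 1 V \<le> 1"
  shows "gnorm av 1 (hom n p U V) \<le> gnorm av 1 p"
  unfolding hom_def
proof (rule g.sum_le)
  fix i
  have "gnorm av 1 (smult (coeff p i) (U ^ i * V ^ (n - i)))
      = av (coeff p i) * (gnorm av 1 U ^ i * gnorm av 1 V ^ (n - i))"
    by (simp add: gnorm_smult g.mult g.power)
  also have "\<dots> \<le> av (coeff p i) * 1"
    using assms by (intro mult_left_mono mult_le_one power_le_one zero_le_power) auto
  finally show "gnorm av 1 (smult (coeff p i) (U ^ i * V ^ (n - i))) \<le> gnorm av 1 p"
    using coeff_le_gnorm[of p i] by simp
qed auto

text \<open>An integral translation fixes the Gauss point: |a - b| and |b| can differ only when both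
  are at most 1.\<close>

lemma gnorm_shift:
  assumes "av a \<le> 1"
  shows "gnorm av 1 (pcompose p [:a, 1:]) = gnorm av 1 p"
proof -
  have "(\<lambda>f. gnorm av 1 (pcompose f [:a, 1:])) = gnorm av 1"
  proof (rule mseminorm_eqI[OF mseminorm_disk mseminorm_gauss])
    fix b
    have "av (a - b) \<le> max (av b) 1" "av (a - (a - b)) \<le> max (av (a - b)) 1"
      using assms by (rule_tac [!] av.diff_le) (simp_all add: le_max_iff_disj)
    then have "max (av (a - b)) 1 = max (av b) 1"
      by (auto simp: max_def split: if_splits)
    then show "gnorm av 1 (pcompose [:-b, 1:] [:a, 1:]) = gnorm av 1 [:-b, 1:]"
      by (simp add: gnorm_disk_linear av.gnorm_linear)
  qed simp
  then show ?thesis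
    by metis
qed

lemma red_degree_props:
  assumes "av (coeff p i) = 1"
  shows "av (coeff p (red_degree av p)) = 1" "i \<le> red_degree av p" "red_degree av p \<le> degree p"
proof -
  have b: "\<And>j. av (coeff p j) = 1 \<Longrightarrow> j \<le> degree p"
    by (rule le_degree) auto
  have rd: "red_degree av p = (GREATEST i. av (coeff p i) = 1)"
    using assms unfolding red_degree_def by auto
  show 1: "av (coeff p (red_degree av p)) = 1"
    unfolding rd by (rule GreatestI_nat[where P = "\<lambda>i. av (coeff p i) = 1", OF assms b])
  show "i \<le> red_degree av p"
    unfolding rd by (rule Greatest_le_nat[where P = "\<lambda>i. av (coeff p i) = 1", OF assms b])
  show "red_degree av p \<le> degree p"
    by (rule b[OF 1])
qed

lemma coeff_lt_above_red_degree:
  assumes "gnorm av 1 p = 1" "red_degree av p < i"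
  shows "av (coeff p i) < 1"
  using red_degree_props(2)[of p i] assms coeff_le_gnorm[of p i] by linarith

text \<open>In degree i + j the product of the two residually leading coefficients is a unit, and
  every other term has a factor beyond its residual degree.\<close>

lemma red_degree_mult_ge:
  assumes p: "gnorm av 1 p = 1" and q: "gnorm av 1 q = 1"
  shows "red_degree av p + red_degree av q \<le> red_degree av (p * q)"
proof -
  define i where "i = red_degree av p"
  define j where "j = red_degree av q"
  have i: "av (coeff p i) = 1" and j: "av (coeff q j) = 1"
    using p q red_degree_props(1) unfolding gnorm_eq_1_iff i_def j_def by blast+
  have le: "av (coeff p l) \<le> 1" "av (coeff q l) \<le> 1" for l
    using coeff_le_gnorm[of p l] coeff_le_gnorm[of q l] p q by auto
  have "av (\<Sum>l\<in>{..i + j} - {i}. coeff p l * coeff q (i + j - l)) < 1"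
  proof (rule av.sum_lt)
    fix l assume l: "l \<in> {..i + j} - {i}"
    show "av (coeff p l * coeff q (i + j - l)) < 1"
    proof (cases "i < l")
      case True
      then have "av (coeff p l) < 1"
        using coeff_lt_above_red_degree[OF p] by (simp add: i_def)
      then show ?thesis
        using le(2)[of "i + j - l"] mult_left_le[of "av (coeff q (i + j - l))" "av (coeff p l)"]
        by (simp add: av.mult)
    next
      case False
      then have "av (coeff q (i + j - l)) < 1"
        using l by (intro coeff_lt_above_red_degree[OF q]) (auto simp: j_def)
      then show ?thesis
        using le(1)[of l] mult_left_le[of "av (coeff p l)" "av (coeff q (i + j - l))"]
        by (simp add: av.mult mult.commute)
    qed
  qed auto
  moreover have "coeff (p * q) (i + j)
      = (\<Sum>l\<in>{..i + j} - {i}. coeff p l * coeff q (i + j - l)) + coeff p i * coeff q j"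
    unfolding coeff_mult by (subst sum.remove[of _ i]) auto
  ultimately have "av (coeff (p * q) (i + j)) = 1"
    using av.add_eq_dominant[of _ "coeff p i * coeff q j"] i j by (simp add: av.mult)
  then show ?thesis
    using red_degree_props(2) by (simp add: i_def j_def)
qed

lemma congm_coeff:
  assumes "gnorm av 1 (p - q) < 1"
  shows "av (coeff p i) = 1 \<longleftrightarrow> av (coeff q i) = 1"
proof -
  have "av (coeff p i - coeff q i) < 1"
    using assms coeff_le_gnorm[of "p - q" i] by simp
  then show ?thesis
    using av.eq_if_close[of "coeff p i" "coeff q i"] av.eq_if_close[of "coeff q i" "coeff p i"]
      av.minus_commute[of "coeff p i" "coeff q i"] by auto
qed

lemma congm_red_degree: "gnorm av 1 (p - q) < 1 \<Longrightarrow> red_degree av p = red_degree av q"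
  unfolding red_degree_def by (simp add: congm_coeff)

lemma congm_gnorm: "gnorm av 1 (p - q) < 1 \<Longrightarrow> gnorm av 1 p = 1 \<longleftrightarrow> gnorm av 1 q = 1"
  using g.eq_if_close[of p q] g.eq_if_close[of q p] g.minus_commute[of p q] by auto

lemma gnorm_mult_le1: "gnorm av 1 p \<le> 1 \<Longrightarrow> gnorm av 1 q \<le> 1 \<Longrightarrow> gnorm av 1 (p * q) \<le> 1"
  by (simp add: g.mult mult_le_one)

lemma gnorm_mult_lt1: "gnorm av 1 p \<le> 1 \<Longrightarrow> gnorm av 1 q < 1 \<Longrightarrow> gnorm av 1 (p * q) < 1"
  using mult_right_mono[of "gnorm av 1 p" 1 "gnorm av 1 q"] by (simp add: g.mult)

text \<open>Two Gauss norms at most 1 with product 1 are both 1; then residual degrees add up inside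
  the degree of F.\<close>

lemma red_factor_unit:
  assumes A: "gnorm av 1 A \<le> 1" and G: "gnorm av 1 G \<le> 1"
    and F: "gnorm av 1 F = 1" "gnorm av 1 (F - G * A) < 1"
  shows "gnorm av 1 G = 1" "gnorm av 1 A = 1" "red_degree av G + red_degree av A \<le> degree F"
proof -
  have "gnorm av 1 (G * A) = 1"
    using congm_gnorm[OF F(2)] F(1) by simp
  then have GA: "gnorm av 1 G * gnorm av 1 A = 1"
    by (simp add: g.mult)
  show G1: "gnorm av 1 G = 1"
    using GA G A mult_left_le[of "gnorm av 1 A" "gnorm av 1 G"] by simp
  then show A1: "gnorm av 1 A = 1"
    using GA by simp
  have "red_degree av G + red_degree av A \<le> red_degree av (G * A)"
    by (rule red_degree_mult_ge[OF G1 A1])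
  also have "\<dots> = red_degree av F"
    using congm_red_degree[OF F(2)] by simp
  also have "\<dots> \<le> degree F"
    using F(1) red_degree_props(3) unfolding gnorm_eq_1_iff by blast
  finally show "red_degree av G + red_degree av A \<le> degree F" .
qed

text \<open>Take a common factor G of largest residual degree. A nonconstant residual common factor
  D of the cofactors could be absorbed into G, giving a factor of larger residual degree.\<close>

lemma red_fact_exists:
  assumes F: "gnorm av 1 F \<le> 1" and H: "gnorm av 1 H \<le> 1"
    and one: "gnorm av 1 F = 1 \<or> gnorm av 1 H = 1"
  shows "\<exists>A B. intp av A \<and> intp av B \<and> red_coprime av A B \<and>
      (\<exists>G. intp av G \<and> congm av F (G * A) \<and> congm av H (G * B))"
proof -
  define fac where "fac G A B \<longleftrightarrow> gnorm av 1 G \<le> 1 \<and> gnorm av 1 A \<le> 1 \<and> gnorm av 1 B \<le> 1 \<and>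
    gnorm av 1 (F - G * A) < 1 \<and> gnorm av 1 (H - G * B) < 1" for G A B
  define K where "K k \<longleftrightarrow> (\<exists>G A B. fac G A B \<and> red_degree av G = k)" for k
  have G1: "gnorm av 1 G = 1 \<and> red_degree av G \<le> max (degree F) (degree H)" if "fac G A B" for G A B
    using one
  proof
    assume "gnorm av 1 F = 1"
    then show ?thesis
      using red_factor_unit[of A G F] that unfolding fac_def by auto
  next
    assume "gnorm av 1 H = 1"
    then show ?thesis
      using red_factor_unit[of B G H] that unfolding fac_def by auto
  qed
  have bound: "\<And>k. K k \<Longrightarrow> k \<le> max (degree F) (degree H)"
    using G1 unfolding K_def by blast
  have "fac 1 F H"
    using F H by (simp add: fac_def)
  then have "K (red_degree av 1)"
    unfolding K_def by blast
  then have KG: "K (GREATEST k. K k)" and Kle: "\<And>k. K k \<Longrightarrow> k \<le> (GREATEST k. K k)"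
    using GreatestI_nat[of K, OF _ bound] Greatest_le_nat[of K, OF _ bound] by blast+
  obtain G A B where fac: "fac G A B" and G: "red_degree av G = (GREATEST k. K k)"
    using KG unfolding K_def by blast
  have "red_coprime av A B"
    unfolding red_coprime_def
  proof
    assume "\<exists>D S T. intp av D \<and> intp av S \<and> intp av T \<and> red_nonconst av D \<and>
      congm av A (D * S) \<and> congm av B (D * T)"
    then obtain D S T where D: "gnorm av 1 D \<le> 1" "gnorm av 1 S \<le> 1" "gnorm av 1 T \<le> 1"
      and nc: "red_nonconst av D" and c: "gnorm av 1 (A - D * S) < 1" "gnorm av 1 (B - D * T) < 1"
      unfolding intp_iff congm_iff by blast
    have cong: "gnorm av 1 (X - G * D * Y) < 1"
      if "gnorm av 1 (X - G * Z) < 1" "gnorm av 1 (Z - D * Y) < 1" for X Y Z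
    proof -
      have "X - G * D * Y = (X - G * Z) + G * (Z - D * Y)"
        by (simp add: algebra_simps)
      then show ?thesis
        using that fac g.add_lt gnorm_mult_lt1 unfolding fac_def by metis
    qed
    have "fac (G * D) S T"
      using fac D cong[OF _ c(1)] cong[OF _ c(2)] gnorm_mult_le1 unfolding fac_def by blast
    then have "red_degree av (G * D) \<le> red_degree av G"
      using Kle G unfolding K_def by metis
    moreover obtain i where i: "1 \<le> i" "av (coeff D i) = 1"
      using nc unfolding red_nonconst_def by blast
    then have "gnorm av 1 D = 1"
      using D(1) unfolding gnorm_eq_1_iff intp_iff by blast
    then have "red_degree av G + red_degree av D \<le> red_degree av (G * D)"
      using red_degree_mult_ge G1[OF fac] by blast
    moreover have "1 \<le> red_degree av D"
      using red_degree_props(2)[OF i(2)] i(1) by simp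
    ultimately show False
      by simp
  qed
  then show ?thesis
    using fac unfolding fac_def intp_iff congm_iff by blast
qed

lemma normalized_gnorm:
  assumes "normalized av (F, H)"
  shows "gnorm av 1 F \<le> 1" "gnorm av 1 H \<le> 1" "gnorm av 1 F = 1 \<or> gnorm av 1 H = 1"
  using assms unfolding normalized_def intp_iff gnorm_eq_1_iff by auto

lemma red_fact_spec:
  assumes "normalized av (F, H)" "red_fact av (F, H) = (A, B)"
  obtains G where "gnorm av 1 A \<le> 1" "gnorm av 1 B \<le> 1" "red_coprime av A B"
    "gnorm av 1 G \<le> 1" "gnorm av 1 (F - G * A) < 1" "gnorm av 1 (H - G * B) < 1"
proof -
  define R where "R = (\<lambda>(A, B). intp av A \<and> intp av B \<and> red_coprime av A B \<and>
      (\<exists>G. intp av G \<and> congm av F (G * A) \<and> congm av H (G * B)))"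
  have "\<exists>x. R x"
    using red_fact_exists[OF normalized_gnorm[OF assms(1)]] by (auto simp: R_def)
  then have "R (SOME x. R x)"
    by (rule someI_ex)
  moreover have "(SOME x. R x) = (A, B)"
    using assms(2) by (simp add: red_fact_def R_def)
  ultimately show ?thesis
    using that by (auto simp: R_def intp_iff congm_iff)
qed

section \<open>Pairs with good reduction\<close>

text \<open>Good reduction, phrased as: the two forms have no common zero over the residue field.
  Testing primitive pairs (x, y) treats infinity like any other point and is visibly preserved by
  unimodular changes at source and target.\<close>

definition good_pair :: "nat \<Rightarrow> 'a poly \<Rightarrow> 'a poly \<Rightarrow> bool" where
  "good_pair d F G \<longleftrightarrow> degree F \<le> d \<and> degree G \<le> d \<and> gnorm av 1 F \<le> 1 \<and> gnorm av 1 G \<le> 1 \<and>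
     (\<forall>x y. max (av x) (av y) = 1 \<longrightarrow> max (av (hval d F x y)) (av (hval d G x y)) = 1)"

text \<open>By Horner's scheme the coefficients of the quotient are values at a of tails of p, which
  are integral.\<close>

lemma gnorm_synthetic_div:
  assumes "av a \<le> 1" "gnorm av 1 p \<le> 1"
  shows "gnorm av 1 (synthetic_div p a) \<le> 1"
  using assms(2)
proof (induction p)
  case 0
  then show ?case
    by simp
next
  case (pCons c p)
  have p: "gnorm av 1 p \<le> 1"
    using pCons.prems unfolding intp_iff[symmetric] intp_def by (metis coeff_pCons_Suc)
  then have "av (poly p a) \<le> 1"
    using eval_le_gnorm[OF assms(1), of p] by simp
  then show ?case
    using pCons.IH[OF p] unfolding intp_iff[symmetric] intp_def
    by (auto simp: coeff_pCons split: nat.split)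
qed

text \<open>If both values were below 1, T - a would be a common residual factor, with the quotients
  by T - a as cofactors.\<close>

lemma red_coprime_no_common_root:
  assumes AB: "gnorm av 1 A \<le> 1" "gnorm av 1 B \<le> 1" "red_coprime av A B" and a: "av a \<le> 1"
  shows "1 \<le> av (poly A a) \<or> 1 \<le> av (poly B a)"
proof (rule ccontr)
  assume "\<not> ?thesis"
  then have lt: "av (poly A a) < 1" "av (poly B a) < 1"
    by auto
  have c: "p - [:-a, 1:] * synthetic_div p a = [:poly p a:]" for p
    using synthetic_div_correct'[of a p] by (metis add_diff_cancel_left')
  have "red_nonconst av [:-a, 1:]"
    unfolding red_nonconst_def by (intro exI[of _ 1]) simp
  moreover have "gnorm av 1 [:-a, 1:] \<le> 1"
    using a by (simp add: av.gnorm_linear)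
  ultimately show False
    using AB lt gnorm_synthetic_div[OF a] unfolding red_coprime_def intp_iff congm_iff
    by (metis c av.gnorm_const)
qed

text \<open>Since A or B already has residual degree d, the common factor has residual degree 0 and
  reduces to a constant c. Coprimality excludes finite residual common zeros, and a unit coefficient
  in degree d excludes one at infinity.\<close>

lemma red_fact_good_pair:
  assumes norm: "normalized av (F, H)" and fact: "red_fact av (F, H) = (A, B)"
    and deg: "degree F \<le> d" "degree H \<le> d" "max (red_degree av A) (red_degree av B) = d" "1 \<le> d"
  obtains c where "good_pair d F H" "av c = 1" "gnorm av 1 A \<le> 1" "gnorm av 1 B \<le> 1"
    "gnorm av 1 (F - smult c A) < 1" "gnorm av 1 (H - smult c B) < 1"
proof -
  obtain G where A: "gnorm av 1 A \<le> 1" and B: "gnorm av 1 B \<le> 1" and cop: "red_coprime av A B"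
    and G: "gnorm av 1 G \<le> 1" and FG: "gnorm av 1 (F - G * A) < 1" "gnorm av 1 (H - G * B) < 1"
    using red_fact_spec[OF norm fact] by blast
  note FH = normalized_gnorm[OF norm]
  have G1: "gnorm av 1 G = 1"
    using FH(3) red_factor_unit(1)[OF A G _ FG(1)] red_factor_unit(1)[OF B G _ FG(2)] by blast
  have top: "red_degree av G = 0 \<and> av (coeff X d) = 1"
    if X: "gnorm av 1 X \<le> 1" "red_degree av X = d" "degree Y \<le> d" "gnorm av 1 (Y - G * X) < 1" for X Y
  proof -
    have "\<exists>i. av (coeff X i) = 1"
      using X(2) deg(4) unfolding red_degree_def by (auto split: if_splits)
    then obtain i where i: "av (coeff X i) = 1" ..
    then have "gnorm av 1 X = 1"
      using X(1) gnorm_eq_1_iff intp_iff by blast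
    then have "gnorm av 1 Y = 1"
      using congm_gnorm[OF X(4)] G1 by (simp add: g.mult)
    then show ?thesis
      using red_factor_unit(3)[OF X(1) G _ X(4)] X(2,3) red_degree_props(1)[OF i] by simp
  qed
  have rG: "red_degree av G = 0" and AB: "av (coeff A d) = 1 \<or> av (coeff B d) = 1"
    using top[OF A _ deg(1) FG(1)] top[OF B _ deg(2) FG(2)] deg(3) by (auto simp: max_def split: if_splits)
  define c where "c = coeff G 0"
  have c: "av c = 1"
    using G1 red_degree_props(1)[of G] rG unfolding gnorm_eq_1_iff c_def by auto
  have "gnorm av 1 (G - [:c:]) < 1"
    unfolding gnorm_lt_iff
  proof
    fix i
    show "av (coeff (G - [:c:]) i) < 1"
      using coeff_lt_above_red_degree[OF G1, of i] rG by (cases i) (auto simp: c_def)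
  qed
  then have cong: "gnorm av 1 (Y - smult c X) < 1"
    if "gnorm av 1 X \<le> 1" "gnorm av 1 (Y - G * X) < 1" for X Y
  proof -
    have "Y - smult c X = (Y - G * X) + X * (G - [:c:])"
      by (simp add: algebra_simps)
    then show ?thesis
      using that g.add_lt gnorm_mult_lt1[OF that(1) \<open>gnorm av 1 (G - [:c:]) < 1\<close>] by metis
  qed
  have cF: "gnorm av 1 (F - smult c A) < 1" and cH: "gnorm av 1 (H - smult c B) < 1"
    using cong[OF A FG(1)] cong[OF B FG(2)] .
  have "good_pair d F H"
    unfolding good_pair_def
  proof (intro conjI allI impI)
    fix x y assume xy: "max (av x) (av y) = 1"
    then have le: "av x \<le> 1" "av y \<le> 1"
      by (metis max.cobounded1, metis max.cobounded2)
    have ub: "av (hval d F x y) \<le> 1" "av (hval d H x y) \<le> 1"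
      using hval_le_gnorm[OF le] FH(1,2) by (meson order_trans)+
    have "1 \<le> av (hval d F x y) \<or> 1 \<le> av (hval d H x y)"
    \<comment> \<open>If y is a unit, dehomogenise at x / y. Otherwise x is a unit, the point
      reduces to infinity, and only the term x ^ d can be a unit.\<close>
    proof (cases "av y = 1")
      case True
      then have y: "y \<noteq> 0"
        by auto
      define a where "a = x / y"
      have a: "av a \<le> 1"
        using True le y by (simp add: a_def av_divide)
      have h: "av (hval d Y x y) = av (poly Y a)" if "degree Y \<le> d" for Y
        using that y True by (simp add: hval_eq av.mult av.power a_def)
      have p: "1 \<le> av (poly Y a)" if "1 \<le> av (poly X a)" "gnorm av 1 (Y - smult c X) < 1" for X Y
      proof (rule ccontr)
        assume "\<not> 1 \<le> av (poly Y a)"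
        moreover have "av (poly Y a - c * poly X a) < 1"
          using eval_le_gnorm[OF a, of "Y - smult c X"] that(2) by simp
        ultimately have "av (c * poly X a) < 1"
          using av.diff_lt[of "poly Y a" 1 "poly Y a - c * poly X a"] by simp
        then show False
          using that(1) c by (simp add: av.mult)
      qed
      show ?thesis
        using red_coprime_no_common_root[OF A B cop a] p cF cH h deg by metis
    next
      case False
      then have y: "av y < 1" and x: "av x = 1"
        using xy le by (auto simp: max_def split: if_splits)
      have t: "1 \<le> av (hval d Y x y)"
        if "gnorm av 1 Y \<le> 1" "av (coeff X d) = 1" "gnorm av 1 (Y - smult c X) < 1" for X Y
      proof -
        have "av (coeff Y d) = 1"
          using congm_coeff[OF that(3), of d] that(2) c by (simp add: av.mult)
        then have lead: "av (coeff Y d * x ^ d) = 1"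
          using x by (simp add: av.mult av.power)
        have "hval d Y x y = (\<Sum>i<d. coeff Y i * x ^ i * y ^ (d - i)) + coeff Y d * x ^ d"
          unfolding hval_def by (simp add: lessThan_Suc_atMost[symmetric])
        moreover have "av (\<Sum>i<d. coeff Y i * x ^ i * y ^ (d - i)) < 1"
        proof (rule av.sum_lt)
          fix i assume "i \<in> {..<d}"
          then obtain j where j: "d - i = Suc j"
            by (cases "d - i") auto
          have "av y ^ (d - i) < 1"
            unfolding j using mult_left_le[of "av y ^ j" "av y"] power_le_one[of "av y" j] y by simp
          moreover have "av (coeff Y i) \<le> 1"
            using coeff_le_gnorm[of Y i] that(1) by simp
          ultimately show "av (coeff Y i * x ^ i * y ^ (d - i)) < 1"
            using x mult_left_le_one_le[of "av y ^ (d - i)" "av (coeff Y i)"]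
            by (simp add: av.mult av.power)
        qed auto
        ultimately have "av (hval d Y x y) = 1"
          using av.add_eq_dominant[of _ "coeff Y d * x ^ d"] lead by simp
        then show ?thesis
          by simp
      qed
      show ?thesis
        using AB t[OF FH(1) _ cF] t[OF FH(2) _ cH] by blast
    qed
    then show "max (av (hval d F x y)) (av (hval d H x y)) = 1"
      using ub by (auto simp: max_def)
  qed (use deg FH in auto)
  then show ?thesis
    using that c A B cF cH by blast
qed

lemma hval_add: "hval n (F + G) x y = hval n F x y + hval n G x y"
  by (simp add: hval_def algebra_simps sum.distrib)

lemma hval_smult: "hval n (smult c F) x y = c * hval n F x y"
  by (simp add: hval_def sum_distrib_left algebra_simps)

lemma good_pair_left:
  assumes m: "unimod (a, b, c, e)" and FG: "good_pair d F G"
  shows "good_pair d (smult a F + smult b G) (smult c F + smult e G)"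
proof -
  have i: "av a \<le> 1" "av b \<le> 1" "av c \<le> 1" "av e \<le> 1"
    using m by (auto simp: unimod_def)
  have lin: "degree (smult p F + smult q G) \<le> d \<and> gnorm av 1 (smult p F + smult q G) \<le> 1"
    if "av p \<le> 1" "av q \<le> 1" for p q
    using FG that unfolding good_pair_def
    by (auto intro!: degree_add_le g.add_le order_trans[OF degree_smult_le] simp: gnorm_smult mult_le_one)
  show ?thesis
    unfolding good_pair_def
    using FG lin i unimod_max[OF m] by (auto simp: good_pair_def hval_add hval_smult)
qed

lemma good_pair_right:
  assumes m: "unimod (a, b, c, e)" and FG: "good_pair d F G"
  shows "good_pair d (hom d F [:b, a:] [:e, c:]) (hom d G [:b, a:] [:e, c:])"
proof -
  have i: "gnorm av 1 [:b, a:] \<le> 1" "gnorm av 1 [:e, c:] \<le> 1"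
    using m by (auto simp: unimod_def av.gnorm_linear)
  have "degree (hom d X [:b, a:] [:e, c:]) \<le> d" for X
    using degree_hom_le[of "[:b, a:]" 1 "[:e, c:]" d X] by simp
  then show ?thesis
    using FG unimod_max[OF m] order_trans[OF gnorm_hom_le[OF i]] unfolding good_pair_def hval_hom
    by simp
qed

section \<open>Fixed points in a residue disk\<close>

lemma mseminorm_const_approx:
  assumes s: "mseminorm av s" and T: "s [:0, 1:] \<le> 1" and F: "gnorm av 1 F \<le> 1"
  shows "s (F - [:coeff F 0:]) \<le> s [:0, 1:]"
proof -
  interpret s: mult_seminorm s
    using s mseminorm_iff by blast
  obtain a K where FK: "F = pCons a K"
    by (cases F)
  have "gnorm av 1 K \<le> 1"
    using F unfolding intp_iff[symmetric] intp_def FK by (metis coeff_pCons_Suc)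
  then have K: "s K \<le> 1"
    using poly_le_gnorm[OF s T, of K] by simp
  have "F - [:coeff F 0:] = [:0, 1:] * K"
    by (simp add: FK)
  then have "s (F - [:coeff F 0:]) = s [:0, 1:] * s K"
    by (simp only: s.mult)
  then show ?thesis
    using mult_left_mono[OF K s.nonneg[of "[:0, 1:]"]] by simp
qed

text \<open>The Newton polygon argument by linear factors: if all roots have absolute value at least
  1, the constant coefficient dominates all the others.\<close>

lemma root_in_disk:
  assumes "av (coeff H 0) < av (coeff H 1)"
  shows "\<exists>a. poly H a = 0 \<and> av a < 1"
proof (rule ccontr)
  assume no: "\<not> ?thesis"
  have "(\<forall>a. poly p a = 0 \<longrightarrow> 1 \<le> av a) \<longrightarrow> (\<forall>i. av (coeff p i) \<le> av (coeff p 0))" for p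
  proof (induction p rule: poly_linear_induct)
    case (const c)
    then show ?case
      by (simp add: coeff_pCons split: nat.split)
  next
    case (linear a q)
    show ?case
    proof (intro impI allI)
      fix i assume r: "\<forall>b. poly ([:-a, 1:] * q) b = 0 \<longrightarrow> 1 \<le> av b"
      then have a: "1 \<le> av a" and q: "\<And>i. av (coeff q i) \<le> av (coeff q 0)"
        using linear.IH by auto
      have "av (coeff q j) \<le> av a * av (coeff q 0)" for j
        using q[of j] a mult_right_mono[OF a, of "av (coeff q 0)"] by simp
      then have "av (coeff ([:-a, 1:] * q) i) \<le> av a * av (coeff q 0)"
        using mult_left_mono[OF q, of "av a"]
        by (cases i) (auto simp: av.mult intro!: av.diff_le)
      then show "av (coeff ([:-a, 1:] * q) i) \<le> av (coeff ([:-a, 1:] * q) 0)"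
        by (simp add: av.mult)
    qed
  qed
  then have "av (coeff H 1) \<le> av (coeff H 0)"
    using no by force
  then show False
    using assms by simp
qed

text \<open>With the attracting fixed point \<open>\<alpha>\<close> of \<open>F/G\<close> as centre, \<open>F - \<alpha> G = (T - \<alpha>) K\<close> with
  \<open>|K| < 1\<close> on the disk, so that a fixed seminorm has to vanish on \<open>T - \<alpha>\<close>.\<close>
lemma fixed_in_disk_type1:
  assumes F: "gnorm av 1 F \<le> 1" and G: "gnorm av 1 G \<le> 1"
    and F0: "av (coeff F 0) < 1" and G0: "av (coeff G 0) = 1" and F1: "av (coeff F 1) < 1"
    and fixed: "maps_to d F G (Fin s) (Fin s)" and s: "Fin s \<in> open_disk"
  shows "\<exists>a. Fin s = type1_pt av a"
proof -
  have ms: "mseminorm av s" and T: "s [:0, 1:] < 1"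
    using s by (auto simp: Fin_in_open_disk)
  interpret s: mult_seminorm s
    using ms mseminorm_iff by blast
  \<comment> \<open>The linear coefficient of the fixed point equation F - T G; its constant term
    F_0 is smaller, so there is a root in the open disk.\<close>
  have "av (coeff F 1 - coeff G 0) = 1"
    using av.add_eq_dominant[of "coeff F 1" "- coeff G 0"] F1 G0 by simp
  then obtain \<alpha> where \<alpha>: "poly (F - pCons 0 G) \<alpha> = 0" "av \<alpha> < 1"
    using root_in_disk[of "F - pCons 0 G"] F0 by auto
  define E where "E = F - smult \<alpha> G"
  define K where "K = synthetic_div E \<alpha>"
  have "poly E \<alpha> = 0"
    using \<alpha> by (simp add: E_def)
  then have EK: "E = [:-\<alpha>, 1:] * K"
    using synthetic_div_correct'[of \<alpha> E] by (simp add: K_def)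
  have \<alpha>G: "av (\<alpha> * coeff G i) < 1" for i
    using mult_left_le[of "av (coeff G i)" "av \<alpha>"] coeff_le_gnorm[of G i] G \<alpha>(2) by (simp add: av.mult)
  have "gnorm av 1 E \<le> 1"
    unfolding E_def using F G \<alpha>(2) by (intro g.diff_le) (auto simp: gnorm_smult mult_le_one)
  then have K: "gnorm av 1 K \<le> 1"
    unfolding K_def using \<alpha>(2) by (intro gnorm_synthetic_div) auto
  have "coeff E 1 = coeff K 0 - \<alpha> * coeff K 1"
    unfolding EK by simp
  moreover have "av (\<alpha> * coeff K 1) < 1"
    using mult_left_le[of "av (coeff K 1)" "av \<alpha>"] coeff_le_gnorm[of K 1] K \<alpha>(2) by (simp add: av.mult)
  moreover have "av (coeff E 1) < 1"
    unfolding E_def using F1 \<alpha>G[of 1] by (auto intro!: av.diff_lt)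
  ultimately have K0: "av (coeff K 0) < 1"
    using av.add_lt[of "coeff E 1" 1 "\<alpha> * coeff K 1"] by simp
  have "s (K - [:coeff K 0:]) < 1"
    using mseminorm_const_approx[OF ms _ K] T by simp
  then have sK: "s K < 1"
    using s.add_lt[of "K - [:coeff K 0:]" 1 "[:coeff K 0:]"] K0 ms by (simp add: mseminorm_def)
  have "s (G - [:coeff G 0:]) < s [:coeff G 0:]"
    using mseminorm_const_approx[OF ms _ G] T G0 ms by (simp add: mseminorm_def)
  then have sG: "s G = 1"
    using s.eq_if_close[of G "[:coeff G 0:]"] G0 ms by (simp add: mseminorm_def)
  obtain k where "0 < k" and k: "\<And>p q. s (smult p F + smult q G) = k * s [:q, p:]"
    using maps_to_linear[OF fixed] unfolding hnorm_Fin by blast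
  have "k = 1"
    using k[of 0 1] sG ms by (simp add: mseminorm_def)
  then have "s E = s [:-\<alpha>, 1:]"
    using k[of 1 "- \<alpha>"] by (simp add: E_def)
  then have "s [:-\<alpha>, 1:] * s K = s [:-\<alpha>, 1:]"
    unfolding EK by (simp only: s.mult)
  then have "s [:-\<alpha>, 1:] = 0"
    using sK by auto
  then show ?thesis
    using mseminorm_zero_type1[OF ms] by blast
qed

text \<open>The norm of F - b G at radius r has to equal the larger of |b| and r. If |b| > r, the
  constant term attains |b|; otherwise the linear term attains r because F_1 is a unit. No term
  exceeds the bound, since higher powers of r are at most r.\<close>

lemma disk_fixed:
  assumes F: "gnorm av 1 F \<le> 1" and G: "gnorm av 1 G \<le> 1"
    and F0: "av (coeff F 0) \<le> r" "r < 1" and G0: "av (coeff G 0) = 1" and F1: "av (coeff F 1) = 1"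
    and w: "maps_to d F G (disk_pt av 0 r) w"
  shows "w = disk_pt av 0 r"
proof -
  have r: "0 \<le> r"
    using F0(1) av.nonneg order_trans by blast
  define s where "s = gnorm av r"
  have ms: "mseminorm av s"
    using mseminorm_disk[OF r, of 0] by (simp add: s_def)
  have ds: "disk_pt av 0 r = Fin s"
    by (simp add: disk_pt_eq s_def)
  obtain k where "0 < k" and k: "\<And>p q. s (smult p F + smult q G) = k * hnorm w 1 [:q, p:]"
    using maps_to_linear[OF w] unfolding ds hnorm_Fin by blast
  have Fi: "av (coeff F i) \<le> 1" and Gi: "av (coeff G i) \<le> 1" for i
    using coeff_le_gnorm[of F i] coeff_le_gnorm[of G i] F G by auto
  have rpow: "r ^ Suc i \<le> r" for i
    using r F0(2) mult_left_le[of "r ^ i" r] power_le_one[of r i] by simp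
  have "s G = 1"
  proof (rule antisym)
    show "s G \<le> 1"
      unfolding s_def
    proof (rule av.gnorm_le)
      show "av (coeff G i) * r ^ i \<le> 1" for i
        using Gi[of i] r F0(2) by (intro mult_le_one power_le_one zero_le_power) auto
    qed
    show "1 \<le> s G"
      unfolding s_def using av.gnorm_ge[OF r, of G 0] G0 by simp
  qed
  then have "k * hnorm w 1 [:1:] = 1"
    using k[of 0 1] by simp
  then obtain s' where s': "w = Fin s'" "mseminorm av s'"
    using maps_to_in_berk[OF w] by (cases w) auto
  then have "k = 1"
    using \<open>k * hnorm w 1 [:1:] = 1\<close> by (simp add: mseminorm_def)
  have "s' = s"
  proof (rule mseminorm_eqI[OF s'(2) ms])
    fix b
    define E where "E = F - smult b G"
    have Ei: "av (coeff E i) \<le> max 1 (av b)" for i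
      unfolding E_def using Fi[of i] Gi[of i] mult_left_le[of "av (coeff G i)" "av b"]
      by (auto intro!: av.diff_le simp: av.mult le_max_iff_disj)
    have bE: "av (coeff E (Suc i)) * r ^ Suc i \<le> max r (av b)" for i
    proof -
      have "av (coeff E (Suc i)) * r ^ Suc i \<le> max 1 (av b) * r"
        using Ei[of "Suc i"] rpow[of i] r by (intro mult_mono) auto
      also have "\<dots> \<le> max r (av b)"
        using r F0(2) mult_left_le[of r "av b"] by (auto simp: max_def)
      finally show ?thesis .
    qed
    have "s E = max (av b) r"
    proof (rule antisym)
      show "s E \<le> max (av b) r"
        unfolding s_def
      proof (rule av.gnorm_le)
        fix i
        show "av (coeff E i) * r ^ i \<le> max (av b) r"
        proof (cases i)
          case 0
          have "av (coeff E 0) \<le> max (av b) r"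
            unfolding E_def using F0(1) G0 by (auto intro!: av.diff_le simp: av.mult)
          then show ?thesis
            using 0 by simp
        next
          case (Suc j)
          then show ?thesis
            using bE[of j] by (simp add: max.commute)
        qed
      qed
      show "max (av b) r \<le> s E"
      proof (cases "r < av b")
        case True
        then have "av (coeff E 0) = av b"
          using av.add_eq_dominant[of "coeff F 0" "- (b * coeff G 0)"] F0(1) G0
          by (simp add: E_def av.mult)
        then show ?thesis
          using True av.gnorm_ge[OF r, of E 0] by (simp add: s_def)
      next
        case False
        then have "av (b * coeff G 1) < 1"
          using mult_left_le[of "av (coeff G 1)" "av b"] Gi[of 1] F0(2) by (simp add: av.mult)
        then have "av (coeff E 1) = 1"
          using av.eq_if_close[of "coeff E 1" "coeff F 1"] F1 by (simp add: E_def)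
        then show ?thesis
          using False av.gnorm_ge[OF r, of E 1] by (simp add: s_def)
      qed
    qed
    moreover have "s [:-b, 1:] = max (av b) r"
      unfolding s_def by (simp add: av.gnorm_linear r)
    moreover have "s' [:-b, 1:] = s E"
      using k[of 1 "- b"] \<open>k = 1\<close> s'(1) by (simp add: E_def)
    ultimately show "s' [:-b, 1:] = s [:-b, 1:]"
      by simp
  qed
  then show ?thesis
    using s' ds by simp
qed

text \<open>On the open disk F and G differ from their constant terms by less than 1. The image
  therefore stays in the residue disk of F_0 / G_0, or in that of infinity when G_0 is not a
  unit.\<close>

lemma good_pair_maps_disk:
  assumes FG: "good_pair d F G"
  obtains m where "unimod m"
    "\<And>z w. z \<in> open_disk \<Longrightarrow> maps_to d F G z w \<Longrightarrow> w \<in> direction m"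
proof -
  have F: "gnorm av 1 F \<le> 1" and G: "gnorm av 1 G \<le> 1" and deg: "degree F \<le> d" "degree G \<le> d"
    using FG by (auto simp: good_pair_def)
  \<comment> \<open>The primitive pair (0, 1), at which the forms take their constant terms as
    values.\<close>
  have mx: "max (av (coeff F 0)) (av (coeff G 0)) = 1"
    using FG deg unfolding good_pair_def
    by (metis av.one av.zero hval_1_right max.absorb2 poly_0_coeff_0 zero_le_one)
  have approx: "s X = 1" if "av (coeff X 0) = 1" "gnorm av 1 X \<le> 1" "Fin s \<in> open_disk" for X s
  proof -
    have ms: "mseminorm av s" and T: "s [:0, 1:] < 1"
      using that by (auto simp: Fin_in_open_disk)
    interpret s: mult_seminorm s
      using ms mseminorm_iff by blast
    show ?thesis
      using s.eq_if_close[of X "[:coeff X 0:]"] mseminorm_const_approx[OF ms _ that(2)] T that(1) ms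
      by (simp add: mseminorm_def)
  qed
  have small: "s X < 1" if "av (coeff X 0) < 1" "gnorm av 1 X \<le> 1" "Fin s \<in> open_disk" for X s
  proof -
    have ms: "mseminorm av s" and T: "s [:0, 1:] < 1"
      using that by (auto simp: Fin_in_open_disk)
    interpret s: mult_seminorm s
      using ms mseminorm_iff by blast
    have "s (X - [:coeff X 0:]) < 1" "s [:coeff X 0:] < 1"
      using mseminorm_const_approx[OF ms _ that(2)] T that(1) ms by (simp_all add: mseminorm_def)
    then show ?thesis
      using s.add_lt[of "X - [:coeff X 0:]" 1 "[:coeff X 0:]"] by simp
  qed
  show ?thesis
  proof (cases "av (coeff G 0) = 1")
    case True
    define a where "a = coeff F 0 / coeff G 0"
    have ne: "coeff G 0 \<noteq> 0"
      using True by auto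
    have a: "av a \<le> 1"
      using mx True ne by (simp add: a_def av_divide max_def split: if_splits)
    have "w \<in> direction (1, a, 0, 1)" if z: "z \<in> open_disk" "maps_to d F G z w" for z w
    proof -
      obtain s where s: "z = Fin s"
        using z(1) by (cases z) auto
      obtain k where "0 < k" and k: "\<And>p q. s (smult p F + smult q G) = k * hnorm w 1 [:q, p:]"
        using maps_to_linear[OF z(2)] unfolding s hnorm_Fin by blast
      have "k * hnorm w 1 [:1:] = 1"
        using k[of 0 1] approx[OF True G, of s] z s by simp
      then obtain s' where s': "w = Fin s'" "mseminorm av s'"
        using maps_to_in_berk[OF z(2)] by (cases w) auto
      then have "k = 1"
        using \<open>k * hnorm w 1 [:1:] = 1\<close> by (simp add: mseminorm_def)
      have "gnorm av 1 (F - smult a G) \<le> 1"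
        using F G a by (intro g.diff_le) (simp_all add: gnorm_smult mult_le_one)
      moreover have "coeff (F - smult a G) 0 = 0"
        using ne by (simp add: a_def)
      ultimately have "s (F - smult a G) < 1"
        using small[of "F - smult a G" s] z(1) s by simp
      then have "s' [:-a, 1:] < 1"
        using k[of 1 "- a"] \<open>k = 1\<close> s' by simp
      then show ?thesis
        using in_translated_disk[OF s'(2)] s'(1) by (simp add: direction_def)
    qed
    then show ?thesis
      using that[OF unimod_translation[OF a]] by blast
  next
    case False
    then have lt: "av (coeff G 0) < 1" "av (coeff F 0) = 1"
      using mx by (auto simp: max_def split: if_splits)
    have "w \<in> direction (0, 1, 1, 0)" if z: "z \<in> open_disk" "maps_to d F G z w" for z w
    proof -
      obtain s where s: "z = Fin s"
        using z(1) by (cases z) auto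
      obtain k where k: "0 < k" "\<And>p q. s (smult p F + smult q G) = k * hnorm w 1 [:q, p:]"
        using maps_to_linear[OF z(2)] unfolding s hnorm_Fin by blast
      have "k * hnorm w 1 1 < k * hnorm w 1 [:0, 1:]"
        using k(2)[of 0 1] k(2)[of 1 0] approx[OF lt(2) F, of s] small[OF lt(1) G, of s] z s
        by (simp add: one_pCons)
      then have "hnorm w 1 1 < hnorm w 1 [:0, 1:]"
        using k(1) by simp
      then show ?thesis
        using in_infinite_disk[OF maps_to_in_berk[OF z(2)]] by (simp add: direction_def)
    qed
    then show ?thesis
      using that[OF unimod_inversion] by blast
  qed
qed

end

section \<open>Multiplicities and the conjugated map\<close>

lemma pcompose_power: "pcompose (p ^ k) q = pcompose p q ^ k"
  by (induction k) (simp_all add: pcompose_mult pcompose_1)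

lemma hom_one_right:
  assumes "degree F \<le> n"
  shows "hom n F U 1 = pcompose F U"
proof -
  have "pcompose F U = pcompose (\<Sum>i\<le>n. monom (coeff F i) i) U"
    using poly_as_sum_of_monoms'[OF assms] by simp
  also have "\<dots> = (\<Sum>i\<le>n. smult (coeff F i) (U ^ i))"
    by (simp add: pcompose_sum monom_altdef pcompose_smult pcompose_power pcompose_pCons)
  finally show ?thesis
    by (simp add: hom_def)
qed

context alg_closed_nonarch
begin

text \<open>After translating a to 0, residual divisibility by the k-th power says that the first k
  coefficients have absolute value below 1. A unit coefficient of \<open>R'\<close> bounds such k,
  so the \<open>GREATEST\<close> in \<open>ord_red\<close> is attained.\<close>

lemma ord_red_ge_2_iff:
  assumes a: "av a \<le> 1" and R: "gnorm av 1 R = 1"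
    and R': "R' = pcompose R [:a, 1:]" "av (coeff R' 0) < 1"
  shows "2 \<le> ord_red av a R \<longleftrightarrow> av (coeff R' 1) < 1"
proof -
  have X: "pcompose ([:-a, 1:] ^ k) [:a, 1:] = monom 1 k" for k
    by (simp add: pcompose_power pcompose_pCons monom_altdef)
  have "gnorm av 1 R' = 1"
    using R gnorm_shift[OF a] R'(1) by simp
  then obtain j where j: "av (coeff R' j) = 1" and R'1: "\<And>i. av (coeff R' i) \<le> 1"
    unfolding gnorm_eq_1_iff intp_def by blast
  define D where "D k \<longleftrightarrow> (\<exists>S. intp av S \<and> congm av R ([:-a, 1:] ^ k * S))" for k
  have D: "D k \<longleftrightarrow> (\<forall>i<k. av (coeff R' i) < 1)" for k
  proof
    assume "D k"
    then obtain S where S: "gnorm av 1 (R - [:-a, 1:] ^ k * S) < 1"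
      unfolding D_def congm_iff by blast
    have "pcompose (R - [:-a, 1:] ^ k * S) [:a, 1:] = R' - monom 1 k * pcompose S [:a, 1:]"
      by (simp add: pcompose_diff pcompose_mult X R')
    then have "gnorm av 1 (R' - monom 1 k * pcompose S [:a, 1:]) < 1"
      using S gnorm_shift[OF a] by metis
    then have "av (coeff (R' - monom 1 k * pcompose S [:a, 1:]) i) < 1" for i
      unfolding gnorm_lt_iff by blast
    then show "\<forall>i<k. av (coeff R' i) < 1"
      by (metis coeff_diff coeff_monom_mult diff_zero)
  next
    assume lt: "\<forall>i<k. av (coeff R' i) < 1"
    \<comment> \<open>Drop the k lowest coefficients, which are residually zero, and undo the
      translation.\<close>
    define S where "S = pcompose (poly_shift k R') [:-a, 1:]"
    have S: "pcompose S [:a, 1:] = poly_shift k R'"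
      unfolding S_def by (simp add: pcompose_assoc[symmetric] pcompose_pCons)
    have "gnorm av 1 (poly_shift k R') \<le> 1"
      unfolding intp_iff[symmetric] intp_def coeff_poly_shift using R'1 by blast
    then have "gnorm av 1 S \<le> 1"
      using gnorm_shift[OF a, of S] S by simp
    moreover have "gnorm av 1 (R' - monom 1 k * poly_shift k R') < 1"
      unfolding gnorm_lt_iff coeff_diff coeff_monom_mult coeff_poly_shift using lt by simp
    then have "gnorm av 1 (R - [:-a, 1:] ^ k * S) < 1"
      using gnorm_shift[OF a, of "R - [:-a, 1:] ^ k * S"]
      by (simp add: pcompose_diff pcompose_mult X S flip: R'(1))
    ultimately show "D k"
      unfolding D_def intp_iff congm_iff by blast
  qed
  have bound: "\<And>k. D k \<Longrightarrow> k \<le> j"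
    using D j by (metis not_le less_irrefl)
  have D0: "D 0"
    using D by simp
  have ord: "ord_red av a R = (GREATEST k. D k)"
    by (simp add: ord_red_def D_def)
  show ?thesis
  proof
    assume "2 \<le> ord_red av a R"
    moreover have "D (ord_red av a R)"
      unfolding ord by (rule GreatestI_nat[of D, OF D0 bound])
    ultimately show "av (coeff R' 1) < 1"
      unfolding D by simp
  next
    assume "av (coeff R' 1) < 1"
    then have "D 2"
      unfolding D using R'(2) by (auto simp: less_2_cases_iff)
    then show "2 \<le> ord_red av a R"
      unfolding ord by (rule Greatest_le_nat[of D, OF _ bound])
  qed
qed

text \<open>The form whose residual order of vanishing at 0 is the multiplicity of F / H there; it
  is alternating and bilinear in the pair.\<close>

definition cross :: "'a poly \<Rightarrow> 'a poly \<Rightarrow> 'a poly" where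
  "cross F H = smult (coeff H 0) F - smult (coeff F 0) H"

text \<open>Lifts match the map only residually and up to a unit c. Bilinearity turns c into its
  square and makes the remaining error small.\<close>

lemma cross_cong:
  assumes A: "gnorm av 1 A \<le> 1" and B: "gnorm av 1 B \<le> 1" and c: "av c = 1"
    and F: "gnorm av 1 (F - smult c A) < 1" and H: "gnorm av 1 (H - smult c B) < 1"
  shows "gnorm av 1 (cross F H - smult (c * c) (cross A B)) < 1"
proof -
  have F1: "gnorm av 1 F \<le> 1"
    using g.add_le[of "F - smult c A" 1 "smult c A"] F A c by (simp add: gnorm_smult)
  have H1: "gnorm av 1 H \<le> 1"
    using g.add_le[of "H - smult c B" 1 "smult c B"] H B c by (simp add: gnorm_smult)
  have sm: "gnorm av 1 (smult x p) < 1" if "av x \<le> 1" "gnorm av 1 p < 1" for x p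
    using that mult_right_mono[of "av x" 1 "gnorm av 1 p"] by (simp add: gnorm_smult)
  have sm': "gnorm av 1 (smult x p) < 1" if "av x < 1" "gnorm av 1 p \<le> 1" for x p
    using that mult_left_le[of "gnorm av 1 p" "av x"] by (simp add: gnorm_smult)
  have F0: "av (coeff F 0 - c * coeff A 0) < 1"
    using coeff_le_gnorm[of "F - smult c A" 0] F by simp
  have H0: "av (coeff H 0 - c * coeff B 0) < 1"
    using coeff_le_gnorm[of "H - smult c B" 0] H by simp
  have A0: "av (c * coeff A 0) \<le> 1" "av (c * coeff B 0) \<le> 1"
    using coeff_le_gnorm[of A 0] coeff_le_gnorm[of B 0] A B c by (simp_all add: av.mult)
  have "cross F H - smult (c * c) (cross A B)
      = (smult (coeff H 0 - c * coeff B 0) F + smult (c * coeff B 0) (F - smult c A))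
        - (smult (coeff F 0 - c * coeff A 0) H + smult (c * coeff A 0) (H - smult c B))"
    by (rule poly_eqI) (simp add: cross_def algebra_simps)
  then show ?thesis
    using sm[OF A0(1) H] sm[OF A0(2) F] sm'[OF F0 H1] sm'[OF H0 F1]
    by (metis g.add_lt g.diff_lt)
qed

text \<open>A change of target coordinates multiplies an alternating bilinear expression by the
  determinant.\<close>

lemma cross_unimod:
  "cross (smult a F + smult b H) (smult c F + smult e H) = smult (a * e - b * c) (cross F H)"
  by (rule poly_eqI) (simp add: cross_def algebra_simps)

text \<open>If the formal top coefficient vanishes, infinity is a zero; a root a outside the unit
  disk is rescaled to (1, 1 / a) to be primitive.\<close>

lemma form_has_zero:
  assumes "degree H \<le> d" "1 \<le> d"
  shows "\<exists>x y. max (av x) (av y) = 1 \<and> hval d H x y = 0"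
proof (cases "coeff H d = 0")
  case True
  then show ?thesis
    by (intro exI[of _ 1] exI[of _ 0]) (simp add: hval_0_right)
next
  case False
  then have "0 < degree H"
    using assms le_degree[of H d] by simp
  then obtain a where a: "poly H a = 0"
    using closed unfolding alg_closed_def by blast
  show ?thesis
  proof (cases "av a \<le> 1")
    case True
    then show ?thesis
      using a assms by (intro exI[of _ a] exI[of _ 1]) (simp add: hval_1_right)
  next
    case False
    then have "a \<noteq> 0"
      by auto
    moreover from this False have "av (1 / a) \<le> 1"
      by (simp add: av_divide)
    ultimately show ?thesis
      using a assms by (intro exI[of _ 1] exI[of _ "1 / a"]) (simp add: hval_eq)
  qed
qed

text \<open>If the cross form vanished modulo the maximal ideal, a zero of \<open>H\<close> would be a common zero
  of the reductions of \<open>F\<close> and \<open>H\<close>.\<close>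
lemma good_pair_cross:
  assumes FH: "good_pair d F H" and d: "1 \<le> d" and H0: "av (coeff H 0) = 1"
  shows "gnorm av 1 (cross F H) = 1"
proof (rule antisym)
  have F: "gnorm av 1 F \<le> 1" and H: "gnorm av 1 H \<le> 1" and deg: "degree F \<le> d" "degree H \<le> d"
    using FH by (auto simp: good_pair_def)
  have F0: "av (coeff F 0) \<le> 1"
    using coeff_le_gnorm[of F 0] F by simp
  show "gnorm av 1 (cross F H) \<le> 1"
    unfolding cross_def using F H F0 H0
    by (intro g.diff_le) (simp_all add: gnorm_smult mult_le_one)
  obtain x y where xy: "max (av x) (av y) = 1" "hval d H x y = 0"
    using form_has_zero[OF deg(2) d] by blast
  then have "max (av (hval d F x y)) (av (hval d H x y)) = 1"
    using FH unfolding good_pair_def by blast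
  then have "av (hval d F x y) = 1"
    using xy(2) by (simp add: max_def split: if_splits)
  moreover have "cross F H = smult (coeff H 0) F + smult (- coeff F 0) H"
    by (simp add: cross_def)
  then have "hval d (cross F H) x y = coeff H 0 * hval d F x y"
    using xy(2) by (simp add: hval_add hval_smult del: smult_minus_left)
  moreover have "av x \<le> 1" "av y \<le> 1"
    using xy(1) by (metis max.cobounded1, metis max.cobounded2)
  ultimately show "1 \<le> gnorm av 1 (cross F H)"
    using hval_le_gnorm[of x y d "cross F H"] H0 by (simp add: av.mult)
qed

section \<open>The conjugated map and its normalisation\<close>

lemma comp_pair_maps_to:
  assumes PQ: "coprime P Q" and d: "d = rdeg (P, Q)" "0 < d" and ok: "mob_ok s" "mob_ok t" and c: "c \<noteq> 0"
    and FH: "(F, H) = scale_rm c (comp_rm (mob (mob_inv t)) (comp_rm (P, Q) (mob s)))"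
  shows "degree F \<le> d" "degree H \<le> d"
    "w \<in> berk av \<Longrightarrow> maps_to d F H w (mact (mob_inv t) (bact av (P, Q) (mact s w)))"
proof -
  define U where "U = fst (mob s)"
  define V where "V = snd (mob s)"
  define U' where "U' = fst (mob (mob_inv t))"
  define V' where "V' = snd (mob (mob_inv t))"
  have ok': "mob_ok (mob_inv t)"
    using ok mob_ok_inv by blast
  have degs: "degree U \<le> 1" "degree V \<le> 1" "degree U' \<le> 1" "degree V' \<le> 1" "degree P \<le> d" "degree Q \<le> d"
    using rdeg_mob[OF ok(1)] rdeg_mob[OF ok'] d
    by (auto simp: rdeg_def U_def V_def U'_def V'_def simp flip: One_nat_def)
  have F: "F = smult c (hom 1 U' (hom d P U V) (hom d Q U V))"
    and H: "H = smult c (hom 1 V' (hom d P U V) (hom d Q U V))"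
    using FH rdeg_mob[OF ok'] d(1)
    by (simp_all add: scale_rm_def comp_rm_def U_def V_def U'_def V'_def)
  have "degree (hom 1 X (hom d P U V) (hom d Q U V)) \<le> 1 * (d * 1)" for X
    using degs by (intro degree_hom_le) auto
  then show "degree F \<le> d" "degree H \<le> d"
    unfolding F H using c by auto
  assume w: "w \<in> berk av"
  define y where "y = bact av (P, Q) (mact s w)"
  have sw: "mact s w \<in> berk av"
    using mact_in_berk[OF ok(1) w] .
  have y: "y \<in> berk av"
    unfolding y_def using bact_in_berk[OF PQ _ sw] d by simp
  have 1: "maps_to 1 U V w (mact s w)"
    unfolding U_def V_def by (rule maps_to_mact[OF ok(1) w])
  have 2: "maps_to d P Q (mact s w) y"
    unfolding y_def d(1) using maps_to_bact[OF PQ _ sw] d by simp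
  have 3: "maps_to 1 U' V' y (mact (mob_inv t) y)"
    unfolding U'_def V'_def by (rule maps_to_mact[OF ok' y])
  have "maps_to (1 * (d * 1)) (hom 1 U' (hom d P U V) (hom d Q U V)) (hom 1 V' (hom d P U V) (hom d Q U V))
      w (mact (mob_inv t) y)"
    using maps_to_comp[OF maps_to_comp[OF 1 2 degs(5,6)] 3 degs(3,4)] .
  then show "maps_to d F H w (mact (mob_inv t) (bact av (P, Q) (mact s w)))"
    unfolding F H y_def[symmetric] using maps_to_smult[OF _ c w] by simp
qed

text \<open>At a common root all combinations of F and H vanish, but no point of the line kills all
  linear forms. This gives the coprimality demanded by \<open>normalized\<close> without computing
  resultants.\<close>

lemma maps_to_coprime:
  assumes "\<And>w. w \<in> berk av \<Longrightarrow> \<exists>x. maps_to d F H w x"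
  shows "coprime F H"
  unfolding coprime_iff_no_common_root
proof
  assume "\<exists>x. poly F x = 0 \<and> poly H x = 0"
  then obtain x where x: "poly F x = 0" "poly H x = 0"
    by blast
  have "type1_pt av x \<in> berk av"
    by (simp add: type1_pt_def mseminorm_type1)
  then obtain w where w: "maps_to d F H (type1_pt av x) w"
    using assms by blast
  obtain k where k: "0 < k"
    "\<And>a b. hnorm (type1_pt av x) d (smult a F + smult b H) = k * hnorm w 1 [:b, a:]"
    using maps_to_linear[OF w] by blast
  have "hnorm w 1 [:b, a:] = 0" for a b
    using k(1) k(2)[of a b] x by (simp add: type1_pt_def)
  from this[of 1 0] this[of 0 1] show False
    using maps_to_in_berk[OF w] by (cases w) (auto simp: mseminorm_def)
qed

lemma mact_affine_gauss:
  assumes "b \<noteq> 0"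
  shows "mact (b, a, 0, 1) (gauss_pt av) = disk_pt av a (av b)"
proof -
  have ok: "mob_ok (b, a, 0, 1)"
    using assms by (simp add: mob_ok_def)
  define w where "w = mact (b, a, 0, 1) (gauss_pt av)"
  have mt: "maps_to 1 [:a, b:] [:1, 0:] (gauss_pt av) w"
    using maps_to_mact[OF ok gauss_in_berk] by (simp add: w_def mob_def)
  obtain k where k: "\<And>p q. gnorm av 1 (smult p [:a, b:] + smult q [:1, 0:]) = k * hnorm w 1 [:q, p:]"
    using maps_to_linear[OF mt] unfolding gauss_pt_eq hnorm_Fin by blast
  have "k * hnorm w 1 [:1:] = 1"
    using k[of 0 1] by simp
  then obtain s where s: "w = Fin s" "mseminorm av s"
    using maps_to_in_berk[OF mt] by (cases w) auto
  then have "k = 1"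
    using \<open>k * hnorm w 1 [:1:] = 1\<close> by (simp add: mseminorm_def)
  have "s = (\<lambda>f. gnorm av (av b) (pcompose f [:a, 1:]))"
  proof (rule mseminorm_eqI[OF s(2) mseminorm_disk])
    fix x
    show "s [:-x, 1:] = gnorm av (av b) (pcompose [:-x, 1:] [:a, 1:])"
      using k[of 1 "- x"] s(1) \<open>k = 1\<close> by (simp add: av.gnorm_linear gnorm_disk_linear)
  qed simp
  then show ?thesis
    using s(1) by (simp add: w_def disk_pt_eq)
qed

lemma normalizing_factor:
  assumes "coprime F H"
  obtains c where "c \<noteq> 0" "normalized av (smult c F, smult c H)"
proof -
  define M where "M = max (gnorm av 1 F) (gnorm av 1 H)"
  obtain i j where ij: "av (coeff F i) = gnorm av 1 F" "av (coeff H j) = gnorm av 1 H"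
    using av.gnorm_attained[of F 1] av.gnorm_attained[of H 1] by auto
  \<comment> \<open>The largest absolute value is attained by a coefficient, and its inverse is the
    normalising scalar.\<close>
  obtain e where e: "av e = M" "e = coeff F i \<or> e = coeff H j"
    using ij unfolding M_def max_def by metis
  have "F \<noteq> 0 \<or> H \<noteq> 0"
    using assms by auto
  then obtain l where "coeff F l \<noteq> 0 \<or> coeff H l \<noteq> 0"
    using leading_coeff_0_iff by blast
  then have "0 < av (coeff F l) \<or> 0 < av (coeff H l)"
    by simp
  then have M: "0 < M"
    using coeff_le_gnorm[of F l] coeff_le_gnorm[of H l] unfolding M_def by linarith
  then have e0: "e \<noteq> 0"
    using e by auto
  have "av (1 / e) = 1 / M"
    using e e0 by (simp add: av_divide)
  then have "gnorm av 1 (smult (1 / e) F) \<le> 1" "gnorm av 1 (smult (1 / e) H) \<le> 1"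
    using M by (simp_all add: gnorm_smult M_def)
  moreover have "av (1 / e * e) = 1"
    using e0 by simp
  then have "av (coeff (smult (1 / e) F) i) = 1 \<or> av (coeff (smult (1 / e) H) j) = 1"
    using e(2) by auto
  moreover have "coprime (smult (1 / e) F) (smult (1 / e) H)"
    using assms e0 unfolding coprime_iff_no_common_root by simp
  ultimately have "normalized av (smult (1 / e) F, smult (1 / e) H)"
    unfolding normalized_def intp_iff by auto
  then show ?thesis
    using that[of "1 / e"] e0 by simp
qed

lemma type1_pt_inj: "type1_pt av a = type1_pt av b \<Longrightarrow> a = b"
proof -
  assume "type1_pt av a = type1_pt av b"
  then have "av (poly [:-a, 1:] a) = av (poly [:-a, 1:] b)"
    unfolding type1_pt_def option.inject by (rule fun_cong)
  then show ?thesis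
    by simp
qed

lemma type1_set_berk: "z \<in> type1_set av \<Longrightarrow> z \<in> berk av"
  by (auto simp: type1_set_def type1_pt_def mseminorm_type1)

lemma mact_type1:
  assumes m: "mob_ok m" and z: "z \<in> type1_set av"
  shows "mact m z \<in> type1_set av"
proof (cases z)
  case None
  then show ?thesis
    by (simp add: bact_def type1_set_def)
next
  case (Some s')
  then obtain a where a: "z = type1_pt av a"
    using z by (auto simp: type1_set_def)
  define U where "U = fst (mob m)"
  define V where "V = snd (mob m)"
  have mt: "maps_to 1 U V z (mact m z)"
    unfolding U_def V_def by (rule maps_to_mact[OF m type1_set_berk[OF z]])
  obtain k where k: "0 < k" "\<And>p q. hnorm z 1 (smult p U + smult q V) = k * hnorm (mact m z) 1 [:q, p:]"
    using maps_to_linear[OF mt] by blast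
  show ?thesis
  proof (cases "mact m z")
    case None
    then show ?thesis
      by (simp add: type1_set_def)
  next
    case (Some s)
    then have s: "mseminorm av s"
      using maps_to_in_berk[OF mt] by simp
    have "av (poly V a) = k"
      using k(2)[of 0 1] Some s a by (simp add: type1_pt_def mseminorm_def)
    then have V: "poly V a \<noteq> 0"
      using k(1) by auto
    define b where "b = poly U a / poly V a"
    have "k * s [:-b, 1:] = 0"
      using k(2)[of 1 "- b"] Some a V by (simp add: type1_pt_def b_def)
    then have "mact m z = type1_pt av b"
      using mseminorm_zero_type1[OF s] Some k(1) by simp
    then show ?thesis
      by (simp add: type1_set_def)
  qed
qed

lemma mmul_assoc: "mmul (mmul l m) n = mmul l (mmul m n)"
  by (cases l; cases m; cases n) (simp add: mmul_def algebra_simps)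

end

section \<open>The theorem\<close>

locale fixed_totally_ramified = alg_closed_nonarch av
  for av :: "'a::field \<Rightarrow> real" +
  fixes P Q :: "'a poly" and xi :: "'a bpt"
  assumes coprime: "coprime P Q"
    and rdeg_ge_2: "rdeg (P, Q) \<ge> 2"
    and type2: "type2 av xi"
    and xi_fixed: "bact av (P, Q) xi = xi"
    and ramified: "mult_pt av (P, Q) xi = rdeg (P, Q)"
begin

abbreviation d :: nat where "d \<equiv> rdeg (P, Q)"
abbreviation phi :: "'a bpt \<Rightarrow> 'a bpt" where "phi \<equiv> bact av (P, Q)"

text \<open>Names for what \<open>SOME\<close> picks in \<open>loc_data\<close> and
  \<open>red_fact\<close>. Only the specified properties are available; in particular
  \<open>src\<close> and \<open>tgt\<close> may differ.\<close>

definition src where "src = fst (loc_data av (P, Q) xi)"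
definition tgt where "tgt = fst (snd (loc_data av (P, Q) xi))"
definition scal where "scal = snd (snd (loc_data av (P, Q) xi))"
definition locF where "locF = fst (loc_map av (P, Q) xi)"
definition locH where "locH = snd (loc_map av (P, Q) xi)"
definition redA where "redA = fst (red_fact av (locF, locH))"
definition redB where "redB = snd (red_fact av (locF, locH))"

text \<open>As \<open>xi\<close> is fixed, one affine frame carrying the Gauss point to the disk of
  \<open>xi\<close> serves at both source and target.\<close>

lemma loc_data_exists:
  "\<exists>s t c. mob_ok s \<and> mob_ok t \<and> c \<noteq> 0 \<and>
      mact s (gauss_pt av) = xi \<and> mact t (gauss_pt av) = phi xi \<and>
      normalized av (scale_rm c (comp_rm (mob (mob_inv t)) (comp_rm (P, Q) (mob s))))"
proof -
  obtain a b where ab: "b \<noteq> 0" "xi = disk_pt av a (av b)"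
    using type2 unfolding type2_def by auto
  define s :: "'a \<times> 'a \<times> 'a \<times> 'a" where "s = (b, a, 0, 1)"
  have s: "mob_ok s" "mact s (gauss_pt av) = xi"
    using ab mact_affine_gauss[OF ab(1)] by (simp_all add: s_def mob_ok_def)
  define Psi where "Psi = comp_rm (mob (mob_inv s)) (comp_rm (P, Q) (mob s))"
  have 1: "(fst Psi, snd Psi) = scale_rm 1 (comp_rm (mob (mob_inv s)) (comp_rm (P, Q) (mob s)))"
    by (simp add: scale_rm_def Psi_def)
  have "coprime (fst Psi) (snd Psi)"
    using comp_pair_maps_to(3)[OF coprime refl _ s(1) s(1) _ 1] rdeg_ge_2
    by (intro maps_to_coprime) fastforce
  then obtain c where "c \<noteq> 0" "normalized av (smult c (fst Psi), smult c (snd Psi))"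
    using normalizing_factor by blast
  then have "normalized av (scale_rm c Psi)" "c \<noteq> 0"
    by (simp_all add: scale_rm_def)
  then show ?thesis
    using s xi_fixed unfolding Psi_def
    by (intro exI[of _ s] exI[of _ c] conjI) simp_all
qed

lemma loc_spec:
  "mob_ok src" "mob_ok tgt" "scal \<noteq> 0" "mact src (gauss_pt av) = xi" "mact tgt (gauss_pt av) = xi"
  "normalized av (locF, locH)"
  "(locF, locH) = scale_rm scal (comp_rm (mob (mob_inv tgt)) (comp_rm (P, Q) (mob src)))"
proof -
  define L where "L = (\<lambda>(s, t, c). mob_ok s \<and> mob_ok t \<and> c \<noteq> 0 \<and>
      mact s (gauss_pt av) = xi \<and> mact t (gauss_pt av) = phi xi \<and>
      normalized av (scale_rm c (comp_rm (mob (mob_inv t)) (comp_rm (P, Q) (mob s)))))"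
  have "\<exists>s t c. L (s, t, c)"
    using loc_data_exists unfolding L_def prod.case .
  then have "\<exists>x. L x"
    by (elim exE) (rule exI)
  then have "L (SOME x. L x)"
    by (rule someI_ex)
  moreover have "(SOME x. L x) = (src, tgt, scal)"
    by (simp add: src_def tgt_def scal_def loc_data_def L_def)
  ultimately have L: "L (src, tgt, scal)"
    by simp
  show eq: "(locF, locH) = scale_rm scal (comp_rm (mob (mob_inv tgt)) (comp_rm (P, Q) (mob src)))"
    by (simp add: locF_def locH_def loc_map_def src_def tgt_def scal_def split_def)
  show "mob_ok src" "mob_ok tgt" "scal \<noteq> 0" "mact src (gauss_pt av) = xi" "mact tgt (gauss_pt av) = xi"
    "normalized av (locF, locH)"
    using L xi_fixed unfolding L_def eq by auto
qed

lemma red_degree_loc: "max (red_degree av redA) (red_degree av redB) = d"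
  using ramified
  by (simp add: mult_pt_def red_map_degree_def redA_def redB_def locF_def locH_def split_def)

lemma d_pos: "0 < d" "1 \<le> d"
  using rdeg_ge_2 by auto

lemma loc_degree: "degree locF \<le> d" "degree locH \<le> d"
  using comp_pair_maps_to(1,2)[OF coprime refl d_pos(1) loc_spec(1,2,3,7)] .

lemma loc_maps_to: "w \<in> berk av \<Longrightarrow> maps_to d locF locH w (mact (mob_inv tgt) (phi (mact src w)))"
  using comp_pair_maps_to(3)[OF coprime refl d_pos(1) loc_spec(1,2,3,7)] .

lemma loc_good:
  obtains c where "good_pair d locF locH" "av c = 1" "gnorm av 1 redA \<le> 1" "gnorm av 1 redB \<le> 1"
    "gnorm av 1 (locF - smult c redA) < 1" "gnorm av 1 (locH - smult c redB) < 1"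
proof -
  have "red_fact av (locF, locH) = (redA, redB)"
    by (simp add: redA_def redB_def)
  then show ?thesis
    using red_fact_good_pair[OF loc_spec(6) _ loc_degree red_degree_loc d_pos(2)] that by blast
qed

lemma xi_berk: "xi \<in> berk av"
  using mact_in_berk[OF loc_spec(1) gauss_in_berk] loc_spec(4) by simp

lemma phi_berk: "z \<in> berk av \<Longrightarrow> phi z \<in> berk av"
  using bact_in_berk[OF coprime d_pos(1)] .

lemma dirs_xi: "dirs av xi = {direction (mmul src m) | m. unimod m}"
  using dirs_eq[OF loc_spec(1)] loc_spec(4) by simp

text \<open>Only the source is moved by m: a residue point goes to 0 while the target frame stays
  \<open>tgt\<close>, matching the way \<open>dir_mult\<close> uses the lifts.\<close>

definition preF where "preF m = hom d locF (fst (mob m)) (snd (mob m))"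
definition preH where "preH m = hom d locH (fst (mob m)) (snd (mob m))"

text \<open>Since \<open>src\<close> and \<open>tgt\<close> both send the Gauss point to \<open>xi\<close>, they differ by an element
  of \<open>PGL\<^sub>2\<close> of the valuation ring, which does not change multiplicities.\<close>
lemma conj_pair:
  assumes m: "unimod m"
  obtains a b c e where "unimod (a, b, c, e)"
    "good_pair d (smult a (preF m) + smult b (preH m)) (smult c (preF m) + smult e (preH m))"
    "\<And>w. w \<in> berk av \<Longrightarrow> maps_to d
       (smult a (preF m) + smult b (preH m)) (smult c (preF m) + smult e (preH m))
       w (mact (mob_inv (mmul src m)) (phi (mact (mmul src m) w)))"
proof -
  note ok = unimod_mob_ok[OF m]
  define N where "N = mmul src m"
  have N: "mob_ok N"
    unfolding N_def using mob_ok_mmul[OF loc_spec(1) ok] .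
  have Nact: "mact N x = mact src (mact m x)" if "x \<in> berk av" for x
    unfolding N_def using mact_mmul[OF loc_spec(1) ok that] .
  \<comment> \<open>The discrepancy between the target frame \<open>tgt\<close> and the source frame
    N. Both send the Gauss point to \<open>xi\<close>, so n0 fixes it and is unimodular up to a
    scalar.\<close>
  define n0 where "n0 = mmul (mob_inv N) tgt"
  have n0: "mob_ok n0"
    unfolding n0_def using mob_ok_mmul[OF mob_ok_inv[OF N] loc_spec(2)] .
  have n0act: "mact n0 x = mact (mob_inv N) (mact tgt x)" if "x \<in> berk av" for x
    unfolding n0_def using mact_mmul[OF mob_ok_inv[OF N] loc_spec(2) that] .
  have "mact N (gauss_pt av) = xi"
    using Nact[OF gauss_in_berk] mact_gauss[OF m] loc_spec(4) by simp
  then have "mact n0 (gauss_pt av) = gauss_pt av"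
    using n0act[OF gauss_in_berk] loc_spec(5) mact_inv(1)[OF N gauss_in_berk] by simp
  then obtain k where k: "k \<noteq> 0" "unimod (mscale k n0)"
    using gauss_fixed_unimod[OF n0] by blast
  obtain a b c e where n: "mscale k n0 = (a, b, c, e)"
    by (cases "mscale k n0")
  have un: "unimod (a, b, c, e)"
    using k n by simp
  obtain p q r t where m': "m = (p, q, r, t)"
    by (cases m)
  have mob_m: "fst (mob m) = [:q, p:]" "snd (mob m) = [:t, r:]"
    by (simp_all add: m' mob_def)
  obtain c' where good: "good_pair d locF locH"
    using loc_good by blast
  have goodm: "good_pair d (preF m) (preH m)"
    using good_pair_right[OF _ good, of p q r t] m unfolding preF_def preH_def mob_m by (simp add: m')
  have "maps_to d (smult a (preF m) + smult b (preH m)) (smult c (preF m) + smult e (preH m))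
       w (mact (mob_inv N) (phi (mact N w)))" if w: "w \<in> berk av" for w
  proof -
    have mw: "mact m w \<in> berk av"
      using mact_in_berk[OF ok w] .
    define y where "y = phi (mact N w)"
    have y: "y \<in> berk av"
      unfolding y_def using phi_berk mact_in_berk[OF N w] by blast
    define x where "x = mact (mob_inv tgt) y"
    have x: "x \<in> berk av" "mact tgt x = y"
      unfolding x_def using mact_in_berk[OF mob_ok_inv[OF loc_spec(2)] y] mact_inv(2)[OF loc_spec(2) y]
      by auto
    have 1: "maps_to 1 (fst (mob m)) (snd (mob m)) w (mact m w)"
      using maps_to_mact[OF ok w] .
    have 2: "maps_to d locF locH (mact m w) x"
      using loc_maps_to[OF mw] Nact[OF w] by (simp add: x_def y_def)
    have 3: "maps_to 1 [:b, a:] [:e, c:] x (mact (mscale k n0) x)"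
      using maps_to_mact[OF unimod_mob_ok[OF k(2)] x(1)] by (simp add: n mob_def)
    have "maps_to (1 * (d * 1)) (hom 1 [:b, a:] (preF m) (preH m)) (hom 1 [:e, c:] (preF m) (preH m))
        w (mact (mscale k n0) x)"
      unfolding preF_def preH_def
      using maps_to_comp[OF maps_to_comp[OF 1 2 loc_degree] 3] by simp
    moreover have "mact (mscale k n0) x = mact (mob_inv N) y"
      using mact_mscale[OF n0 k(1) x(1)] n0act[OF x(1)] x(2) by simp
    ultimately show ?thesis
      unfolding hom_linear y_def by simp
  qed
  then show ?thesis
    using that[OF un good_pair_left[OF un goodm]] unfolding N_def by blast
qed

lemma phi_direction:
  assumes v: "v \<in> dirs av xi"
  shows "\<exists>w\<in>dirs av xi. phi ` v \<subseteq> w"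
proof -
  obtain m where m: "unimod m" "v = direction (mmul src m)"
    using v unfolding dirs_xi by blast
  define N where "N = mmul src m"
  have N: "mob_ok N"
    unfolding N_def using mob_ok_mmul[OF loc_spec(1) unimod_mob_ok[OF m(1)]] .
  obtain F H where FH: "good_pair d F H"
    "\<And>w. w \<in> berk av \<Longrightarrow> maps_to d F H w (mact (mob_inv N) (phi (mact N w)))"
    using conj_pair[OF m(1)] unfolding N_def by metis
  obtain m' where m': "unimod m'"
    "\<And>z w. z \<in> open_disk \<Longrightarrow> maps_to d F H z w \<Longrightarrow> w \<in> direction m'"
    using good_pair_maps_disk[OF FH(1)] by blast
  have "phi x \<in> direction (mmul N m')" if xv: "x \<in> v" for x
  proof -
    obtain w where w: "w \<in> open_disk" "x = mact N w"
      using xv m(2) by (auto simp: direction_def N_def)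
    have wb: "w \<in> berk av"
      using open_disk_berk[OF w(1)] .
    have "mact (mob_inv N) (phi x) \<in> direction m'"
      using m'(2)[OF w(1) FH(2)[OF wb]] w(2) by simp
    then have "mact N (mact (mob_inv N) (phi x)) \<in> mact N ` direction m'"
      by (rule imageI)
    moreover have "mact N (mact (mob_inv N) (phi x)) = phi x"
      using mact_inv(2)[OF N] phi_berk mact_in_berk[OF N wb] w(2) by simp
    ultimately show ?thesis
      using direction_mmul[OF N unimod_mob_ok[OF m'(1)]] by simp
  qed
  moreover have "direction (mmul N m') \<in> dirs av xi"
    unfolding dirs_xi N_def mmul_assoc using unimod_mmul[OF m(1) m'(1)] by blast
  ultimately show ?thesis
    by blast
qed

lemma dirs_overlap:
  "v \<in> dirs av xi \<Longrightarrow> w \<in> dirs av xi \<Longrightarrow> x \<in> v \<Longrightarrow> x \<in> w \<Longrightarrow> v = w"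
  using connected_components_of_overlap[of v _ w] unfolding dirs_def by auto

lemma tmap_fixed_iff:
  assumes v: "v \<in> dirs av xi"
  shows "tmap av (P, Q) xi v = v \<longleftrightarrow> phi ` v \<subseteq> v"
proof -
  obtain w where w: "w \<in> dirs av xi" "phi ` v \<subseteq> w"
    using phi_direction[OF v] by blast
  have "tmap av (P, Q) xi v = w"
    using tmap_eq[OF loc_spec(1) loc_spec(4)[symmetric] xi_fixed v w] .
  moreover have "v \<noteq> {}"
    using v nonempty_connected_components_of unfolding dirs_def by blast
  then have "phi ` v \<subseteq> v \<longleftrightarrow> w = v"
    using dirs_overlap[OF v w(1)] w(2) by blast
  ultimately show ?thesis
    by auto
qed

text \<open>\<open>dir_mult\<close> reads the residue class off an arbitrarily chosen type 1 point
  of v. Directions sharing a point coincide, so v is the residue disk around that point, whichever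
  one was chosen.\<close>

lemma dir_mult_eq:
  assumes v: "v \<in> dirs av xi"
  shows "(\<exists>a. av a \<le> 1 \<and> v = direction (mmul src (1, a, 0, 1)) \<and>
      dir_mult av (P, Q) xi v = ord_red av a (smult (poly redB a) redA - smult (poly redA a) redB)) \<or>
    (v = direction (mmul src (0, 1, 1, 0)) \<and>
      dir_mult av (P, Q) xi v = ord_red av 0 (smult (coeff redB d) (hom d redA 1 [:0, 1:])
         - smult (coeff redA d) (hom d redB 1 [:0, 1:])))"
proof -
  obtain m where m: "unimod m" "v = direction (mmul src m)"
    using v unfolding dirs_xi by blast
  have ok: "mob_ok (mmul src m)"
    using mob_ok_mmul[OF loc_spec(1) unimod_mob_ok[OF m(1)]] .
  define x where "x = (SOME x. x \<in> type1_set av \<and> x \<in> v)"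
  have "mact (mmul src m) (type1_pt av 0) \<in> type1_set av \<and> mact (mmul src m) (type1_pt av 0) \<in> v"
    using mact_type1[OF ok, of "type1_pt av 0"] type1_0_in_open_disk m(2)
    by (auto simp: type1_set_def direction_def)
  then have x: "x \<in> type1_set av" "x \<in> v"
    using someI[of "\<lambda>x. x \<in> type1_set av \<and> x \<in> v"] unfolding x_def by blast+
  have xb: "x \<in> berk av"
    using type1_set_berk[OF x(1)] .
  define y where "y = mact (mob_inv src) x"
  have y: "y \<in> type1_set av" "mact src y = x"
    unfolding y_def using mact_type1[OF mob_ok_inv[OF loc_spec(1)] x(1)] mact_inv(2)[OF loc_spec(1) xb]
    by auto
  have veq: "v = direction (mmul src n)" if n: "unimod n" "y \<in> direction n" for n
  proof -
    have "x \<in> direction (mmul src n)"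
      using direction_mmul[OF loc_spec(1) unimod_mob_ok[OF n(1)]] n(2) y(2) by auto
    moreover have "direction (mmul src n) \<in> dirs av xi"
      unfolding dirs_xi using n(1) by blast
    ultimately show ?thesis
      using dirs_overlap[OF v] x(2) by blast
  qed
  have ld: "loc_data av (P, Q) xi = (src, tgt, scal)"
    by (simp add: src_def tgt_def scal_def)
  have rf: "red_fact av (loc_map av (P, Q) xi) = (redA, redB)"
    by (simp add: redA_def redB_def locF_def locH_def)
  have dm: "dir_mult av (P, Q) xi v =
      (if \<exists>a. y = type1_pt av a \<and> av a \<le> 1
       then let a = (SOME a. y = type1_pt av a) in
         ord_red av a (smult (poly redB a) redA - smult (poly redA a) redB)
       else ord_red av 0 (smult (coeff redB d) (hom d redA 1 [:0, 1:])
         - smult (coeff redA d) (hom d redB 1 [:0, 1:])))"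
    unfolding dir_mult_def ld rf prod.case Let_def red_degree_loc x_def[symmetric] y_def[symmetric]
    by (rule refl)
  show ?thesis
  proof (cases "\<exists>a. y = type1_pt av a \<and> av a \<le> 1")
    case True
    then obtain a where a: "y = type1_pt av a" "av a \<le> 1"
      by blast
    have "(SOME a. y = type1_pt av a) = a"
      using a(1) type1_pt_inj by (intro some_equality) auto
    moreover have "y \<in> direction (1, a, 0, 1)"
      using in_translated_disk[OF mseminorm_type1, of a a] a(1) by (simp add: type1_pt_def direction_def)
    then have "v = direction (mmul src (1, a, 0, 1))"
      using veq unimod_translation[OF a(2)] by blast
    ultimately show ?thesis
      using dm True a(2) by (intro disjI1 exI[of _ a]) (simp add: Let_def)
  next
    case False
    have "hnorm y 1 1 < hnorm y 1 [:0, 1:]"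
      using y(1) False by (auto simp: type1_set_def type1_pt_def not_le)
    then have "y \<in> direction (0, 1, 1, 0)"
      using in_infinite_disk[OF type1_set_berk[OF y(1)]] by (simp add: direction_def)
    then have "v = direction (mmul src (0, 1, 1, 0))"
      using veq unimod_inversion by blast
    then show ?thesis
      using dm False by simp
  qed
qed

text \<open>Moving the residue point to 0, by a translation or by inversion, turns both branches of
  \<open>dir_mult\<close> into one criterion on \<open>cross\<close>. That the reduction of
  \<open>cross A B\<close> is nonzero stays a premise here; \<open>good_pair_cross\<close> supplies
  it once both frames agree.\<close>

lemma dir_mult_ge_2:
  assumes v: "v \<in> dirs av xi"
  obtains m A B c where "unimod m" "v = direction (mmul src m)" "av c = 1"
    "gnorm av 1 A \<le> 1" "gnorm av 1 B \<le> 1"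
    "gnorm av 1 (preF m - smult c A) < 1" "gnorm av 1 (preH m - smult c B) < 1"
    "gnorm av 1 (cross A B) = 1 \<longrightarrow>
       (2 \<le> dir_mult av (P, Q) xi v \<longleftrightarrow> av (coeff (cross A B) 1) < 1)"
proof -
  obtain c where c: "av c = 1" "gnorm av 1 redA \<le> 1" "gnorm av 1 redB \<le> 1"
    "gnorm av 1 (locF - smult c redA) < 1" "gnorm av 1 (locH - smult c redB) < 1"
    using loc_good by blast
  have cross0: "coeff (cross A B) 0 = 0" for A B
    by (simp add: cross_def)
  from dir_mult_eq[OF v] show ?thesis
  proof (elim disjE exE conjE)
    fix a assume a: "av a \<le> 1" "v = direction (mmul src (1, a, 0, 1))"
      and dm: "dir_mult av (P, Q) xi v = ord_red av a (smult (poly redB a) redA - smult (poly redA a) redB)"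
    define A where "A = pcompose redA [:a, 1:]"
    define B where "B = pcompose redB [:a, 1:]"
    have mob: "fst (mob (1, a, 0, 1)) = [:a, 1:]" "snd (mob (1, a, 0, 1)) = 1"
      by (simp_all add: mob_def one_pCons)
    have AB: "gnorm av 1 A \<le> 1" "gnorm av 1 B \<le> 1"
      unfolding A_def B_def gnorm_shift[OF a(1)] using c by auto
    have pre: "preF (1, a, 0, 1) - smult c A = pcompose (locF - smult c redA) [:a, 1:]"
      "preH (1, a, 0, 1) - smult c B = pcompose (locH - smult c redB) [:a, 1:]"
      unfolding preF_def preH_def mob hom_one_right[OF loc_degree(1)] hom_one_right[OF loc_degree(2)]
      by (simp_all add: A_def B_def pcompose_diff pcompose_smult)
    define R where "R = smult (poly redB a) redA - smult (poly redA a) redB"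
    have R: "cross A B = pcompose R [:a, 1:]"
      by (simp add: cross_def A_def B_def R_def pcompose_diff pcompose_smult)
    have "2 \<le> dir_mult av (P, Q) xi v \<longleftrightarrow> av (coeff (cross A B) 1) < 1" if "gnorm av 1 (cross A B) = 1"
      unfolding dm R_def[symmetric]
    proof (rule ord_red_ge_2_iff[OF a(1) _ R])
      show "gnorm av 1 R = 1"
        using that R gnorm_shift[OF a(1), of R] by simp
      show "av (coeff (cross A B) 0) < 1"
        unfolding cross0 by simp
    qed
    then show ?thesis
      using that[OF unimod_translation[OF a(1)] a(2) c(1) AB] c(4,5)
      unfolding pre gnorm_shift[OF a(1)] by blast
  next
    assume veq: "v = direction (mmul src (0, 1, 1, 0))"
      and dm: "dir_mult av (P, Q) xi v = ord_red av 0 (smult (coeff redB d) (hom d redA 1 [:0, 1:])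
         - smult (coeff redA d) (hom d redB 1 [:0, 1:]))"
    define A where "A = hom d redA 1 [:0, 1:]"
    define B where "B = hom d redB 1 [:0, 1:]"
    have mob: "fst (mob (0, 1, 1, 0)) = 1" "snd (mob (0, 1, 1, 0)) = [:0, 1:]"
      by (simp_all add: mob_def one_pCons)
    have i: "gnorm av 1 1 \<le> 1" "gnorm av 1 [:0, 1:] \<le> 1"
      by (simp_all add: av.gnorm_linear)
    have AB: "gnorm av 1 A \<le> 1" "gnorm av 1 B \<le> 1"
      unfolding A_def B_def using gnorm_hom_le[OF i] c(2,3) order_trans by blast+
    have "hom d locF 1 [:0, 1:] = hom d (locF - smult c redA) 1 [:0, 1:] + smult c A"
      "hom d locH 1 [:0, 1:] = hom d (locH - smult c redB) 1 [:0, 1:] + smult c B"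
      by (simp_all add: A_def B_def flip: hom_add hom_smult)
    then have pre: "preF (0, 1, 1, 0) - smult c A = hom d (locF - smult c redA) 1 [:0, 1:]"
      "preH (0, 1, 1, 0) - smult c B = hom d (locH - smult c redB) 1 [:0, 1:]"
      unfolding preF_def preH_def mob by (simp_all add: algebra_simps)
    have lt: "gnorm av 1 (preF (0, 1, 1, 0) - smult c A) < 1" "gnorm av 1 (preH (0, 1, 1, 0) - smult c B) < 1"
      unfolding pre using gnorm_hom_le[OF i] c(4,5) order.strict_trans1 by blast+
    have co: "coeff A 0 = coeff redA d" "coeff B 0 = coeff redB d"
      by (simp_all add: A_def B_def poly_hom hval_0_right flip: poly_0_coeff_0)
    have R: "cross A B = smult (coeff redB d) (hom d redA 1 [:0, 1:])
         - smult (coeff redA d) (hom d redB 1 [:0, 1:])"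
      unfolding cross_def co by (simp add: A_def B_def)
    have "2 \<le> dir_mult av (P, Q) xi v \<longleftrightarrow> av (coeff (cross A B) 1) < 1" if "gnorm av 1 (cross A B) = 1"
      unfolding dm R[symmetric] using that cross0 by (intro ord_red_ge_2_iff) simp_all
    then show ?thesis
      using that[OF unimod_inversion veq c(1) AB lt] by blast
  qed
qed

text \<open>The normal form for an invariant direction, with the same frame N at source and target.
  The criterion passes from \<open>cross A B\<close> to the source-translated pair by congruence up
  to a unit, and from there to \<open>cross F H\<close> by a unit determinant.\<close>

lemma residually_fixed_direction:
  assumes v: "v \<in> dirs av xi" and fixed: "phi ` v \<subseteq> v"
  obtains N F H where "mob_ok N" "v = direction N" "gnorm av 1 F \<le> 1" "gnorm av 1 H \<le> 1"
    "av (coeff F 0) < 1" "av (coeff H 0) = 1"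
    "2 \<le> dir_mult av (P, Q) xi v \<longleftrightarrow> av (coeff F 1) < 1"
    "\<And>w. w \<in> berk av \<Longrightarrow> maps_to d F H w (mact (mob_inv N) (phi (mact N w)))"
proof -
  obtain m A B c where m: "unimod m" "v = direction (mmul src m)" and c: "av c = 1"
    and AB: "gnorm av 1 A \<le> 1" "gnorm av 1 B \<le> 1"
    and cong: "gnorm av 1 (preF m - smult c A) < 1" "gnorm av 1 (preH m - smult c B) < 1"
    and dm: "gnorm av 1 (cross A B) = 1 \<longrightarrow>
       (2 \<le> dir_mult av (P, Q) xi v \<longleftrightarrow> av (coeff (cross A B) 1) < 1)"
    using dir_mult_ge_2[OF v] by metis
  define N where "N = mmul src m"
  have N: "mob_ok N"
    unfolding N_def using mob_ok_mmul[OF loc_spec(1) unimod_mob_ok[OF m(1)]] .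
  obtain a b c' e where n: "unimod (a, b, c', e)"
    and good: "good_pair d (smult a (preF m) + smult b (preH m)) (smult c' (preF m) + smult e (preH m))"
    and maps: "\<And>w. w \<in> berk av \<Longrightarrow> maps_to d
       (smult a (preF m) + smult b (preH m)) (smult c' (preF m) + smult e (preH m))
       w (mact (mob_inv (mmul src m)) (phi (mact (mmul src m) w)))"
    using conj_pair[OF m(1)] by metis
  define F where "F = smult a (preF m) + smult b (preH m)"
  define H where "H = smult c' (preF m) + smult e (preH m)"
  have good: "good_pair d F H"
    using good unfolding F_def H_def .
  have maps: "maps_to d F H w (mact (mob_inv N) (phi (mact N w)))" if "w \<in> berk av" for w
    using maps[OF that] unfolding F_def H_def N_def .
  have FH: "gnorm av 1 F \<le> 1" "gnorm av 1 H \<le> 1" "degree F \<le> d" "degree H \<le> d"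
    using good by (auto simp: good_pair_def)
  have mx: "max (av (coeff F 0)) (av (coeff H 0)) = 1"
    using good FH unfolding good_pair_def
    by (metis av.one av.zero hval_1_right max.absorb2 poly_0_coeff_0 zero_le_one)
  \<comment> \<open>The centre of the disk as test point: its image lies in the disk exactly when
    |F_0| < |H_0|, and the larger of the two is 1.\<close>
  define o1 where "o1 = type1_pt av 0"
  have o1: "o1 \<in> open_disk" "o1 \<in> berk av"
    using type1_0_in_open_disk open_disk_berk by (auto simp: o1_def)
  have "mact N o1 \<in> v"
    using o1 m(2) by (auto simp: direction_def N_def)
  then have "phi (mact N o1) \<in> direction N"
    using fixed m(2) unfolding N_def by blast
  then have "mact (mob_inv N) (phi (mact N o1)) \<in> open_disk"
    unfolding direction_iff[OF N] by blast
  then have "av (coeff F 0) < av (coeff H 0)"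
    unfolding maps_to_open_disk_iff[OF maps[OF o1(2)]]
    by (simp add: o1_def type1_pt_def poly_0_coeff_0)
  then have F0: "av (coeff F 0) < 1" and H0: "av (coeff H 0) = 1"
    using mx by (auto simp: max_def split: if_splits)
  have det: "av (a * e - b * c') = 1"
    using n by (simp add: unimod_def)
  have crossFH: "cross F H = smult (a * e - b * c') (cross (preF m) (preH m))"
    unfolding F_def H_def by (rule cross_unimod)
  have av_cross: "av (coeff (cross F H) i) = av (coeff (cross (preF m) (preH m)) i)" for i
    unfolding crossFH using det by (simp add: av.mult)
  have cc: "gnorm av 1 (cross (preF m) (preH m) - smult (c * c) (cross A B)) < 1"
    by (rule cross_cong[OF AB c cong])
  have "gnorm av 1 (cross F H) = 1"
    by (rule good_pair_cross[OF good d_pos(2) H0])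
  then have "gnorm av 1 (cross (preF m) (preH m)) = 1"
    unfolding crossFH gnorm_smult det by simp
  then have AB1: "gnorm av 1 (cross A B) = 1"
    using congm_gnorm[OF cc] c by (simp add: gnorm_smult av.mult)
  have le: "av (coeff X i) \<le> 1" if "gnorm av 1 X = 1" for X i
    using coeff_le_gnorm[of X i] that by simp
  have "av (coeff (cross A B) 1) < 1 \<longleftrightarrow> av (coeff (cross F H) 1) < 1"
    using congm_coeff[OF cc, of 1] c le[OF AB1, of 1] le[OF \<open>gnorm av 1 (cross F H) = 1\<close>, of 1] av_cross[of 1]
    by (auto simp: av.mult order_le_less)
  also have "\<dots> \<longleftrightarrow> av (coeff F 1) < 1"
  proof -
    have "av (coeff H 1) \<le> 1"
      using coeff_le_gnorm[of H 1] FH(2) by simp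
    then have lt: "av (coeff F 0 * coeff H 1) < 1"
      using F0 mult_left_le[of "av (coeff H 1)" "av (coeff F 0)"] by (simp add: av.mult)
    \<comment> \<open>H_0 is a unit and F_0 H_1 is small, so this coefficient is below 1 exactly
      when F_1 is.\<close>
    have eq: "coeff (cross F H) 1 = coeff H 0 * coeff F 1 - coeff F 0 * coeff H 1"
      by (simp add: cross_def)
    have "av (coeff H 0 * coeff F 1) < 1 \<longleftrightarrow> av (coeff (cross F H) 1) < 1"
      using av.diff_lt[OF _ lt, of "coeff H 0 * coeff F 1"] av.add_lt[OF _ lt, of "coeff (cross F H) 1"]
      unfolding eq by auto
    then show ?thesis
      using H0 by (simp add: av.mult)
  qed
  finally have "2 \<le> dir_mult av (P, Q) xi v \<longleftrightarrow> av (coeff F 1) < 1"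
    using dm AB1 by simp
  then show ?thesis
    using that[OF N _ FH(1,2) F0 H0 _ maps] m(2) unfolding N_def by blast
qed

section \<open>Counting fixed points\<close>

lemma multiple_direction_fixed_type1:
  assumes v: "v \<in> dirs av xi" "phi ` v \<subseteq> v" and mult: "2 \<le> dir_mult av (P, Q) xi v"
    and z: "z \<in> v" "phi z = z"
  shows "z \<in> type1_set av"
proof -
  obtain N F H where N: "mob_ok N" "v = direction N" and FH: "gnorm av 1 F \<le> 1" "gnorm av 1 H \<le> 1"
    "av (coeff F 0) < 1" "av (coeff H 0) = 1"
    and dm: "2 \<le> dir_mult av (P, Q) xi v \<longleftrightarrow> av (coeff F 1) < 1"
    and maps: "\<And>w. w \<in> berk av \<Longrightarrow> maps_to d F H w (mact (mob_inv N) (phi (mact N w)))"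
    using residually_fixed_direction[OF v] by metis
  obtain w where w: "w \<in> open_disk" "z = mact N w"
    using z(1) N(2) by (auto simp: direction_def)
  then obtain s where s: "w = Fin s"
    by (cases w) auto
  have wb: "w \<in> berk av"
    using open_disk_berk[OF w(1)] .
  have "maps_to d F H w w"
    using maps[OF wb] z(2) mact_inv(1)[OF N(1) wb] unfolding w(2) by simp
  then obtain a where "w = type1_pt av a"
    using fixed_in_disk_type1[OF FH _ _ ] dm mult w(1) s by blast
  then show ?thesis
    using mact_type1[OF N(1), of w] w(2) by (simp add: type1_set_def)
qed

lemma simple_direction_infinite:
  assumes v: "v \<in> dirs av xi" "phi ` v \<subseteq> v" and simple: "\<not> 2 \<le> dir_mult av (P, Q) xi v"
  shows "infinite (fix_locus av (P, Q))"
proof -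
  obtain N F H where N: "mob_ok N" "v = direction N" and FH: "gnorm av 1 F \<le> 1" "gnorm av 1 H \<le> 1"
    "av (coeff F 0) < 1" "av (coeff H 0) = 1"
    and dm: "2 \<le> dir_mult av (P, Q) xi v \<longleftrightarrow> av (coeff F 1) < 1"
    and maps: "\<And>w. w \<in> berk av \<Longrightarrow> maps_to d F H w (mact (mob_inv N) (phi (mact N w)))"
    using residually_fixed_direction[OF v] by metis
  have F1: "av (coeff F 1) = 1"
    using dm simple coeff_le_gnorm[of F 1] FH(1) by linarith
  \<comment> \<open>Infinite because |F_0| < 1 strictly; the lower end is the smallest radius whose
    disk about 0 contains F_0.\<close>
  define I where "I = {av (coeff F 0)..<1}"
  define h where "h r = mact N (disk_pt av 0 r)" for r
  have I0: "0 \<le> r" if "r \<in> I" for r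
    using that av.nonneg[of "coeff F 0"] unfolding I_def atLeastLessThan_iff by linarith
  have db: "disk_pt av 0 r \<in> berk av" if "r \<in> I" for r
    using disk_pt_in_berk[OF I0[OF that]] .
  have "h r \<in> fix_locus av (P, Q)" if r: "r \<in> I" for r
  proof -
    have "mact (mob_inv N) (phi (h r)) = disk_pt av 0 r"
      using disk_fixed[OF FH(1,2) _ _ FH(4) F1 maps[OF db[OF r]]] r by (simp add: I_def h_def)
    then have "mact N (mact (mob_inv N) (phi (h r))) = h r"
      by (simp add: h_def)
    moreover have "h r \<in> berk av"
      unfolding h_def using mact_in_berk[OF N(1) db[OF r]] .
    ultimately show ?thesis
      using mact_inv(2)[OF N(1) phi_berk] by (simp add: fix_locus_def)
  qed
  then have "h ` I \<subseteq> fix_locus av (P, Q)"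
    by blast
  moreover have "inj_on h I"
  proof (rule inj_onI)
    fix r r' assume r: "r \<in> I" "r' \<in> I" "h r = h r'"
    then have "disk_pt av 0 r = disk_pt av 0 r'"
      using mact_inv(1)[OF N(1) db] unfolding h_def by metis
    \<comment> \<open>The value on T recovers the radius, so different radii give different fixed
      points.\<close>
    then have "gnorm av r [:0, 1:] = gnorm av r' [:0, 1:]"
      unfolding disk_pt_eq by (metis option.inject pcompose_idR)
    then show "r = r'"
      using I0[OF r(1)] I0[OF r(2)] by (simp add: av.gnorm_linear)
  qed
  moreover have "infinite I"
    unfolding I_def using FH(3) by (simp add: infinite_Ico)
  ultimately show ?thesis
    using finite_imageD finite_subset by blast
qed

text \<open>Finite fixed points are roots of P - T Q. If this vanished, coprimality would make Q
  constant and the degree at most 1.\<close>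

lemma finite_type1_fixed: "finite {z \<in> type1_set av. phi z = z}"
proof -
  define R where "R = P - pCons 0 Q"
  have "R \<noteq> 0"
  proof
    assume "R = 0"
    then have "P = [:0, 1:] * Q"
      by (simp add: R_def)
    then have "is_unit Q"
      using coprime by (metis coprime_common_divisor dvd_refl dvd_triv_right)
    then have "degree Q = 0"
      using is_unit_iff_degree[of Q] not_is_unit_0 by blast
    then have "degree P \<le> 1"
      using \<open>P = [:0, 1:] * Q\<close> degree_mult_le[of "[:0, 1:]" Q] by simp
    then show False
      using rdeg_ge_2 \<open>degree Q = 0\<close> by (simp add: rdeg_def)
  qed
  have "{z \<in> type1_set av. phi z = z} \<subseteq> insert Infty (type1_pt av ` {a. poly R a = 0})"
  proof
    fix z assume "z \<in> {z \<in> type1_set av. phi z = z}"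
    then have z: "z \<in> type1_set av" "phi z = z"
      by auto
    show "z \<in> insert Infty (type1_pt av ` {a. poly R a = 0})"
    proof (cases "z = Infty")
      case False
      then obtain a where a: "z = type1_pt av a"
        using z(1) by (auto simp: type1_set_def)
      have "maps_to d P Q z z"
        using maps_to_bact[OF coprime d_pos(1) type1_set_berk[OF z(1)]] z(2) by simp
      then obtain k where "\<And>p q. hnorm z d (smult p P + smult q Q) = k * hnorm z 1 [:q, p:]"
        using maps_to_linear by blast
      from this[of 1 "- a"] have "poly R a = 0"
        by (simp add: a type1_pt_def R_def)
      then show ?thesis
        using a by blast
    qed simp
  qed
  moreover have "finite {a. poly R a = 0}"
    using poly_roots_finite[OF \<open>R \<noteq> 0\<close>] .
  ultimately show ?thesis
    using finite_subset by blast
qed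

lemma fix_locus_eq:
  assumes "\<forall>v \<in> dirs av xi. tmap av (P, Q) xi v = v \<longrightarrow> 2 \<le> dir_mult av (P, Q) xi v"
  shows "fix_locus av (P, Q) = {z \<in> type1_set av. phi z = z} \<union> {xi}"
proof
  show "{z \<in> type1_set av. phi z = z} \<union> {xi} \<subseteq> fix_locus av (P, Q)"
    using type1_set_berk xi_berk xi_fixed by (auto simp: fix_locus_def)
  show "fix_locus av (P, Q) \<subseteq> {z \<in> type1_set av. phi z = z} \<union> {xi}"
  proof
    fix z assume "z \<in> fix_locus av (P, Q)"
    then have z: "z \<in> berk av" "phi z = z"
      by (auto simp: fix_locus_def)
    show "z \<in> {z \<in> type1_set av. phi z = z} \<union> {xi}"
    proof (cases "z = xi")
      case False
      have "\<Union>(dirs av xi) = berk av - {xi}"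
        unfolding dirs_def Union_connected_components_of by auto
      then obtain v where v: "v \<in> dirs av xi" "z \<in> v"
        using z(1) False by blast
      obtain w where w: "w \<in> dirs av xi" "phi ` v \<subseteq> w"
        using phi_direction[OF v(1)] by blast
      \<comment> \<open>A fixed point of v is its own image, so it lies in the direction receiving
        v, and that direction must be v.\<close>
      then have "z \<in> w"
        using v(2) z(2) by force
      then have inv: "phi ` v \<subseteq> v"
        using dirs_overlap[OF v(1) w(1) v(2)] w(2) by simp
      then have "2 \<le> dir_mult av (P, Q) xi v"
        using assms v(1) tmap_fixed_iff by blast
      then show ?thesis
        using multiple_direction_fixed_type1[OF v(1) inv _ v(2) z(2)] z(2) by simp
    qed simp
  qed
qed

lemma fix_locus_finite_iff:
  "(\<forall>v \<in> dirs av xi. tmap av (P, Q) xi v = v \<longrightarrow> 2 \<le> dir_mult av (P, Q) xi v)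
     \<longleftrightarrow> finite (fix_locus av (P, Q))"
proof
  assume "\<forall>v \<in> dirs av xi. tmap av (P, Q) xi v = v \<longrightarrow> 2 \<le> dir_mult av (P, Q) xi v"
  then show "finite (fix_locus av (P, Q))"
    using fix_locus_eq finite_type1_fixed by simp
next
  assume "finite (fix_locus av (P, Q))"
  then show "\<forall>v \<in> dirs av xi. tmap av (P, Q) xi v = v \<longrightarrow> 2 \<le> dir_mult av (P, Q) xi v"
    using simple_direction_infinite tmap_fixed_iff by blast
qed

end

theorem theorem3p11:
  fixes av :: "'a::field \<Rightarrow> real" and P Q :: "'a poly" and xi :: "'a bpt"
  assumes "ground_field av"
    and "coprime P Q"
    and "rdeg (P, Q) \<ge> 2"
    and "potential_good_reduction av (P, Q)"
    and "type2 av xi"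
    and "bact av (P, Q) xi = xi"
    and "mult_pt av (P, Q) xi = rdeg (P, Q)"
  shows "((\<forall>v \<in> dirs av xi. tmap av (P, Q) xi v = v \<longrightarrow> dir_mult av (P, Q) xi v \<ge> 2)
            \<longleftrightarrow> finite (fix_locus av (P, Q)))
         \<and> (finite (fix_locus av (P, Q)) \<longrightarrow>
            fix_locus av (P, Q) = {z \<in> type1_set av. bact av (P, Q) z = z} \<union> {xi})"
proof -
  interpret fixed_totally_ramified av P Q xi
    using assms by unfold_locales (auto simp: ground_field_def)
  show ?thesis
    using fix_locus_finite_iff fix_locus_eq by blast
qed

end
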